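(* Let $0<n\le m$ be integers (not necessarily coprime), $d=\gcd(n,m)$, let $p,q$ be positive integers with $mp-nq=d$, and let $f(x,y)=y^n-x^m$. Let $\mathcal{F}_W\in Fol(f)$ be a foliation defined by a 1-form $$W=\mathrm{d}f+\bigl(\Delta(x,y)+f(x,y)g(x,y)\bigr)(nx\,\mathrm{d}y-my\,\mathrm{d}x),$$ where $g\in\mathbb{C}\{x,y\}$ and $\Delta(x,y)=\sum_{0\le i\le m-2,\;0\le j\le n-2}a_{i,j}x^iy^j$ with $a_{i,j}\in\mathbb{C}$. Suppose that $\mathcal{F}_W$ is of the second type. Then $\mathcal{F}_W$ is a generalized curve foliation if and only if, for every $\xi\in\mathbb{C}$ with $\xi^d=1$, $$1+\sum_{n(r+1)+m(s+1)=mn}a_{r,s}\,\xi^{\,p(r+1)+q(s+1)-qn}\notin\mathbb{Q}^{-}\cup\{0\},$$ where the sum runs over the pairs $(r,s)$ with $0\le r\le m-2$, $0\le s\le n-2$ and $n(r+1)+m(s+1)=mn$.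
   Context: $\mathbb{Q}^{+}$ and $\mathbb{Q}^{-}$ denote the positive and the negative rationals. A singular holomorphic foliation at the origin $\mathcal{F}_W:\{W=0\}$ is given by a 1-form $W=R\,\mathrm{d}x+S\,\mathrm{d}y$ with $R,S\in\mathbb{C}\{x,y\}$ without common factors and $R(0,0)=S(0,0)=0$. A separatrix of $\mathcal{F}_W$ is a branch $\{g=0\}$ ($g\in\mathbb{C}\{x,y\}$ irreducible non-unit) such that $g$ divides $W\wedge \mathrm{d}g$ (i.e. divides its coefficient with respect to $\mathrm{d}x\wedge \mathrm{d}y$). $\mathcal{F}_W$ is nondicritical if it has finitely many separatrices; if these are $\{f_i=0\}$, $1\le i\le r$ (distinct), its union of separatrices is the reduced curve $\{f_1\cdots f_r=0\}$. For $f$ reduced, $[Fol(f)]$ is the set of 1-forms $W$ defining a nondicritical foliation $\mathcal{F}_W$ such that $f$ divides $W\wedge \mathrm{d}f$, and $Fol(f)$ is the set of foliations defined by elements of $[Fol(f)]$ whose union of separatrices is $\{f=0\}$. Let $\lambda_1,\lambda_2$ be the eigenvalues of $\begin{pmatrix}-S_x(0,0)&-S_y(0,0)\\ R_x(0,0)&R_y(0,0)\end{pmatrix}$. The singularity at the origin is irreducible if either $\lambda_1\lambda_2\ne0$ and $\lambda_1/\lambda_2\notin\mathbb{Q}^{+}$ (simple), or exactly one of $\lambda_1,\lambda_2$ is zero (saddle-node). The reduction of singularities (Seidenberg) of $\mathcal{F}_W$ is the finite composition of point blow-ups after which all singularities of the strict transform are irreducible. $\mathcal{F}_W$ is a generalized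 curve foliation if no saddle-nodes appear in its reduction of singularities. $\mathcal{F}_W$ is of the second type (Mattei--Salem) if saddle-nodes are admitted in its reduction of singularities provided that they lie in the regular part of the exceptional divisor (i.e. not at its corners) and that their weak separatrices (the separatrices associated with the zero eigenvalue) are transversal to the divisor. *)

theory Defs
  imports "HOL-Analysis.Analysis" "HOL-Computational_Algebra.Computational_Algebra"
begin

section \<open>Formal power series in two variables\<close>

text \<open>A series in x and y is a power series in x whose coefficients are power series in y.\<close>

type_synonym fps2 = "complex fps fps"

definition coeff2 :: "fps2 \<Rightarrow> nat \<Rightarrow> nat \<Rightarrow> complex" where
  "coeff2 h i j = fps_nth (fps_nth h i) j"

definition fps2_dx :: "fps2 \<Rightarrow> fps2" where
  "fps2_dx h = fps_deriv h"

definition fps2_dy :: "fps2 \<Rightarrow> fps2" where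
  "fps2_dy h = Abs_fps (\<lambda>i. fps_deriv (fps_nth h i))"

text \<open>The composition h(a,b), for a and b without constant term. The monomial a^i b^j has order
  at least i + j, so only finitely many (i,j) contribute to a given coefficient.\<close>

definition fps2_subst :: "fps2 \<Rightarrow> fps2 \<Rightarrow> fps2 \<Rightarrow> fps2" where
  "fps2_subst h a b = Abs_fps (\<lambda>k. Abs_fps (\<lambda>l.
     \<Sum>i\<le>k + l. \<Sum>j\<le>k + l. coeff2 h i j * coeff2 (a ^ i * b ^ j) k l))"

definition convergent2 :: "fps2 \<Rightarrow> bool" where
  "convergent2 h \<longleftrightarrow> (\<exists>r>0. (\<lambda>(i, j). norm (coeff2 h i j) * r ^ (i + j)) summable_on UNIV)"


subsection \<open>Closure properties of convergent series\<close>

definition wsum :: "('a::comm_ring_1 \<Rightarrow> real) \<Rightarrow> nat \<Rightarrow> real \<Rightarrow> 'a fps \<Rightarrow> real" where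
  "wsum v N r a = (\<Sum>i\<le>N. v (fps_nth a i) * r ^ i)"

definition seminormlike :: "('a::comm_ring_1 \<Rightarrow> real) \<Rightarrow> bool" where
  "seminormlike v \<longleftrightarrow> v 0 = 0 \<and> v 1 = 1 \<and> (\<forall>x. 0 \<le> v x) \<and> (\<forall>x. v (- x) = v x) \<and>
     (\<forall>x y. v (x + y) \<le> v x + v y) \<and> (\<forall>x y. v (x * y) \<le> v x * v y)"

lemma seminormlike_sum:
  assumes "seminormlike v"
  shows "v (sum f A) \<le> (\<Sum>x\<in>A. v (f x))"
proof (induction A rule: infinite_finite_induct)
  case (insert x F)
  have "v (f x + sum f F) \<le> v (f x) + v (sum f F)"
    using assms by (simp add: seminormlike_def)
  then show ?case using insert by simp
qed (use assms in \<open>auto simp: seminormlike_def\<close>)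

lemma wsum_mult:
  assumes v: "seminormlike v" and r: "0 \<le> r"
  shows "wsum v N r (a * b) \<le> wsum v N r a * wsum v N r b"
proof -
  let ?a = "\<lambda>i. v (fps_nth a i) * r ^ i" and ?b = "\<lambda>i. v (fps_nth b i) * r ^ i"
  have nn: "0 \<le> v x" for x using v by (simp add: seminormlike_def)
  have "v (fps_nth (a * b) n) * r ^ n \<le> (\<Sum>i\<le>n. ?a i * ?b (n - i))" for n
  proof -
    have "v (fps_nth (a * b) n) \<le> (\<Sum>i=0..n. v (fps_nth a i * fps_nth b (n - i)))"
      unfolding fps_mult_nth by (rule seminormlike_sum[OF v])
    also have "\<dots> \<le> (\<Sum>i=0..n. v (fps_nth a i) * v (fps_nth b (n - i)))"
      using v by (intro sum_mono) (simp add: seminormlike_def)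
    finally have "v (fps_nth (a * b) n) * r ^ n
        \<le> (\<Sum>i=0..n. v (fps_nth a i) * v (fps_nth b (n - i))) * r ^ n"
      using r by (intro mult_right_mono) auto
    also have "\<dots> = (\<Sum>i\<le>n. ?a i * ?b (n - i))"
      unfolding sum_distrib_right atLeast0AtMost
      by (intro sum.cong refl) (auto simp: power_add[symmetric] mult_ac)
    finally show ?thesis .
  qed
  then have "wsum v N r (a * b) \<le> (\<Sum>n\<le>N. \<Sum>i\<le>n. ?a i * ?b (n - i))"
    unfolding wsum_def by (intro sum_mono) auto
  also have "\<dots> = (\<Sum>(i,j)\<in>{(i,j). i + j \<le> N}. ?a i * ?b j)"
    by (rule sum.triangle_reindex_eq[symmetric])
  also have "\<dots> \<le> (\<Sum>(i,j)\<in>{..N} \<times> {..N}. ?a i * ?b j)"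
    using nn r by (intro sum_mono2) (auto intro!: mult_nonneg_nonneg)
  also have "\<dots> = wsum v N r a * wsum v N r b"
    by (simp add: wsum_def sum_product sum.cartesian_product)
  finally show ?thesis .
qed

lemma seminormlike_wsum:
  assumes v: "seminormlike v" and r: "0 \<le> r"
  shows "seminormlike (wsum v N r)"
proof -
  have "wsum v N r 1 = (\<Sum>i\<le>N. if i = 0 then 1 else 0)"
    unfolding wsum_def using v by (intro sum.cong refl) (auto simp: seminormlike_def)
  then have "wsum v N r 1 = 1" by simp
  moreover have "wsum v N r 0 = 0" "wsum v N r (- a) = wsum v N r a" "0 \<le> wsum v N r a" for a
    using v r by (auto simp: wsum_def seminormlike_def intro!: sum_nonneg)
  moreover have "wsum v N r (a + b) \<le> wsum v N r a + wsum v N r b" for a b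
    unfolding wsum_def sum.distrib[symmetric] distrib_right[symmetric]
    using v r by (auto simp: seminormlike_def intro!: sum_mono mult_right_mono)
  ultimately show ?thesis
    using wsum_mult[OF v r] unfolding seminormlike_def by blast
qed

definition box_sum :: "nat \<Rightarrow> real \<Rightarrow> fps2 \<Rightarrow> real" where
  "box_sum N r = wsum (wsum norm N r) N r"

lemma seminormlike_box: "0 \<le> r \<Longrightarrow> seminormlike (box_sum N r)"
proof -
  have "seminormlike (norm :: complex \<Rightarrow> real)"
    by (auto simp: seminormlike_def norm_triangle_ineq norm_mult)
  then show "0 \<le> r \<Longrightarrow> seminormlike (box_sum N r)"
    unfolding box_sum_def by (intro seminormlike_wsum)
qed

lemma box_sum_altdef: "box_sum N r a = (\<Sum>i\<le>N. \<Sum>j\<le>N. norm (coeff2 a i j) * r ^ (i + j))"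
  by (simp add: box_sum_def wsum_def coeff2_def sum_distrib_left sum_distrib_right power_add mult_ac)

lemma box_sum_nonneg: "0 \<le> r \<Longrightarrow> 0 \<le> box_sum N r a"
  and box_sum_uminus: "0 \<le> r \<Longrightarrow> box_sum N r (- a) = box_sum N r a"
  and box_sum_add: "0 \<le> r \<Longrightarrow> box_sum N r (a + b) \<le> box_sum N r a + box_sum N r b"
  and box_sum_mult: "0 \<le> r \<Longrightarrow> box_sum N r (a * b) \<le> box_sum N r a * box_sum N r b"
  and box_sum_one: "0 \<le> r \<Longrightarrow> box_sum N r 1 = 1"
  and box_sum_zero: "0 \<le> r \<Longrightarrow> box_sum N r 0 = 0"
  using seminormlike_box[of r N] by (auto simp: seminormlike_def)

lemma box_sum_power:
  assumes "0 \<le> r"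
  shows "box_sum N r (a ^ n) \<le> box_sum N r a ^ n"
proof (induction n)
  case (Suc n)
  have "box_sum N r (a ^ Suc n) \<le> box_sum N r a * box_sum N r (a ^ n)"
    using box_sum_mult[OF assms] by simp
  also have "\<dots> \<le> box_sum N r a * box_sum N r a ^ n"
    using Suc box_sum_nonneg[OF assms] by (intro mult_left_mono) auto
  finally show ?case by simp
qed (use box_sum_one assms in simp)

lemma box_sum_mono: "0 \<le> r \<Longrightarrow> r \<le> s \<Longrightarrow> box_sum N r a \<le> box_sum N s a"
  unfolding box_sum_altdef by (intro sum_mono mult_left_mono power_mono) auto

lemma convergent2_iff: "convergent2 a \<longleftrightarrow> (\<exists>r>0. \<exists>B. \<forall>N. box_sum N r a \<le> B)"
proof
  let ?f = "\<lambda>r (i, j). norm (coeff2 a i j) * r ^ (i + j)"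
  have eq: "box_sum N r a = sum (?f r) ({..N} \<times> {..N})" for N r
    by (simp add: box_sum_altdef sum.cartesian_product)
  {
    assume "convergent2 a"
    then obtain r where r: "r > 0" "?f r summable_on UNIV"
      unfolding convergent2_def by blast
    have "box_sum N r a \<le> infsum (?f r) UNIV" for N
      unfolding eq using r by (intro finite_sum_le_infsum) auto
    then show "\<exists>r>0. \<exists>B. \<forall>N. box_sum N r a \<le> B" using r by blast
  next
    assume "\<exists>r>0. \<exists>B. \<forall>N. box_sum N r a \<le> B"
    then obtain r B where r: "r > 0" "\<And>N. box_sum N r a \<le> B" by blast
    have "?f r summable_on UNIV"
    proof (rule nonneg_bdd_above_summable_on)
      show "bdd_above (sum (?f r) ` {F. F \<subseteq> UNIV \<and> finite F})"
      proof (rule bdd_aboveI2)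
        fix F :: "(nat \<times> nat) set" assume "F \<in> {F. F \<subseteq> UNIV \<and> finite F}"
        then have F: "finite F" by simp
        define N where "N = Max (insert 0 (fst ` F \<union> snd ` F))"
        have "F \<subseteq> {..N} \<times> {..N}"
        proof
          fix z assume z: "z \<in> F"
          have "fst z \<le> N" "snd z \<le> N" unfolding N_def using F z by (auto intro!: Max_ge)
          then show "z \<in> {..N} \<times> {..N}" by (auto simp: mem_Times_iff)
        qed
        then have "sum (?f r) F \<le> sum (?f r) ({..N} \<times> {..N})"
          using r by (intro sum_mono2) auto
        also have "\<dots> \<le> B" using r(2)[of N] eq by simp
        finally show "sum (?f r) F \<le> B" .
      qed
    qed (use r in auto)
    then show "convergent2 a" using r unfolding convergent2_def by blast
  }
qed

lemma convergent2_common: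
  assumes "convergent2 a" "convergent2 b"
  obtains r A B where "r > 0" "\<And>N. box_sum N r a \<le> A" "\<And>N. box_sum N r b \<le> B"
proof -
  obtain r A where r: "r > 0" "\<And>N. box_sum N r a \<le> A" using assms convergent2_iff by blast
  obtain s B where s: "s > 0" "\<And>N. box_sum N s b \<le> B" using assms convergent2_iff by blast
  have "box_sum N (min r s) a \<le> A" "box_sum N (min r s) b \<le> B" for N
    using box_sum_mono[of "min r s" r N a] box_sum_mono[of "min r s" s N b] r(1) s(1) r(2)[of N] s(2)[of N]
    by auto
  with r(1) s(1) that[of "min r s" A B] show ?thesis by auto
qed

lemma convergent2_zero: "convergent2 0"
  and convergent2_one: "convergent2 1"
  unfolding convergent2_iff using box_sum_zero[of 1] box_sum_one[of 1]
  by (auto intro!: exI[of _ "1::real"])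

lemma convergent2_uminus: "convergent2 a \<Longrightarrow> convergent2 (- a)"
  unfolding convergent2_iff using box_sum_uminus by (metis less_imp_le)

lemma convergent2_add:
  assumes "convergent2 a" "convergent2 b" shows "convergent2 (a + b)"
proof -
  obtain r A B where r: "r > 0" "\<And>N. box_sum N r a \<le> A" "\<And>N. box_sum N r b \<le> B"
    using convergent2_common[OF assms] by blast
  have "box_sum N r (a + b) \<le> A + B" for N
    using box_sum_add[of r N a b] r(1) r(2)[of N] r(3)[of N] by linarith
  then show ?thesis unfolding convergent2_iff using r(1) by blast
qed

lemma convergent2_diff:
  "convergent2 a \<Longrightarrow> convergent2 b \<Longrightarrow> convergent2 (a - b)"
  using convergent2_add[of a "- b"] convergent2_uminus by simp

lemma convergent2_mult:
  assumes "convergent2 a" "convergent2 b" shows "convergent2 (a * b)"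
proof -
  obtain r A B where r: "r > 0" "\<And>N. box_sum N r a \<le> A" "\<And>N. box_sum N r b \<le> B"
    using convergent2_common[OF assms] by blast
  have "box_sum N r (a * b) \<le> A * B" for N
  proof -
    have "box_sum N r (a * b) \<le> box_sum N r a * box_sum N r b" using box_sum_mult r(1) by simp
    also have "\<dots> \<le> A * B"
      using r(2)[of N] r(3)[of N] box_sum_nonneg[of r N a] box_sum_nonneg[of r N b] r(1)
      by (intro mult_mono) auto
    finally show ?thesis .
  qed
  then show ?thesis unfolding convergent2_iff using r(1) by blast
qed

lemma convergent2_finite:
  assumes "\<And>i j. i > M \<or> j > M \<Longrightarrow> coeff2 a i j = 0"
  shows "convergent2 a"
proof -
  have "box_sum N 1 a \<le> box_sum M 1 a" for N
  proof -
    have "box_sum N 1 a = (\<Sum>z\<in>{..N} \<times> {..N}. norm (coeff2 a (fst z) (snd z)))"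
      by (simp add: box_sum_altdef sum.cartesian_product case_prod_unfold)
    also have "\<dots> = (\<Sum>z\<in>{..N} \<times> {..N} \<inter> {..M} \<times> {..M}. norm (coeff2 a (fst z) (snd z)))"
      using assms by (intro sum.mono_neutral_right) (auto, (metis assms not_le)+)
    also have "\<dots> \<le> (\<Sum>z\<in>{..M} \<times> {..M}. norm (coeff2 a (fst z) (snd z)))"
      by (intro sum_mono2) auto
    also have "\<dots> = box_sum M 1 a"
      by (simp add: box_sum_altdef sum.cartesian_product case_prod_unfold)
    finally show ?thesis .
  qed
  then show ?thesis unfolding convergent2_iff by (intro exI[of _ 1]) auto
qed

lemma of_nat_le_two_power: "real (i + 1) \<le> 2 ^ i"
  by (induction i) auto

lemma convergent2_dx:
  assumes "convergent2 a" shows "convergent2 (fps2_dx a)"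
proof -
  obtain r A where r: "r > 0" "\<And>N. box_sum N r a \<le> A" using assms convergent2_iff by blast
  have c: "coeff2 (fps2_dx a) i j = of_nat (i + 1) * coeff2 a (i + 1) j" for i j
    by (simp add: coeff2_def fps2_dx_def fps_of_nat[symmetric] flip: of_nat_Suc del: of_nat_Suc)
  have "box_sum N (r / 2) (fps2_dx a) \<le> A / r" for N
  proof -
    have "norm (coeff2 (fps2_dx a) i j) * (r / 2) ^ (i + j)
        \<le> norm (coeff2 a (i + 1) j) * r ^ (i + 1 + j) / r" for i j
    proof -
      have "real (i + 1) \<le> 2 ^ (i + j)"
        using of_nat_le_two_power[of i] power_increasing[of i "i + j" "2::real"] by linarith
      then have "real (i + 1) * (r / 2) ^ (i + j) \<le> r ^ (i + j)"
        using r(1) by (simp add: power_divide divide_simps)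
      then have "norm (coeff2 a (i + 1) j) * (real (i + 1) * (r / 2) ^ (i + j))
          \<le> norm (coeff2 a (i + 1) j) * r ^ (i + j)"
        by (intro mult_left_mono) auto
      then show ?thesis using r(1) by (simp only: c norm_mult norm_of_nat) (simp add: mult_ac)
    qed
    then have "box_sum N (r / 2) (fps2_dx a)
        \<le> (\<Sum>i\<le>N. \<Sum>j\<le>N. norm (coeff2 a (i + 1) j) * r ^ (i + 1 + j) / r)"
      unfolding box_sum_altdef by (intro sum_mono)
    also have "\<dots> = (\<Sum>i\<le>N. \<Sum>j\<le>N. norm (coeff2 a (Suc i) j) * r ^ (Suc i + j)) / r"
      by (simp add: sum_divide_distrib)
    also have "(\<Sum>i\<le>N. \<Sum>j\<le>N. norm (coeff2 a (Suc i) j) * r ^ (Suc i + j))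
        \<le> (\<Sum>i\<le>N. \<Sum>j\<le>Suc N. norm (coeff2 a (Suc i) j) * r ^ (Suc i + j))"
      using r(1) by (intro sum_mono sum_mono2) auto
    also have "\<dots> = (\<Sum>i\<in>Suc ` {..N}. \<Sum>j\<le>Suc N. norm (coeff2 a i j) * r ^ (i + j))"
      by (subst sum.reindex) (auto simp: o_def)
    also have "\<dots> \<le> box_sum (Suc N) r a"
      unfolding box_sum_altdef using r(1)
      by (intro sum_mono2) (auto intro!: sum_nonneg simp del: sum.atMost_Suc)
    also have "\<dots> \<le> A" by (rule r(2))
    finally show ?thesis using r(1) by (simp add: divide_right_mono)
  qed
  then show ?thesis unfolding convergent2_iff using r(1) by (meson half_gt_zero)
qed

lemma convergent2_dy:
  assumes "convergent2 a" shows "convergent2 (fps2_dy a)"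
proof -
  obtain r A where r: "r > 0" "\<And>N. box_sum N r a \<le> A" using assms convergent2_iff by blast
  have c: "coeff2 (fps2_dy a) i j = of_nat (j + 1) * coeff2 a i (j + 1)" for i j
    by (simp add: coeff2_def fps2_dy_def)
  have "box_sum N (r / 2) (fps2_dy a) \<le> A / r" for N
  proof -
    have "norm (coeff2 (fps2_dy a) i j) * (r / 2) ^ (i + j)
        \<le> norm (coeff2 a i (j + 1)) * r ^ (i + (j + 1)) / r" for i j
    proof -
      have "real (j + 1) \<le> 2 ^ (i + j)"
        using of_nat_le_two_power[of j] power_increasing[of j "i + j" "2::real"] by linarith
      then have "real (j + 1) * (r / 2) ^ (i + j) \<le> r ^ (i + j)"
        using r(1) by (simp add: power_divide divide_simps)
      then have "norm (coeff2 a i (j + 1)) * (real (j + 1) * (r / 2) ^ (i + j))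
          \<le> norm (coeff2 a i (j + 1)) * r ^ (i + j)"
        by (intro mult_left_mono) auto
      then show ?thesis using r(1) by (simp only: c norm_mult norm_of_nat) (simp add: mult_ac)
    qed
    then have "box_sum N (r / 2) (fps2_dy a)
        \<le> (\<Sum>i\<le>N. \<Sum>j\<le>N. norm (coeff2 a i (j + 1)) * r ^ (i + (j + 1)) / r)"
      unfolding box_sum_altdef by (intro sum_mono)
    also have "\<dots> = (\<Sum>i\<le>N. \<Sum>j\<le>N. norm (coeff2 a i (Suc j)) * r ^ (i + Suc j)) / r"
      by (simp add: sum_divide_distrib)
    also have "(\<Sum>i\<le>N. \<Sum>j\<le>N. norm (coeff2 a i (Suc j)) * r ^ (i + Suc j))
        = (\<Sum>i\<le>N. \<Sum>j\<in>Suc ` {..N}. norm (coeff2 a i j) * r ^ (i + j))"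
      by (simp add: sum.reindex)
    also have "\<dots> \<le> (\<Sum>i\<le>N. \<Sum>j\<le>Suc N. norm (coeff2 a i j) * r ^ (i + j))"
      using r(1) by (intro sum_mono sum_mono2) auto
    also have "\<dots> \<le> box_sum (Suc N) r a"
      unfolding box_sum_altdef using r(1)
      by (intro sum_mono2) (auto intro!: sum_nonneg simp del: sum.atMost_Suc)
    also have "\<dots> \<le> A" by (rule r(2))
    finally show ?thesis using r(1) by (simp add: divide_right_mono)
  qed
  then show ?thesis unfolding convergent2_iff using r(1) by (meson half_gt_zero)
qed

lemma box_sum_scale:
  assumes "coeff2 a 0 0 = 0" "0 \<le> r" "0 \<le> t" "t \<le> 1"
  shows "box_sum N (t * r) a \<le> t * box_sum N r a"
proof -
  have "norm (coeff2 a i j) * (t * r) ^ (i + j) \<le> t * (norm (coeff2 a i j) * r ^ (i + j))" for i j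
  proof (cases "i + j")
    case 0
    then show ?thesis using assms by simp
  next
    case (Suc n)
    have "t ^ Suc n \<le> t" using assms by (simp add: mult_left_le power_le_one)
    then have "t ^ (i + j) * (norm (coeff2 a i j) * r ^ (i + j))
        \<le> t * (norm (coeff2 a i j) * r ^ (i + j))"
      unfolding Suc using assms by (intro mult_right_mono) auto
    then show ?thesis by (simp add: power_mult_distrib mult_ac)
  qed
  then show ?thesis unfolding box_sum_altdef sum_distrib_left by (intro sum_mono)
qed

lemma convergent2_subst:
  assumes h: "convergent2 h" and a: "convergent2 a" "coeff2 a 0 0 = 0"
    and b: "convergent2 b" "coeff2 b 0 0 = 0"
  shows "convergent2 (fps2_subst h a b)"
proof -
  obtain r A B where r: "r > 0" "\<And>N. box_sum N r a \<le> A" "\<And>N. box_sum N r b \<le> B"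
    using convergent2_common[OF a(1) b(1)] by blast
  obtain s H where s: "s > 0" "\<And>N. box_sum N s h \<le> H" using h convergent2_iff by blast
  define M where "M = max 1 (max A B)"
  define t where "t = min 1 (s / M)"
  define u where "u = t * r"
  have M: "M > 0" "A \<le> M" "B \<le> M" by (auto simp: M_def)
  have t: "0 < t" "t \<le> 1" "t * M \<le> s" using M s(1) by (auto simp: t_def min_def divide_simps)
  have u: "u > 0" using t r by (simp add: u_def)
  have small: "box_sum N u c \<le> s" if "coeff2 c 0 0 = 0" "box_sum N r c \<le> M" for c N
  proof -
    have "box_sum N u c \<le> t * box_sum N r c" unfolding u_def using that t r by (intro box_sum_scale) auto
    also have "\<dots> \<le> t * M" using that t by (intro mult_left_mono) auto
    finally show ?thesis using t by simp
  qed
  have "box_sum N u (fps2_subst h a b) \<le> H" for N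
  proof -
    let ?K = "{..N + N}"
    have ab: "box_sum N u (a ^ i * b ^ j) \<le> s ^ (i + j)" for i j
    proof -
      have "box_sum N u (a ^ i * b ^ j) \<le> box_sum N u (a ^ i) * box_sum N u (b ^ j)"
        using box_sum_mult u by simp
      also have "\<dots> \<le> s ^ i * s ^ j"
      proof (intro mult_mono)
        show "box_sum N u (a ^ i) \<le> s ^ i"
          using box_sum_power[of u N a i] power_mono[OF small[OF a(2)], of N i] r(2)[of N] M u
            box_sum_nonneg[of u N a] by fastforce
        show "box_sum N u (b ^ j) \<le> s ^ j"
          using box_sum_power[of u N b j] power_mono[OF small[OF b(2)], of N j] r(3)[of N] M u
            box_sum_nonneg[of u N b] by fastforce
      qed (use s u box_sum_nonneg in auto)
      finally show ?thesis by (simp add: power_add)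
    qed
    have "norm (coeff2 (fps2_subst h a b) k l)
        \<le> (\<Sum>i\<in>?K. \<Sum>j\<in>?K. norm (coeff2 h i j) * norm (coeff2 (a ^ i * b ^ j) k l))"
      if "k \<le> N" "l \<le> N" for k l
    proof -
      have "norm (coeff2 (fps2_subst h a b) k l)
          = norm (\<Sum>i\<le>k + l. \<Sum>j\<le>k + l. coeff2 h i j * coeff2 (a ^ i * b ^ j) k l)"
        by (simp add: fps2_subst_def coeff2_def)
      also have "\<dots> \<le> (\<Sum>i\<le>k + l. \<Sum>j\<le>k + l. norm (coeff2 h i j) * norm (coeff2 (a ^ i * b ^ j) k l))"
        by (intro order_trans[OF norm_sum] sum_mono) (auto simp: norm_mult intro!: order_trans[OF norm_sum])
      also have "\<dots> \<le> (\<Sum>i\<le>k + l. \<Sum>j\<in>?K. norm (coeff2 h i j) * norm (coeff2 (a ^ i * b ^ j) k l))"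
        using that by (intro sum_mono sum_mono2) auto
      also have "\<dots> \<le> (\<Sum>i\<in>?K. \<Sum>j\<in>?K. norm (coeff2 h i j) * norm (coeff2 (a ^ i * b ^ j) k l))"
        using that by (intro sum_mono2) (auto intro!: sum_nonneg)
      finally show ?thesis .
    qed
    then have "box_sum N u (fps2_subst h a b) \<le> (\<Sum>k\<le>N. \<Sum>l\<le>N.
        (\<Sum>i\<in>?K. \<Sum>j\<in>?K. norm (coeff2 h i j) * norm (coeff2 (a ^ i * b ^ j) k l)) * u ^ (k + l))"
      unfolding box_sum_altdef using u by (intro sum_mono mult_right_mono) auto
    also have "\<dots> = (\<Sum>k\<le>N. \<Sum>l\<le>N. \<Sum>i\<in>?K. \<Sum>j\<in>?K.
        norm (coeff2 h i j) * (norm (coeff2 (a ^ i * b ^ j) k l) * u ^ (k + l)))"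
      by (simp only: sum_distrib_right mult.assoc)
    also have "\<dots> = (\<Sum>k\<le>N. \<Sum>i\<in>?K. \<Sum>l\<le>N. \<Sum>j\<in>?K.
        norm (coeff2 h i j) * (norm (coeff2 (a ^ i * b ^ j) k l) * u ^ (k + l)))"
      by (intro sum.cong refl sum.swap)
    also have "\<dots> = (\<Sum>i\<in>?K. \<Sum>k\<le>N. \<Sum>l\<le>N. \<Sum>j\<in>?K.
        norm (coeff2 h i j) * (norm (coeff2 (a ^ i * b ^ j) k l) * u ^ (k + l)))"
      by (rule sum.swap)
    also have "\<dots> = (\<Sum>i\<in>?K. \<Sum>k\<le>N. \<Sum>j\<in>?K. \<Sum>l\<le>N.
        norm (coeff2 h i j) * (norm (coeff2 (a ^ i * b ^ j) k l) * u ^ (k + l)))"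
      by (intro sum.cong refl sum.swap)
    also have "\<dots> = (\<Sum>i\<in>?K. \<Sum>j\<in>?K. \<Sum>k\<le>N. \<Sum>l\<le>N.
        norm (coeff2 h i j) * (norm (coeff2 (a ^ i * b ^ j) k l) * u ^ (k + l)))"
      by (intro sum.cong refl sum.swap)
    also have "\<dots> = (\<Sum>i\<in>?K. \<Sum>j\<in>?K. norm (coeff2 h i j) * box_sum N u (a ^ i * b ^ j))"
      by (simp add: box_sum_altdef sum_distrib_left)
    also have "\<dots> \<le> (\<Sum>i\<in>?K. \<Sum>j\<in>?K. norm (coeff2 h i j) * s ^ (i + j))"
      by (intro sum_mono mult_left_mono ab) auto
    also have "\<dots> = box_sum (N + N) s h" by (simp add: box_sum_altdef)
    also have "\<dots> \<le> H" by (rule s(2))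
    finally show ?thesis .
  qed
  then show ?thesis unfolding convergent2_iff using u by blast
qed


section \<open>The ring of convergent power series in two variables\<close>

typedef germ = "{h. convergent2 h}"
  using convergent2_zero by blast

setup_lifting type_definition_germ

instantiation germ :: idom
begin

lift_definition zero_germ :: germ is 0 by (rule convergent2_zero)
lift_definition one_germ :: germ is 1 by (rule convergent2_one)
lift_definition plus_germ :: "germ \<Rightarrow> germ \<Rightarrow> germ" is "(+)" by (rule convergent2_add)
lift_definition minus_germ :: "germ \<Rightarrow> germ \<Rightarrow> germ" is "(-)" by (rule convergent2_diff)
lift_definition uminus_germ :: "germ \<Rightarrow> germ" is uminus by (rule convergent2_uminus)
lift_definition times_germ :: "germ \<Rightarrow> germ \<Rightarrow> germ" is "(*)" by (rule convergent2_mult)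

instance
  by standard (transfer, simp add: algebra_simps)+

end

lift_definition germ_coeff :: "germ \<Rightarrow> nat \<Rightarrow> nat \<Rightarrow> complex" is coeff2 .

lift_definition germ_const :: "complex \<Rightarrow> germ" is "\<lambda>c. fps_const (fps_const c)"
  by (rule convergent2_finite[of 0]) (auto simp: coeff2_def)

lift_definition germ_X :: germ is fps_X
  by (rule convergent2_finite[of 1]) (auto simp: coeff2_def fps_X_def)

lift_definition germ_Y :: germ is "fps_const fps_X"
  by (rule convergent2_finite[of 1]) (auto simp: coeff2_def fps_X_def)

lift_definition germ_dx :: "germ \<Rightarrow> germ" is fps2_dx by (rule convergent2_dx)
lift_definition germ_dy :: "germ \<Rightarrow> germ" is fps2_dy by (rule convergent2_dy)

text \<open>The composition h(a,b); the value 0 is a dummy when (a,b) does not fix the origin.\<close>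

lift_definition germ_subst :: "germ \<Rightarrow> germ \<Rightarrow> germ \<Rightarrow> germ" is
  "\<lambda>h a b. if coeff2 a 0 0 = 0 \<and> coeff2 b 0 0 = 0 then fps2_subst h a b else 0"
  by (auto intro: convergent2_subst convergent2_zero)


section \<open>Foliations and separatrices\<close>

text \<open>The pair (R, S) stands for the 1-form R dx + S dy.\<close>

type_synonym form = "germ \<times> germ"

definition form_scale :: "germ \<Rightarrow> form \<Rightarrow> form" where
  "form_scale h W = (h * fst W, h * snd W)"

definition differential :: "germ \<Rightarrow> form" where
  "differential h = (germ_dx h, germ_dy h)"

text \<open>The coefficient of dx \<and> dy.\<close>

definition wedge :: "form \<Rightarrow> form \<Rightarrow> germ" where
  "wedge W V = fst W * snd V - snd W * fst V"

definition singular :: "form \<Rightarrow> bool" where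
  "singular W \<longleftrightarrow> germ_coeff (fst W) 0 0 = 0 \<and> germ_coeff (snd W) 0 0 = 0"

definition defines_foliation :: "form \<Rightarrow> bool" where
  "defines_foliation W \<longleftrightarrow> singular W \<and> (\<forall>c. c dvd fst W \<and> c dvd snd W \<longrightarrow> c dvd 1)"

text \<open>The foliation is the 1-form up to multiplication by units.\<close>

definition foliation :: "form \<Rightarrow> form set" where
  "foliation W = {form_scale u W | u. u dvd 1}"

text \<open>The curve g = 0, represented by the ideal generated by g.\<close>

definition curve :: "germ \<Rightarrow> germ set" where
  "curve g = {h. g dvd h}"

definition separatrices :: "form \<Rightarrow> germ set set" where
  "separatrices W = {curve g | g. irreducible g \<and> g dvd wedge W (differential g)}"

definition nondicritical :: "form \<Rightarrow> bool" where
  "nondicritical W \<longleftrightarrow> finite (separatrices W)"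

text \<open>The set F consists of one equation for each separatrix.\<close>

definition union_of_separatrices_is :: "form \<Rightarrow> germ \<Rightarrow> bool" where
  "union_of_separatrices_is W f \<longleftrightarrow>
     (\<exists>F. finite F \<and> bij_betw curve F (separatrices W) \<and> curve f = curve (\<Prod>g\<in>F. g))"

definition Fol_forms :: "germ \<Rightarrow> form set" where
  "Fol_forms f = {W. defines_foliation W \<and> nondicritical W \<and> f dvd wedge W (differential f)}"

definition Fol :: "germ \<Rightarrow> form set set" where
  "Fol f = {foliation W | W. W \<in> Fol_forms f \<and> union_of_separatrices_is W f}"


section \<open>Irreducible singularities\<close>

definition linear_part :: "form \<Rightarrow> complex^2^2" where
  "linear_part W = (let (R, S) = W in
     vector [vector [- germ_coeff S 1 0, - germ_coeff S 0 1],
             vector [  germ_coeff R 1 0,   germ_coeff R 0 1]])"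

text \<open>The eigenvalues with multiplicity, as the roots of the characteristic polynomial.\<close>

definition eigenvalue_pair :: "complex^2^2 \<Rightarrow> complex \<Rightarrow> complex \<Rightarrow> bool" where
  "eigenvalue_pair A l1 l2 \<longleftrightarrow> (\<forall>z. det (mat z - A) = (z - l1) * (z - l2))"

definition pos_rats :: "complex set" where
  "pos_rats = {of_rat q | q. 0 < q}"

definition neg_rats :: "complex set" where
  "neg_rats = {of_rat q | q. q < 0}"

definition simple_singularity :: "form \<Rightarrow> bool" where
  "simple_singularity W \<longleftrightarrow> singular W \<and>
     (\<exists>l1 l2. eigenvalue_pair (linear_part W) l1 l2 \<and> l1 * l2 \<noteq> 0 \<and> l1 / l2 \<notin> pos_rats)"

definition saddle_node :: "form \<Rightarrow> bool" where
  "saddle_node W \<longleftrightarrow> singular W \<and>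
     (\<exists>l1 l2. eigenvalue_pair (linear_part W) l1 l2 \<and> ((l1 = 0) \<noteq> (l2 = 0)))"

definition irreducible_singularity :: "form \<Rightarrow> bool" where
  "irreducible_singularity W \<longleftrightarrow> simple_singularity W \<or> saddle_node W"


section \<open>Reduction of singularities\<close>

definition pullback :: "germ \<Rightarrow> germ \<Rightarrow> form \<Rightarrow> form" where
  "pullback a b W = form_scale (germ_subst (fst W) a b) (differential a)
                  + form_scale (germ_subst (snd W) a b) (differential b)"

text \<open>Under the chart (x,y) \<mapsto> (a,b) with exceptional divisor e = 0, the pullback of W is divided
  by the largest possible power of e.\<close>

definition strict_transform :: "germ \<Rightarrow> germ \<Rightarrow> germ \<Rightarrow> form \<Rightarrow> form \<Rightarrow> bool" where
  "strict_transform a b e W W' \<longleftrightarrow>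
     (\<exists>k. pullback a b W = form_scale (e ^ k) W') \<and> \<not> (e dvd fst W' \<and> e dvd snd W')"

text \<open>The points met in the reduction process of a foliation: a singular point that is not yet
  irreducible is blown up, irreducible singularities are left alone. (Seidenberg: the process is
  finite, i.e. only finitely many points get blown up.) A point is recorded by the strict transform
  of the 1-form in local coordinates centred at it and by two flags telling whether the axes
  x = 0 and y = 0 are components of the exceptional divisor there; since each point of the new
  exceptional component is centred by (x, x (t + y)), or (x y, y) for the direction of the
  y-axis, the components of the divisor always are coordinate axes.\<close>

inductive reduction_point :: "form \<Rightarrow> form \<Rightarrow> bool \<Rightarrow> bool \<Rightarrow> bool" for W0 where
  origin: "reduction_point W0 W0 False False"
| finite_direction:
    "reduction_point W0 W ex ey \<Longrightarrow> singular W \<Longrightarrow> \<not> irreducible_singularity W \<Longrightarrow>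
     strict_transform germ_X (germ_X * (germ_const t + germ_Y)) germ_X W W' \<Longrightarrow>
     reduction_point W0 W' True (ey \<and> t = 0)"
| infinite_direction:
    "reduction_point W0 W ex ey \<Longrightarrow> singular W \<Longrightarrow> \<not> irreducible_singularity W \<Longrightarrow>
     strict_transform (germ_X * germ_Y) germ_Y germ_Y W W' \<Longrightarrow>
     reduction_point W0 W' ex True"

definition generalized_curve :: "form \<Rightarrow> bool" where
  "generalized_curve W0 \<longleftrightarrow> (\<forall>W ex ey. reduction_point W0 W ex ey \<longrightarrow> \<not> saddle_node W)"

text \<open>The weak separatrix of a saddle-node is the (unique) invariant branch tangent to the
  eigenspace of the eigenvalue 0. It is smooth, but in general only formal, hence the equation is a
  formal power series.\<close>

definition weak_separatrix :: "form \<Rightarrow> fps2 \<Rightarrow> bool" where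
  "weak_separatrix W g \<longleftrightarrow>
     coeff2 g 0 0 = 0 \<and> (coeff2 g 1 0 \<noteq> 0 \<or> coeff2 g 0 1 \<noteq> 0) \<and>
     g dvd Rep_germ (fst W) * fps2_dy g - Rep_germ (snd W) * fps2_dx g \<and>
     (\<forall>v. linear_part W *v v = 0 \<longrightarrow> coeff2 g 1 0 * v$1 + coeff2 g 0 1 * v$2 = 0)"

text \<open>The smooth curve g = 0 is transversal to x = 0 iff g has a nonzero coefficient at y, and
  likewise for y = 0.\<close>

definition transversal_to_divisor :: "fps2 \<Rightarrow> bool \<Rightarrow> bool \<Rightarrow> bool" where
  "transversal_to_divisor g ex ey \<longleftrightarrow>
     (ex \<longrightarrow> coeff2 g 0 1 \<noteq> 0) \<and> (ey \<longrightarrow> coeff2 g 1 0 \<noteq> 0)"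

definition second_type :: "form \<Rightarrow> bool" where
  "second_type W0 \<longleftrightarrow>
     (\<forall>W ex ey. reduction_point W0 W ex ey \<and> saddle_node W \<longrightarrow>
        \<not> (ex \<and> ey) \<and> (\<forall>g. weak_separatrix W g \<longrightarrow> transversal_to_divisor g ex ey))"

end

theory Submission
  imports Defs
begin

text \<open>Write f = y^n - x^m and W = df + h (n x dy - m y dx). In the weighted chart x = s^n, y = s^m v
  the form n x dy - m y dx becomes a multiple of dv, so a term of h below the Newton polygon of f
  would make the exceptional divisor noninvariant, and W would have separatrices other than those of
  f. The terms of h on the polygon determine, for every v with v^n = 1, a point of the divisor with
  eigenvalue ratio - \<kappa> / C, where \<kappa> is the number in the statement (for \<xi> = v^(- n/d)) and C is a
  positive integer. If \<kappa> is a negative rational, this is a resonant node with two separatrices, hence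
  again dicritical. In the remaining cases the usual blow-ups follow Euclid's algorithm for (n, m):
  all points off the track are regular or simple, and at the end of it there is, for each \<xi>, a
  singularity that is simple if \<kappa> \<noteq> 0 and a saddle-node if \<kappa> = 0.

  The extra separatrices come from solving an ordinary differential equation in convergent power
  series and taking the norm of the resulting Puiseux parametrization.\<close>

section \<open>Coefficients of germs\<close>

text \<open>Two facts close the induction over blow-ups. In either chart, y^n - x^m and n x dy - m y
  dx keep their shape with smaller exponents, up to powers of the equation of the divisor; and the
  k-th lattice point on the Newton polygon goes to the k-th lattice point on the new one. So d =
  gcd(n, m) and the coefficients of h on the polygon, hence \<kappa>, never change, while the rest
  of h stays above it. The integer C at the last step is the multiplicity of the total transform of
  f along the last component. To contradict membership in \<open>Fol\<close>, one separatrix along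
  which f does not vanish is enough, because every separatrix must divide f. The leaves used are
  therefore started off the strict transform of f. The case n = m = 2 stands apart: the origin may
  be irreducible already, nothing is blown up, and the criterion has to be read off its linear part.
  Series in one variable are encoded as germs \<open>w\<close> with \<open>germ_dy w = 0\<close>, so
  that curves and surfaces share one ring.\<close>

lemma germ_eqI: "(\<And>i j. germ_coeff a i j = germ_coeff b i j) \<Longrightarrow> a = b"
  by transfer (auto simp: coeff2_def intro!: fps_ext)

lemma germ_coeff_add [simp]: "germ_coeff (a + b) i j = germ_coeff a i j + germ_coeff b i j"
  and germ_coeff_diff [simp]: "germ_coeff (a - b) i j = germ_coeff a i j - germ_coeff b i j"
  and germ_coeff_uminus [simp]: "germ_coeff (- a) i j = - germ_coeff a i j"
  and germ_coeff_zero [simp]: "germ_coeff 0 i j = 0"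
  and germ_coeff_one: "germ_coeff 1 i j = (if i = 0 \<and> j = 0 then 1 else 0)"
  and germ_coeff_const: "germ_coeff (germ_const c) i j = (if i = 0 \<and> j = 0 then c else 0)"
  and germ_coeff_X: "germ_coeff germ_X i j = (if i = 1 \<and> j = 0 then 1 else 0)"
  and germ_coeff_Y: "germ_coeff germ_Y i j = (if i = 0 \<and> j = 1 then 1 else 0)"
  by (transfer, auto simp: coeff2_def fps_X_def)+

lemma germ_coeff_sum [simp]: "germ_coeff (sum g S) i j = (\<Sum>x\<in>S. germ_coeff (g x) i j)"
  by (induction S rule: infinite_finite_induct) auto

lemma germ_coeff_mult:
  "germ_coeff (a * b) i j
     = (\<Sum>i'\<le>i. \<Sum>j'\<le>j. germ_coeff a i' j' * germ_coeff b (i - i') (j - j'))"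
  by transfer (simp add: coeff2_def fps_mult_nth fps_sum_nth atLeast0AtMost)

lemma germ_coeff_const_mult [simp]: "germ_coeff (germ_const c * h) i j = c * germ_coeff h i j"
  by transfer (simp add: coeff2_def)

lemma germ_coeff_X_mult: "germ_coeff (germ_X * h) i j = (if i = 0 then 0 else germ_coeff h (i - 1) j)"
  by transfer (simp add: coeff2_def)

lemma germ_coeff_Y_mult: "germ_coeff (germ_Y * h) i j = (if j = 0 then 0 else germ_coeff h i (j - 1))"
  by transfer (simp add: coeff2_def)

lemma germ_coeff_X_power_mult:
  "germ_coeff (germ_X ^ e * h) i j = (if i < e then 0 else germ_coeff h (i - e) j)"
  by (induction e arbitrary: i) (auto simp: germ_coeff_X_mult mult.assoc)

lemma germ_coeff_Y_power_mult:
  "germ_coeff (germ_Y ^ e * h) i j = (if j < e then 0 else germ_coeff h i (j - e))"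
  by (induction e arbitrary: j) (auto simp: germ_coeff_Y_mult mult.assoc)

lemma germ_coeff_mult_00 [simp]: "germ_coeff (a * b) 0 0 = germ_coeff a 0 0 * germ_coeff b 0 0"
  by (simp add: germ_coeff_mult)

lemma germ_coeff_power_00 [simp]: "germ_coeff (a ^ e) 0 0 = germ_coeff a 0 0 ^ e"
  by (induction e) (auto simp: germ_coeff_one)

lemma germ_coeff_dx: "germ_coeff (germ_dx h) i j = of_nat (i + 1) * germ_coeff h (i + 1) j"
  by transfer (simp add: coeff2_def fps2_dx_def fps_of_nat[symmetric] flip: of_nat_Suc del: of_nat_Suc)

lemma germ_coeff_dy: "germ_coeff (germ_dy h) i j = of_nat (j + 1) * germ_coeff h i (j + 1)"
  by transfer (simp add: coeff2_def fps2_dy_def)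

lemma germ_const_0 [simp]: "germ_const 0 = 0"
  and germ_const_1 [simp]: "germ_const 1 = 1"
  and germ_const_add: "germ_const (a + b) = germ_const a + germ_const b"
  and germ_const_mult: "germ_const (a * b) = germ_const a * germ_const b"
  by (rule germ_eqI; simp add: germ_coeff_const germ_coeff_one)+

lemma germ_const_power: "germ_const (a ^ e) = germ_const a ^ e"
  by (induction e) (auto simp: germ_const_mult)

lemma of_nat_germ: "(of_nat e :: germ) = germ_const (of_nat e)"
  by (induction e) (auto simp: germ_const_add)

lemma germ_coeff_of_nat_mult [simp]: "germ_coeff (of_nat e * h) i j = of_nat e * germ_coeff h i j"
  by (simp add: of_nat_germ)

lemma germ_coeff_of_nat: "germ_coeff (of_nat e) i j = (if i = 0 \<and> j = 0 then of_nat e else 0)"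
  by (simp add: of_nat_germ germ_coeff_const)

lemma germ_X_nz [simp]: "germ_X \<noteq> 0" and germ_Y_nz [simp]: "germ_Y \<noteq> 0"
proof -
  have "germ_coeff germ_X 1 0 \<noteq> germ_coeff 0 1 0" "germ_coeff germ_Y 0 1 \<noteq> germ_coeff 0 0 1"
    by (simp_all add: germ_coeff_X germ_coeff_Y)
  then show "germ_X \<noteq> 0" "germ_Y \<noteq> 0" by metis+
qed

lemma of_nat_germ_eq_0 [simp]: "(of_nat e :: germ) = 0 \<longleftrightarrow> e = 0"
proof
  assume "(of_nat e :: germ) = 0"
  then have "germ_coeff (of_nat e) 0 0 = 0" by simp
  then show "e = 0" by (simp add: germ_coeff_of_nat)
qed auto

lemma germ_dx_add [simp]: "germ_dx (a + b) = germ_dx a + germ_dx b"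
  and germ_dy_add [simp]: "germ_dy (a + b) = germ_dy a + germ_dy b"
  and germ_dx_diff [simp]: "germ_dx (a - b) = germ_dx a - germ_dx b"
  and germ_dy_diff [simp]: "germ_dy (a - b) = germ_dy a - germ_dy b"
  and germ_dx_const [simp]: "germ_dx (germ_const c) = 0"
  and germ_dy_const [simp]: "germ_dy (germ_const c) = 0"
  and germ_dx_one [simp]: "germ_dx 1 = 0"
  and germ_dy_one [simp]: "germ_dy 1 = 0"
  and germ_dx_zero [simp]: "germ_dx 0 = 0"
  and germ_dy_zero [simp]: "germ_dy 0 = 0"
  and germ_dx_X [simp]: "germ_dx germ_X = 1"
  and germ_dy_X [simp]: "germ_dy germ_X = 0"
  and germ_dx_Y [simp]: "germ_dx germ_Y = 0"
  and germ_dy_Y [simp]: "germ_dy germ_Y = 1"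
  by (rule germ_eqI; simp add: germ_coeff_dx germ_coeff_dy germ_coeff_const germ_coeff_X germ_coeff_Y
      germ_coeff_one algebra_simps)+

lemma germ_dx_mult: "germ_dx (a * b) = germ_dx a * b + a * germ_dx b"
  by transfer (simp add: fps2_dx_def)

lemma germ_dy_mult: "germ_dy (a * b) = germ_dy a * b + a * germ_dy b"
  by transfer
    (auto intro!: fps_ext simp del: fps_deriv_nth simp: fps2_dy_def fps_mult_nth fps_deriv_sum sum.distrib
      fps_sum_nth)

lemma germ_dx_power: "germ_dx (a ^ e) = of_nat e * a ^ (e - 1) * germ_dx a"
proof (induction e)
  case (Suc e)
  then show ?case by (cases e) (auto simp: germ_dx_mult algebra_simps)
qed auto

lemma germ_dy_power: "germ_dy (a ^ e) = of_nat e * a ^ (e - 1) * germ_dy a"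
proof (induction e)
  case (Suc e)
  then show ?case by (cases e) (auto simp: germ_dy_mult algebra_simps)
qed auto

section \<open>The filtration by powers of the maximal ideal\<close>

definition ord_ge :: "nat \<Rightarrow> germ \<Rightarrow> bool" where
  "ord_ge e h \<longleftrightarrow> (\<forall>i j. i + j < e \<longrightarrow> germ_coeff h i j = 0)"

lemma ord_ge_add: "ord_ge e a \<Longrightarrow> ord_ge e b \<Longrightarrow> ord_ge e (a + b)"
  and ord_ge_diff: "ord_ge e a \<Longrightarrow> ord_ge e b \<Longrightarrow> ord_ge e (a - b)"
  and ord_ge_0 [simp]: "ord_ge 0 a"
  and ord_ge_le: "ord_ge e a \<Longrightarrow> e' \<le> e \<Longrightarrow> ord_ge e' a"
  by (auto simp: ord_ge_def)

lemma ord_ge_mult: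
  assumes "ord_ge e a" "ord_ge e' b" shows "ord_ge (e + e') (a * b)"
  unfolding ord_ge_def germ_coeff_mult
proof safe
  fix i j assume ij: "i + j < e + e'"
  have "germ_coeff a i' j' * germ_coeff b (i - i') (j - j') = 0" if "i' \<le> i" "j' \<le> j" for i' j'
  proof (cases "i' + j' < e")
    case False
    then have "i - i' + (j - j') < e'" using ij that by linarith
    then show ?thesis using assms(2) by (simp add: ord_ge_def)
  qed (use assms(1) in \<open>simp add: ord_ge_def\<close>)
  then show "(\<Sum>i'\<le>i. \<Sum>j'\<le>j. germ_coeff a i' j' * germ_coeff b (i - i') (j - j')) = 0"
    by (intro sum.neutral ballI) auto
qed

lemma ord_ge_mult_left: "ord_ge e b \<Longrightarrow> ord_ge e (a * b)"
  and ord_ge_mult_right: "ord_ge e a \<Longrightarrow> ord_ge e (a * b)"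
  using ord_ge_mult[of 0 a e b] ord_ge_mult[of e a 0 b] by auto

lemma ord_ge_1: "ord_ge (Suc 0) a \<longleftrightarrow> germ_coeff a 0 0 = 0"
  by (auto simp: ord_ge_def)

lemma ord_ge_power: "germ_coeff a 0 0 = 0 \<Longrightarrow> ord_ge e (a ^ e)"
proof (induction e)
  case (Suc e)
  then show ?case using ord_ge_mult[of "Suc 0" a e "a ^ e"] by (simp add: ord_ge_1)
qed auto

lemma ord_ge_dx: "ord_ge (Suc e) h \<Longrightarrow> ord_ge e (germ_dx h)"
  and ord_ge_dy: "ord_ge (Suc e) h \<Longrightarrow> ord_ge e (germ_dy h)"
  by (auto simp: ord_ge_def germ_coeff_dx germ_coeff_dy)

lemma germ_coeff_monomial:
  "germ_coeff (germ_const c * germ_X ^ i * germ_Y ^ j) k l = (if k = i \<and> l = j then c else 0)"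
  using germ_coeff_X_power_mult[of i "germ_Y ^ j" k l] germ_coeff_Y_power_mult[of j 1 "k - i" l]
  by (auto simp: mult.assoc germ_coeff_one)

text \<open>Density of the polynomials: additive maps that are continuous for the topology of the
  maximal ideal are determined by their values at monomials.\<close>

lemma germ_additive_eqI:
  assumes add: "\<And>a b. T (a + b) = T a + T b" "\<And>a b. T' (a + b) = T' a + T' b"
    and mono: "\<And>c i j. T (germ_const c * germ_X ^ i * germ_Y ^ j) = T' (germ_const c * germ_X ^ i * germ_Y ^ j)"
    and cont: "\<And>e h. ord_ge (Suc e) h \<Longrightarrow> ord_ge e (T h)" "\<And>e h. ord_ge (Suc e) h \<Longrightarrow> ord_ge e (T' h)"
  shows "T h = T' h"
proof (rule germ_eqI)
  fix i j
  \<comment> \<open>\<open>T\<close> and \<open>T'\<close> may lose one order, so the truncation has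
    to go one degree further for the coefficient at (i, j) to be controlled.\<close>
  define e where "e = Suc (i + j)"
  define P where "P = (\<Sum>i\<le>e. \<Sum>j\<le>e. germ_const (germ_coeff h i j) * germ_X ^ i * germ_Y ^ j)"
  have zero: "T 0 = 0" "T' 0 = 0" using add(1)[of 0 0] add(2)[of 0 0] by (metis add_0 add_cancel_right_right)+
  have sum: "T (sum g A) = (\<Sum>x\<in>A. T (g x))" "T' (sum g A) = (\<Sum>x\<in>A. T' (g x))"
    for g and A :: "nat set"
    by (induction A rule: infinite_finite_induct) (auto simp: zero add)
  have "germ_coeff P k l = germ_coeff h k l" if "k \<le> e" "l \<le> e" for k l
  proof -
    have "germ_coeff P k l = (\<Sum>i\<le>e. \<Sum>j\<le>e. if k = i then if l = j then germ_coeff h i j else 0 else 0)"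
      unfolding P_def germ_coeff_sum germ_coeff_monomial by (intro sum.cong refl) auto
    also have "\<dots> = (\<Sum>i\<le>e. if k = i then germ_coeff h i l else 0)"
      using that by (intro sum.cong refl) auto
    also have "\<dots> = germ_coeff h k l" using that by auto
    finally show ?thesis .
  qed
  then have r: "ord_ge (Suc e) (h - P)" by (auto simp: ord_ge_def)
  have "T h = T P + T (h - P)" "T' h = T' P + T' (h - P)"
    using add(1)[of P "h - P"] add(2)[of P "h - P"] by auto
  moreover have "T P = T' P" unfolding P_def sum mono ..
  moreover have "germ_coeff (T (h - P)) i j = 0" "germ_coeff (T' (h - P)) i j = 0"
    using cont[OF r] by (auto simp: ord_ge_def e_def)
  ultimately show "germ_coeff (T h) i j = germ_coeff (T' h) i j" by simp
qed


section \<open>Substitution\<close>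

lemma germ_coeff_power_mult_eq_0:
  assumes "germ_coeff a 0 0 = 0" "germ_coeff b 0 0 = 0" "k + l < i + j"
  shows "germ_coeff (a ^ i * b ^ j) k l = 0"
  using ord_ge_mult[OF ord_ge_power[OF assms(1), of i] ord_ge_power[OF assms(2), of j]] assms(3)
  by (simp add: ord_ge_def)

text \<open>Products a^i b^j of degree above k + l contribute nothing, so the truncation in the
  definition can be replaced by any larger bound; different coefficients can then be compared over
  one range of summation.\<close>

lemma germ_coeff_subst:
  assumes ab: "germ_coeff a 0 0 = 0" "germ_coeff b 0 0 = 0" and K: "k + l \<le> K"
  shows "germ_coeff (germ_subst h a b) k l
           = (\<Sum>i\<le>K. \<Sum>j\<le>K. germ_coeff h i j * germ_coeff (a ^ i * b ^ j) k l)"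
proof -
  have "germ_coeff (germ_subst h a b) k l
          = (\<Sum>i\<le>k + l. \<Sum>j\<le>k + l. germ_coeff h i j * germ_coeff (a ^ i * b ^ j) k l)"
    using ab
  proof (transfer fixing: k l)
    fix h a b :: fps2
    have pow: "Rep_germ (x ^ i) = Rep_germ x ^ i" for x i
      by (induction i) (auto simp: one_germ.rep_eq times_germ.rep_eq)
    assume "coeff2 a 0 0 = 0" "coeff2 b 0 0 = 0"
    then show "coeff2 (if coeff2 a 0 0 = 0 \<and> coeff2 b 0 0 = 0 then fps2_subst h a b else 0) k l
          = (\<Sum>i\<le>k + l. \<Sum>j\<le>k + l. coeff2 h i j * coeff2 (a ^ i * b ^ j) k l)"
      by (simp add: fps2_subst_def coeff2_def)
  qed
  also have "\<dots> = (\<Sum>(i,j)\<in>{..k + l} \<times> {..k + l}. germ_coeff h i j * germ_coeff (a ^ i * b ^ j) k l)"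
    by (simp add: sum.cartesian_product)
  also have "\<dots> = (\<Sum>(i,j)\<in>{..K} \<times> {..K}. germ_coeff h i j * germ_coeff (a ^ i * b ^ j) k l)"
    using K by (intro sum.mono_neutral_left) (auto intro!: germ_coeff_power_mult_eq_0[OF ab])
  finally show ?thesis by (simp add: sum.cartesian_product)
qed

context
  fixes a b :: germ
  assumes a0: "germ_coeff a 0 0 = 0" and b0: "germ_coeff b 0 0 = 0"
begin

lemma germ_coeff_subst_00 [simp]: "germ_coeff (germ_subst h a b) 0 0 = germ_coeff h 0 0"
  using germ_coeff_subst[OF a0 b0, of 0 0 0 h] by (simp add: germ_coeff_one)

lemma germ_subst_add: "germ_subst (g + h) a b = germ_subst g a b + germ_subst h a b"
  by (rule germ_eqI)
    (simp add: germ_coeff_subst[OF a0 b0 order_refl] sum.distrib[symmetric] distrib_right)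

lemma germ_subst_monomial:
  "germ_subst (germ_const c * germ_X ^ i * germ_Y ^ j) a b = germ_const c * a ^ i * b ^ j"
proof (rule germ_eqI)
  fix k l
  define K where "K = k + l + i + j"
  have "germ_coeff (germ_subst (germ_const c * germ_X ^ i * germ_Y ^ j) a b) k l
      = (\<Sum>i'\<le>K. \<Sum>j'\<le>K. if i' = i then if j' = j then c * germ_coeff (a ^ i * b ^ j) k l else 0 else 0)"
    unfolding germ_coeff_subst[OF a0 b0, of k l K, OF le_add1[of "k + l" "i + j", folded add.assoc, folded K_def]]
      germ_coeff_monomial by (intro sum.cong refl) auto
  also have "\<dots> = (\<Sum>i'\<le>K. if i' = i then c * germ_coeff (a ^ i * b ^ j) k l else 0)"
    by (intro sum.cong refl) (auto simp: K_def)
  also have "\<dots> = c * germ_coeff (a ^ i * b ^ j) k l" by (auto simp: K_def)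
  finally show "germ_coeff (germ_subst (germ_const c * germ_X ^ i * germ_Y ^ j) a b) k l
      = germ_coeff (germ_const c * a ^ i * b ^ j) k l"
    by (simp add: mult.assoc)
qed

lemma ord_ge_subst:
  assumes "ord_ge e h" shows "ord_ge e (germ_subst h a b)"
  unfolding ord_ge_def
proof safe
  fix k l assume kl: "k + l < e"
  have "germ_coeff h i j * germ_coeff (a ^ i * b ^ j) k l = 0" for i j
    using assms kl germ_coeff_power_mult_eq_0[OF a0 b0, of k l i j]
    by (cases "i + j \<le> k + l") (auto simp: ord_ge_def)
  then show "germ_coeff (germ_subst h a b) k l = 0"
    unfolding germ_coeff_subst[OF a0 b0 order_refl] by (intro sum.neutral ballI)
qed

lemma ord_ge_subst_Suc: "ord_ge (Suc e) h \<Longrightarrow> ord_ge e (germ_subst h a b)"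
  by (rule ord_ge_subst) (auto simp: ord_ge_def)

text \<open>Density of the polynomials in one factor at a time: first in \<open>g\<close>, then in
  \<open>h\<close> with a monomial in place of \<open>g\<close>. What remains is a law of
  exponents.\<close>

lemma germ_subst_mult: "germ_subst (g * h) a b = germ_subst g a b * germ_subst h a b"
proof (rule germ_additive_eqI[where h = g and T = "\<lambda>g. germ_subst (g * h) a b"
      and T' = "\<lambda>g. germ_subst g a b * germ_subst h a b"])
  fix c i j
  let ?m = "germ_const c * germ_X ^ i * germ_Y ^ j"
  show "germ_subst (?m * h) a b = germ_subst ?m a b * germ_subst h a b"
  proof (rule germ_additive_eqI[where h = h and T = "\<lambda>h. germ_subst (?m * h) a b"
        and T' = "\<lambda>h. germ_subst ?m a b * germ_subst h a b"])
    fix c' i' j'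
    have "?m * (germ_const c' * germ_X ^ i' * germ_Y ^ j')
        = germ_const (c * c') * germ_X ^ (i + i') * germ_Y ^ (j + j')"
      by (simp add: germ_const_mult power_add mult_ac)
    then show "germ_subst (?m * (germ_const c' * germ_X ^ i' * germ_Y ^ j')) a b
        = germ_subst ?m a b * germ_subst (germ_const c' * germ_X ^ i' * germ_Y ^ j') a b"
      by (simp only: germ_subst_monomial) (simp add: germ_const_mult power_add mult_ac)
  qed (simp_all add: distrib_left germ_subst_add ord_ge_subst_Suc ord_ge_mult_left)
qed (simp_all add: distrib_right germ_subst_add ord_ge_subst_Suc ord_ge_mult_right)

lemma germ_subst_const: "germ_subst (germ_const c) a b = germ_const c"
  and germ_subst_X: "germ_subst germ_X a b = a"
  and germ_subst_Y: "germ_subst germ_Y a b = b"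
  using germ_subst_monomial[of c 0 0] germ_subst_monomial[of 1 1 0] germ_subst_monomial[of 1 0 1]
  by simp_all

lemma germ_subst_one: "germ_subst 1 a b = 1" and germ_subst_zero: "germ_subst 0 a b = 0"
  using germ_subst_const[of 1] germ_subst_const[of 0] by simp_all

lemma germ_subst_uminus: "germ_subst (- h) a b = - germ_subst h a b"
  using germ_subst_add[of h "- h"] by (simp add: germ_subst_zero minus_unique)

lemma germ_subst_diff: "germ_subst (g - h) a b = germ_subst g a b - germ_subst h a b"
  using germ_subst_add[of "g - h" h] by simp

lemma germ_subst_power: "germ_subst (h ^ e) a b = germ_subst h a b ^ e"
  by (induction e) (simp_all add: germ_subst_one germ_subst_mult)

lemma germ_subst_of_nat: "germ_subst (of_nat e) a b = of_nat e"
  by (simp add: of_nat_germ germ_subst_const)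

lemma germ_subst_prod: "germ_subst (prod g S) a b = (\<Prod>x\<in>S. germ_subst (g x) a b)"
  by (induction S rule: infinite_finite_induct) (simp_all add: germ_subst_one germ_subst_mult)

lemmas germ_subst_simps = germ_subst_add germ_subst_mult germ_subst_const germ_subst_X germ_subst_Y
  germ_subst_one germ_subst_zero germ_subst_uminus germ_subst_diff germ_subst_power germ_subst_of_nat

text \<open>By density only monomials have to be checked. Differentiation lowers the order by one,
  which is exactly the loss that \<open>germ_additive_eqI\<close> tolerates.\<close>

lemma chain_rule_dx:
  "germ_dx (germ_subst h a b)
     = germ_subst (germ_dx h) a b * germ_dx a + germ_subst (germ_dy h) a b * germ_dx b"
proof (rule germ_additive_eqI[where h = h and T = "\<lambda>h. germ_dx (germ_subst h a b)" and
      T' = "\<lambda>h. germ_subst (germ_dx h) a b * germ_dx a + germ_subst (germ_dy h) a b * germ_dx b"])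
  fix c i j
  show "germ_dx (germ_subst (germ_const c * germ_X ^ i * germ_Y ^ j) a b)
      = germ_subst (germ_dx (germ_const c * germ_X ^ i * germ_Y ^ j)) a b * germ_dx a
        + germ_subst (germ_dy (germ_const c * germ_X ^ i * germ_Y ^ j)) a b * germ_dx b"
    by (simp add: germ_dx_mult germ_dy_mult germ_dx_power germ_dy_power germ_subst_simps algebra_simps)
qed (simp_all add: germ_subst_add algebra_simps ord_ge_dx ord_ge_dy ord_ge_subst ord_ge_add
      ord_ge_mult_left ord_ge_mult_right)

lemma chain_rule_dy:
  "germ_dy (germ_subst h a b)
     = germ_subst (germ_dx h) a b * germ_dy a + germ_subst (germ_dy h) a b * germ_dy b"
proof (rule germ_additive_eqI[where h = h and T = "\<lambda>h. germ_dy (germ_subst h a b)" and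
      T' = "\<lambda>h. germ_subst (germ_dx h) a b * germ_dy a + germ_subst (germ_dy h) a b * germ_dy b"])
  fix c i j
  show "germ_dy (germ_subst (germ_const c * germ_X ^ i * germ_Y ^ j) a b)
      = germ_subst (germ_dx (germ_const c * germ_X ^ i * germ_Y ^ j)) a b * germ_dy a
        + germ_subst (germ_dy (germ_const c * germ_X ^ i * germ_Y ^ j)) a b * germ_dy b"
    by (simp add: germ_dx_mult germ_dy_mult germ_dx_power germ_dy_power germ_subst_simps algebra_simps)
qed (simp_all add: germ_subst_add algebra_simps ord_ge_dx ord_ge_dy ord_ge_subst ord_ge_add
      ord_ge_mult_left ord_ge_mult_right)

end

lemma germ_subst_assoc:
  assumes ab: "germ_coeff a 0 0 = 0" "germ_coeff b 0 0 = 0"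
    and cd: "germ_coeff c 0 0 = 0" "germ_coeff d 0 0 = 0"
  shows "germ_subst (germ_subst h a b) c d = germ_subst h (germ_subst a c d) (germ_subst b c d)"
proof (rule germ_additive_eqI[where h = h and T = "\<lambda>h. germ_subst (germ_subst h a b) c d"
      and T' = "\<lambda>h. germ_subst h (germ_subst a c d) (germ_subst b c d)"])
  fix k i j
  show "germ_subst (germ_subst (germ_const k * germ_X ^ i * germ_Y ^ j) a b) c d
      = germ_subst (germ_const k * germ_X ^ i * germ_Y ^ j) (germ_subst a c d) (germ_subst b c d)"
    using ab cd by (simp add: germ_subst_simps)
qed (use ab cd in \<open>simp_all add: germ_subst_add ord_ge_subst ord_ge_subst_Suc\<close>)

lemma germ_subst_id [simp]: "germ_subst h germ_X germ_Y = h"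
  by (rule germ_additive_eqI[where h = h and T = "\<lambda>h. germ_subst h germ_X germ_Y" and T' = "\<lambda>h. h"])
    (auto simp: germ_subst_simps germ_coeff_X germ_coeff_Y ord_ge_subst_Suc intro: ord_ge_le)

text \<open>Functoriality of the pullback, for the composite of two weighted blow-ups.\<close>

lemma pullback_assoc:
  assumes ab: "germ_coeff a 0 0 = 0" "germ_coeff b 0 0 = 0"
    and cd: "germ_coeff c 0 0 = 0" "germ_coeff d 0 0 = 0"
  shows "pullback (germ_subst a c d) (germ_subst b c d) W = pullback c d (pullback a b W)"
  using assms by (simp add: pullback_def form_scale_def differential_def germ_subst_assoc[symmetric]
    germ_subst_simps chain_rule_dx chain_rule_dy algebra_simps)

lemma pullback_form_scale:
  assumes "germ_coeff a 0 0 = 0" "germ_coeff b 0 0 = 0"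
  shows "pullback a b (form_scale h W) = form_scale (germ_subst h a b) (pullback a b W)"
  using assms by (simp add: pullback_def form_scale_def germ_subst_simps algebra_simps)

section \<open>Construction of convergent germs\<close>

lemma germ_exists:
  assumes "r > 0" "\<And>N. (\<Sum>i\<le>N. \<Sum>j\<le>N. norm (c i j) * r ^ (i + j)) \<le> B"
  obtains h where "\<And>i j. germ_coeff h i j = c i j"
proof -
  define F :: fps2 where "F = Abs_fps (\<lambda>i. Abs_fps (c i))"
  have F: "coeff2 F i j = c i j" for i j by (simp add: F_def coeff2_def)
  have "convergent2 F"
    unfolding convergent2_iff box_sum_altdef F using assms by blast
  then have "germ_coeff (Abs_germ F) i j = c i j" for i j
    by (simp add: germ_coeff.rep_eq Abs_germ_inverse F)
  then show ?thesis by (rule that)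
qed

text \<open>For a radius \<open>s \<le> 1\<close> of \<open>h\<close>, the affine bound on the new
  exponents gives the radius \<open>s ^ k\<close> at the cost of a factor \<open>1 / s ^ e\<close>;
  injectivity keeps a coefficient from being counted twice. Division by powers of a variable and
  descent along x -> x^k are both of this kind.\<close>

lemma germ_reindex:
  assumes inj: "inj (\<lambda>(i, j). (\<phi> i j, \<psi> i j))" and le: "\<And>i j. \<phi> i j + \<psi> i j \<le> k * (i + j) + e"
  obtains g where "\<And>i j. germ_coeff g i j = germ_coeff h (\<phi> i j) (\<psi> i j)"
proof -
  obtain r B where r: "r > 0" "\<And>N. box_sum N r (Rep_germ h) \<le> B"
    using Rep_germ[of h] convergent2_iff by auto
  define s where "s = min r 1"
  have s: "0 < s" "s \<le> 1" "s \<le> r" using r(1) by (auto simp: s_def)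
  have "(\<Sum>i\<le>N. \<Sum>j\<le>N. norm (germ_coeff h (\<phi> i j) (\<psi> i j)) * (s ^ k) ^ (i + j)) \<le> B / s ^ e" for N
  proof -
    define M where "M = k * (N + N) + e"
    let ?f = "\<lambda>(i, j). norm (germ_coeff h i j) * s ^ (i + j)"
    have pw: "(s ^ k) ^ (i + j) \<le> s ^ (\<phi> i j + \<psi> i j) / s ^ e" for i j
    proof -
      have "(s ^ k) ^ (i + j) * s ^ e = s ^ (k * (i + j) + e)" by (simp add: power_add power_mult)
      also have "\<dots> \<le> s ^ (\<phi> i j + \<psi> i j)" using s le by (intro power_decreasing) auto
      finally show ?thesis using s by (simp add: field_simps)
    qed
    have "(\<Sum>i\<le>N. \<Sum>j\<le>N. norm (germ_coeff h (\<phi> i j) (\<psi> i j)) * (s ^ k) ^ (i + j))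
        \<le> (\<Sum>i\<le>N. \<Sum>j\<le>N. norm (germ_coeff h (\<phi> i j) (\<psi> i j)) * (s ^ (\<phi> i j + \<psi> i j) / s ^ e))"
      by (intro sum_mono mult_left_mono pw) auto
    also have "\<dots> = (\<Sum>(i, j)\<in>{..N} \<times> {..N}. ?f (\<phi> i j, \<psi> i j)) / s ^ e"
      by (simp add: sum_divide_distrib sum.cartesian_product case_prod_unfold)
    also have "(\<Sum>(i, j)\<in>{..N} \<times> {..N}. ?f (\<phi> i j, \<psi> i j))
        = sum ?f ((\<lambda>(i, j). (\<phi> i j, \<psi> i j)) ` ({..N} \<times> {..N}))"
      by (subst sum.reindex) (auto intro!: inj_on_subset[OF inj] sum.cong)
    also have "\<dots> \<le> sum ?f ({..M} \<times> {..M})"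
    proof (intro sum_mono2)
      show "(\<lambda>(i, j). (\<phi> i j, \<psi> i j)) ` ({..N} \<times> {..N}) \<subseteq> {..M} \<times> {..M}"
      proof clarsimp
        fix i j assume "i \<le> N" "j \<le> N"
        then have "k * (i + j) \<le> k * (N + N)" by (intro mult_le_mono) auto
        then show "\<phi> i j \<le> M \<and> \<psi> i j \<le> M" using le[of i j] unfolding M_def by linarith
      qed
    qed (use s in auto)
    also have "\<dots> = box_sum M s (Rep_germ h)"
      by (simp add: box_sum_altdef sum.cartesian_product germ_coeff.rep_eq)
    also have "\<dots> \<le> B" using box_sum_mono[of s r M "Rep_germ h"] s r(2)[of M] by linarith
    finally show ?thesis using s by (simp add: divide_right_mono)
  qed
  from germ_exists[OF _ this] s show ?thesis using that by auto
qed

lemma germ_X_power_dvdE: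
  assumes "\<And>i j. i < e \<Longrightarrow> germ_coeff h i j = 0"
  obtains g where "h = germ_X ^ e * g" "\<And>i j. germ_coeff g i j = germ_coeff h (i + e) j"
proof -
  have "inj (\<lambda>(i, j). (i + e, j))" by (auto simp: inj_def)
  then obtain g where g: "\<And>i j. germ_coeff g i j = germ_coeff h (i + e) j"
    by (rule germ_reindex[of "\<lambda>i j. i + e" "\<lambda>i j. j" 1 e h]) auto
  have "h = germ_X ^ e * g" using assms by (intro germ_eqI) (auto simp: germ_coeff_X_power_mult g)
  then show ?thesis using g that by blast
qed

lemma germ_Y_power_dvdE:
  assumes "\<And>i j. j < e \<Longrightarrow> germ_coeff h i j = 0"
  obtains g where "h = germ_Y ^ e * g" "\<And>i j. germ_coeff g i j = germ_coeff h i (j + e)"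
proof -
  have "inj (\<lambda>(i::nat, j). (i, j + e))" by (auto simp: inj_def)
  then obtain g where g: "\<And>i j. germ_coeff g i j = germ_coeff h i (j + e)"
    by (rule germ_reindex[of "\<lambda>i j. i" "\<lambda>i j. j + e" 1 e h]) auto
  have "h = germ_Y ^ e * g" using assms by (intro germ_eqI) (auto simp: germ_coeff_Y_power_mult g)
  then show ?thesis using g that by blast
qed

section \<open>Units of the local ring\<close>

lemma germ_unit_iff: "h dvd 1 \<longleftrightarrow> germ_coeff h 0 0 \<noteq> 0"
proof
  assume "h dvd 1"
  then obtain g where "1 = h * g" by (rule dvdE)
  then have "germ_coeff h 0 0 * germ_coeff g 0 0 = 1"
    using germ_coeff_mult_00[of h g] by (metis germ_coeff_one)
  then show "germ_coeff h 0 0 \<noteq> 0" by auto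
next
  let ?c = "germ_coeff h 0 0"
  assume c: "?c \<noteq> 0"
  have "(\<Sum>i\<le>N. \<Sum>j\<le>N. norm (if j = 0 then 1 else 0 :: complex) * (1/2) ^ (i + j)) \<le> 2" for N
  proof -
    have "(\<Sum>i\<le>N. \<Sum>j\<le>N. norm (if j = 0 then 1 else 0 :: complex) * (1/2) ^ (i + j))
        = (\<Sum>i\<le>N. \<Sum>j\<le>N. if j = 0 then (1/2::real) ^ i else 0)"
      by (intro sum.cong refl) auto
    also have "\<dots> = (\<Sum>i\<le>N. (1/2::real) ^ i)" by simp
    also have "\<dots> \<le> 2" by (simp add: sum_gp0)
    finally show ?thesis .
  qed
  \<comment> \<open>\<open>G\<close> is the geometric series 1 / (1 - x), which converges at radius
    1/2 with sum 2.\<close>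
  then obtain G where G: "\<And>i j. germ_coeff G i j = (if j = 0 then 1 else 0)"
    using germ_exists[of "1/2" "\<lambda>i j. if j = 0 then 1 else 0" 2] by auto
  have geom: "(1 - germ_X) * G = 1"
    by (rule germ_eqI) (auto simp: left_diff_distrib germ_coeff_X_mult G germ_coeff_one)
  \<comment> \<open>\<open>h\<close> divided by its constant term is 1 - b with \<open>b\<close> in
    the maximal ideal, so substituting \<open>b\<close> into the geometric series yields the
    inverse.\<close>
  define b where "b = 1 - germ_const (1 / ?c) * h"
  have b: "germ_coeff b 0 0 = 0" using c by (simp add: b_def germ_coeff_one germ_coeff_const)
  have "(1 - b) * germ_subst G b 0 = germ_subst ((1 - germ_X) * G) b 0"
    using b by (simp add: germ_subst_simps)
  also have "\<dots> = 1" using b by (simp add: geom germ_subst_simps)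
  finally have "h * (germ_const (1 / ?c) * germ_subst G b 0) = 1"
    by (simp add: b_def mult_ac)
  then show "h dvd 1" by (metis dvd_triv_left)
qed

subsection \<open>An ordinary differential equation\<close>

text \<open>A truncated weighted l1-norm: it is a finite sum, and convergence is a bound uniform in
  \<open>N\<close>.\<close>

definition germ_norm :: "nat \<Rightarrow> real \<Rightarrow> germ \<Rightarrow> real" where
  "germ_norm N r h = box_sum N r (Rep_germ h)"

lemma germ_norm_altdef: "germ_norm N r a = (\<Sum>i\<le>N. \<Sum>j\<le>N. norm (germ_coeff a i j) * r ^ (i + j))"
  by (simp add: germ_norm_def box_sum_altdef germ_coeff.rep_eq)

lemma seminormlike_germ_norm: "0 \<le> r \<Longrightarrow> seminormlike (germ_norm N r)"
  using seminormlike_box[of r N] unfolding seminormlike_def germ_norm_def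
  by (auto simp: zero_germ.rep_eq one_germ.rep_eq plus_germ.rep_eq times_germ.rep_eq uminus_germ.rep_eq)

lemma germ_norm_power:
  assumes "0 \<le> r" shows "germ_norm N r (a ^ e) \<le> germ_norm N r a ^ e"
proof (induction e)
  case 0
  then show ?case using seminormlike_germ_norm[OF assms, of N] by (simp add: seminormlike_def)
next
  case (Suc e)
  have "germ_norm N r (a ^ Suc e) \<le> germ_norm N r a * germ_norm N r (a ^ e)"
    using seminormlike_germ_norm[OF assms, of N] by (simp add: seminormlike_def)
  also have "\<dots> \<le> germ_norm N r a * germ_norm N r a ^ e"
    using Suc seminormlike_germ_norm[OF assms, of N] by (intro mult_left_mono) (auto simp: seminormlike_def)
  finally show ?case by simp
qed

text \<open>Each a^i b^j has norm at most s^(i + j), and only exponents up to N + N reach the box of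
  size \<open>N\<close>. The bound sees \<open>a\<close> and \<open>b\<close> only through
  \<open>s\<close>, so it holds uniformly along an iteration.\<close>

lemma germ_norm_subst_le:
  assumes ab: "germ_coeff a 0 0 = 0" "germ_coeff b 0 0 = 0" and r: "0 \<le> r"
    and le: "germ_norm N r a \<le> s" "germ_norm N r b \<le> s"
  shows "germ_norm N r (germ_subst h a b) \<le> germ_norm (N + N) s h"
proof -
  let ?K = "{..N + N}"
  define P where "P = (\<Sum>i\<in>?K. \<Sum>j\<in>?K. germ_const (germ_coeff h i j) * (a ^ i * b ^ j))"
  note sn = seminormlike_germ_norm[OF r, of N]
  have nn: "0 \<le> germ_norm N r x" for x using sn by (simp add: seminormlike_def)
  have s: "0 \<le> s" using nn[of a] le by linarith
  have c: "germ_norm N r (germ_const c * x) = norm c * germ_norm N r x" for c x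
    by (simp add: germ_norm_altdef norm_mult sum_distrib_left mult.assoc)
  have "germ_norm N r (germ_subst h a b) = germ_norm N r P"
    unfolding germ_norm_altdef
    by (intro sum.cong refl)
      (simp add: P_def germ_coeff_subst[OF ab, where K = "N + N"])
  also have "\<dots> \<le> (\<Sum>i\<in>?K. \<Sum>j\<in>?K. germ_norm N r (germ_const (germ_coeff h i j) * (a ^ i * b ^ j)))"
    unfolding P_def by (intro order_trans[OF seminormlike_sum[OF sn]] sum_mono) auto
  also have "\<dots> \<le> (\<Sum>i\<in>?K. \<Sum>j\<in>?K. norm (germ_coeff h i j) * s ^ (i + j))"
  proof (intro sum_mono)
    fix i j
    have "germ_norm N r (a ^ i * b ^ j) \<le> germ_norm N r (a ^ i) * germ_norm N r (b ^ j)"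
      using sn by (simp add: seminormlike_def)
    also have "\<dots> \<le> germ_norm N r a ^ i * germ_norm N r b ^ j"
      using nn by (intro mult_mono germ_norm_power r) auto
    also have "\<dots> \<le> s ^ i * s ^ j"
      using le nn s by (intro mult_mono power_mono) auto
    finally show "germ_norm N r (germ_const (germ_coeff h i j) * (a ^ i * b ^ j))
        \<le> norm (germ_coeff h i j) * s ^ (i + j)"
      unfolding c by (intro mult_left_mono) (auto simp: power_add)
  qed
  finally show ?thesis by (simp add: germ_norm_altdef)
qed

definition fps2_int :: "fps2 \<Rightarrow> fps2" where
  "fps2_int h = Abs_fps (\<lambda>i. if i = 0 then 0 else fps_const (inverse (of_nat i)) * fps_nth h (i - 1))"

lemma coeff2_int: "coeff2 (fps2_int h) i j = (if i = 0 then 0 else coeff2 h (i - 1) j / of_nat i)"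
  by (simp add: coeff2_def fps2_int_def divide_inverse mult.commute)

text \<open>The factor \<open>r\<close> gained by integration lets the Picard map preserve a ball
  once \<open>r\<close> is small.\<close>

lemma box_sum_int:
  assumes "0 \<le> r" shows "box_sum N r (fps2_int h) \<le> r * box_sum N r h"
proof (cases N)
  case (Suc M)
  have "box_sum N r (fps2_int h)
      = (\<Sum>i\<le>M. \<Sum>j\<le>N. norm (coeff2 h i j) / real (Suc i) * r ^ Suc (i + j))"
    unfolding box_sum_altdef Suc sum.atMost_Suc_shift[of _ M]
    by (simp add: coeff2_int norm_divide del: sum.atMost_Suc of_nat_Suc)
  also have "\<dots> \<le> (\<Sum>i\<le>M. \<Sum>j\<le>N. norm (coeff2 h i j) * r ^ Suc (i + j))"
    using assms by (intro sum_mono mult_right_mono) (auto simp: divide_simps mult_le_cancel_left1)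
  also have "\<dots> \<le> (\<Sum>i\<le>N. \<Sum>j\<le>N. norm (coeff2 h i j) * r ^ Suc (i + j))"
    using assms Suc by (intro sum_mono2) (auto intro!: sum_nonneg simp del: sum.atMost_Suc)
  also have "\<dots> = r * box_sum N r h"
    by (simp add: box_sum_altdef sum_distrib_left mult_ac)
  finally show ?thesis .
qed (use assms in \<open>auto simp: box_sum_altdef coeff2_int\<close>)

lift_definition germ_int :: "germ \<Rightarrow> germ" is fps2_int
proof -
  fix h assume "convergent2 h"
  then obtain r B where r: "r > 0" "\<And>N. box_sum N r h \<le> B" using convergent2_iff by blast
  have "box_sum N r (fps2_int h) \<le> r * B" for N
    using box_sum_int[of r N h] mult_left_mono[OF r(2)[of N], of r] r(1) by linarith
  then show "convergent2 (fps2_int h)" unfolding convergent2_iff using r(1) by blast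
qed

lemma germ_coeff_int: "germ_coeff (germ_int h) i j = (if i = 0 then 0 else germ_coeff h (i - 1) j / of_nat i)"
  by transfer (rule coeff2_int)

lemma germ_norm_int: "0 \<le> r \<Longrightarrow> germ_norm N r (germ_int h) \<le> r * germ_norm N r h"
  using box_sum_int by (simp add: germ_norm_def germ_int.rep_eq)

lemma germ_dx_int: "germ_dx (germ_int h) = h"
  by (rule germ_eqI) (simp add: germ_coeff_dx germ_coeff_int del: of_nat_Suc)

lemma germ_dy_int: "germ_dy h = 0 \<Longrightarrow> germ_dy (germ_int h) = 0"
proof (rule germ_eqI)
  fix i j assume "germ_dy h = 0"
  then have "germ_coeff (germ_dy h) (i - 1) j = 0" by simp
  then show "germ_coeff (germ_dy (germ_int h)) i j = germ_coeff 0 i j"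
    by (simp add: germ_coeff_dy germ_coeff_int)
qed

lemma ord_ge_int: "ord_ge e h \<Longrightarrow> ord_ge (Suc e) (germ_int h)"
  by (auto simp: ord_ge_def germ_coeff_int)

lemma germ_int_diff: "germ_int (g - h) = germ_int g - germ_int h"
  by (rule germ_eqI) (simp add: germ_coeff_int diff_divide_distrib)

text \<open>\<open>a - b\<close> divides every a^i - b^i, so substitution respects congruence modulo
  powers of the maximal ideal. With the order gained by integration, this makes the Picard map
  contracting.\<close>

lemma ord_ge_subst_diff:
  assumes c: "germ_coeff c 0 0 = 0" and a: "germ_coeff a 0 0 = 0" and b: "germ_coeff b 0 0 = 0"
    and d: "ord_ge e (a - b)"
  shows "ord_ge e (germ_subst h c a - germ_subst h c b)"
proof -
  have pow: "ord_ge e (a ^ i - b ^ i)" for i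
  proof (induction i)
    case (Suc i)
    have "a ^ Suc i - b ^ Suc i = a * (a ^ i - b ^ i) + (a - b) * b ^ i" by (simp add: algebra_simps)
    then show ?case using ord_ge_add ord_ge_mult_left[OF Suc] ord_ge_mult_right[OF d] by metis
  qed (simp add: ord_ge_def)
  have "germ_coeff (c ^ i * a ^ j) k l = germ_coeff (c ^ i * b ^ j) k l" if "k + l < e" for i j k l
  proof -
    have "ord_ge e (c ^ i * (a ^ j - b ^ j))" by (rule ord_ge_mult_left[OF pow])
    then have "germ_coeff (c ^ i * (a ^ j - b ^ j)) k l = 0" using that by (simp add: ord_ge_def)
    then show ?thesis by (simp add: right_diff_distrib)
  qed
  then show ?thesis
    by (simp add: ord_ge_def germ_coeff_subst[OF c a order_refl] germ_coeff_subst[OF c b order_refl])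
qed

lemma germ_eq_0I: "(\<And>e. ord_ge e h) \<Longrightarrow> h = 0"
  unfolding ord_ge_def by (intro germ_eqI) (metis germ_coeff_zero lessI)

text \<open>The Picard iterates are bounded in a weighted l1-norm uniformly in the truncation order, so
  their coefficientwise limit converges.\<close>

lemma germ_ode:
  obtains w where "germ_dy w = 0" "germ_coeff w 0 0 = 0" "germ_dx w = germ_subst F germ_X w"
proof -
  obtain s B where s: "s > 0" "\<And>N. germ_norm N s F \<le> B"
    using Rep_germ[of F] convergent2_iff by (auto simp: germ_norm_def)
  define M where "M = max B 1"
  \<comment> \<open>\<open>r \<le> s\<close> bounds the norm of \<open>germ_X\<close> by
    \<open>s\<close>, and \<open>r * M \<le> s\<close> keeps all iterates in the ball of radius
    \<open>s\<close>.\<close>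
  define r where "r = min s (s / M)"
  have M: "0 < M" "\<And>N. germ_norm N s F \<le> M" using s(2) by (auto simp: M_def le_max_iff_disj)
  have r: "0 < r" "r \<le> s" "r * M \<le> s" using s M by (auto simp: r_def min_def field_simps)
  define T where "T = (\<lambda>w. germ_int (germ_subst F germ_X w))"
  define w where "w = (\<lambda>N. (T ^^ N) 0)"
  have w_Suc: "w (Suc N) = T (w N)" for N by (simp add: w_def)
  have X: "germ_coeff germ_X 0 0 = 0" by (simp add: germ_coeff_X)
  have w0: "germ_coeff (w N) 0 0 = 0" for N
    by (cases N) (simp_all add: w_def T_def germ_coeff_int)
  have wy: "germ_dy (w N) = 0" for N
  proof (induction N)
    case (Suc N)
    have "germ_dy (germ_subst F germ_X (w N)) = 0" by (simp add: chain_rule_dy X w0 Suc)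
    then show ?case by (simp add: w_Suc T_def germ_dy_int)
  qed (simp add: w_def)
  have norm_X: "germ_norm K r germ_X \<le> s" for K
  proof -
    have "germ_int 1 = germ_X"
      by (rule germ_eqI) (auto simp: germ_coeff_int germ_coeff_one germ_coeff_X)
    then have "germ_norm K r germ_X \<le> r * germ_norm K r 1"
      using germ_norm_int[of r K 1] r by simp
    also have "germ_norm K r 1 = 1"
      using seminormlike_germ_norm[of r K] r by (simp add: seminormlike_def)
    finally show ?thesis using r by simp
  qed
  have wn: "germ_norm K r (w N) \<le> s" for K N
  proof (induction N)
    case 0
    then show ?case using s by (simp add: w_def germ_norm_altdef)
  next
    case (Suc N)
    have "germ_norm K r (w (Suc N)) \<le> r * germ_norm K r (germ_subst F germ_X (w N))"
      unfolding w_Suc T_def using r by (intro germ_norm_int) auto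
    also have "\<dots> \<le> r * germ_norm (K + K) s F"
      using r by (intro mult_left_mono germ_norm_subst_le X w0 norm_X Suc) auto
    also have "\<dots> \<le> r * M" using r M by (intro mult_left_mono) auto
    finally show ?case using r by simp
  qed
  \<comment> \<open>Integration raises the order of a difference by one, so each iteration settles
    one more degree.\<close>
  have step: "ord_ge N (w (Suc N) - w N)" for N
  proof (induction N)
    case (Suc N)
    have "ord_ge (Suc N) (T (w (Suc N)) - T (w N))"
      unfolding T_def germ_int_diff[symmetric]
      by (intro ord_ge_int ord_ge_subst_diff X w0 Suc)
    then show ?case by (simp only: w_Suc)
  qed simp
  have stable: "ord_ge N (w (N + k) - w N)" for N k
  proof (induction k)
    case (Suc k)
    have "ord_ge N ((w (Suc (N + k)) - w (N + k)) + (w (N + k) - w N))"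
      by (rule ord_ge_add[OF ord_ge_le[OF step] Suc]) simp
    then show ?case by simp
  qed (simp add: ord_ge_def)
  \<comment> \<open>Coefficients of total degree i + j are final from iterate i + j + 1 on; these
    values define the limit.\<close>
  have eq: "germ_coeff (w N) i j = germ_coeff (w (Suc (i + j))) i j" if ij: "i + j < N" for i j N
  proof -
    obtain k where k: "N = Suc (i + j) + k" using less_imp_Suc_add[OF ij] by auto
    have "germ_coeff (w (Suc (i + j) + k) - w (Suc (i + j))) i j = 0"
      using stable[of "Suc (i + j)" k] unfolding ord_ge_def by blast
    then show ?thesis unfolding k by simp
  qed
  have "(\<Sum>i\<le>N. \<Sum>j\<le>N. norm (germ_coeff (w (Suc (i + j))) i j) * r ^ (i + j)) \<le> s" for N
  proof -
    have "(\<Sum>i\<le>N. \<Sum>j\<le>N. norm (germ_coeff (w (Suc (i + j))) i j) * r ^ (i + j))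
        = germ_norm N r (w (Suc (N + N)))"
      unfolding germ_norm_altdef
    proof (intro sum.cong refl)
      fix i j assume "i \<in> {..N}" "j \<in> {..N}"
      then have "i + j < Suc (N + N)" by simp
      then show "norm (germ_coeff (w (Suc (i + j))) i j) * r ^ (i + j)
          = norm (germ_coeff (w (Suc (N + N))) i j) * r ^ (i + j)"
        by (simp only: eq[OF \<open>i + j < Suc (N + N)\<close>])
    qed
    then show ?thesis using wn by simp
  qed
  then obtain v where v: "\<And>i j. germ_coeff v i j = germ_coeff (w (Suc (i + j))) i j"
    by (rule germ_exists[OF r(1), of "\<lambda>i j. germ_coeff (w (Suc (i + j))) i j"]) auto
  have vw: "ord_ge N (v - w N)" for N by (auto simp: ord_ge_def v intro!: eq[symmetric])
  have v0: "germ_coeff v 0 0 = 0" by (simp add: v w0)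
  have "germ_dy v = 0"
  proof (rule germ_eqI)
    fix i j
    have "germ_coeff (germ_dy (w (Suc (i + Suc j)))) i j = 0" by (simp add: wy)
    then show "germ_coeff (germ_dy v) i j = germ_coeff 0 i j" by (simp add: germ_coeff_dy v)
  qed
  \<comment> \<open>The limit agrees with the iterates to ever higher order, so the equation holds
    modulo every power of the maximal ideal.\<close>
  moreover have "germ_dx v - germ_subst F germ_X v = 0"
  proof (rule germ_eq_0I)
    fix N
    have "germ_dx v - germ_subst F germ_X v
        = germ_dx (v - w (Suc N)) - (germ_subst F germ_X v - germ_subst F germ_X (w N))"
      by (simp add: w_Suc T_def germ_dx_int)
    moreover have "ord_ge N \<dots>"
      by (rule ord_ge_diff[OF ord_ge_dx[OF vw] ord_ge_subst_diff[OF X v0 w0 vw]])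
    ultimately show "ord_ge N (germ_dx v - germ_subst F germ_X v)" by (simp only:)
  qed
  ultimately show ?thesis using that v0 by auto
qed


section \<open>Branches of parametrized curves\<close>

lemma germ_coeff_X_00 [simp]: "germ_coeff germ_X 0 0 = 0"
  and germ_coeff_Y_00 [simp]: "germ_coeff germ_Y 0 0 = 0"
  by (simp_all add: germ_coeff_X germ_coeff_Y)

text \<open>\<open>\<zeta> = 1\<close> gives the ramified cover X -> X^k, and \<open>k = 1\<close>
  with a root of unity gives its deck transformations; both act monomial by monomial.\<close>

lemma germ_coeff_ramified:
  assumes k: "0 < k"
  shows "germ_coeff (germ_subst h (germ_const \<zeta> * germ_X ^ k) germ_Y) i j
           = (if k dvd i then \<zeta> ^ (i div k) * germ_coeff h (i div k) j else 0)"
proof -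
  define K where "K = i + j"
  have "germ_coeff (germ_subst h (germ_const \<zeta> * germ_X ^ k) germ_Y) i j
      = (\<Sum>i'\<le>K. \<Sum>j'\<le>K. germ_coeff h i' j' * germ_coeff (germ_const (\<zeta> ^ i') * germ_X ^ (k * i') * germ_Y ^ j') i j)"
    using k by (simp add: germ_coeff_subst[where K = K] K_def power_mult_distrib germ_const_power power_mult)
  also have "\<dots> = (\<Sum>i'\<le>K. \<Sum>j'\<le>K. if j = j' then if i = k * i' then \<zeta> ^ i' * germ_coeff h i' j else 0 else 0)"
    unfolding germ_coeff_monomial by (intro sum.cong refl) auto
  also have "\<dots> = (\<Sum>i'\<le>K. if i = k * i' then \<zeta> ^ i' * germ_coeff h i' j else 0)"
    by (simp add: K_def)
  also have "\<dots> = (\<Sum>i'\<le>K. if i' = i div k then if k dvd i then \<zeta> ^ (i div k) * germ_coeff h (i div k) j else 0 else 0)"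
    using k by (intro sum.cong refl) auto
  also have "\<dots> = (if k dvd i then \<zeta> ^ (i div k) * germ_coeff h (i div k) j else 0)"
    by (auto simp: K_def intro: trans_le_add1)
  finally show ?thesis .
qed

lemma germ_ramified_inj:
  assumes "0 < k" "germ_subst g (germ_X ^ k) germ_Y = germ_subst h (germ_X ^ k) germ_Y"
  shows "g = h"
proof (rule germ_eqI)
  fix i j
  show "germ_coeff g i j = germ_coeff h i j"
    using germ_coeff_ramified[OF assms(1), of g 1 "k * i" j] germ_coeff_ramified[OF assms(1), of h 1 "k * i" j]
      assms by simp
qed

text \<open>Germs invariant under the deck group descend: a primitive k-th root of unity alone kills
  every coefficient whose exponent of x is not a multiple of \<open>k\<close>.\<close>

lemma germ_invariant_ramified:
  assumes k: "0 < k" and inv: "\<And>\<zeta>. \<zeta> ^ k = 1 \<Longrightarrow> germ_subst h (germ_const \<zeta> * germ_X) germ_Y = h"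
  obtains g where "h = germ_subst g (germ_X ^ k) germ_Y"
proof -
  define z where "z = exp (2 * of_real pi * \<i> * of_nat 1 / of_nat k)"
  have z: "z ^ k = 1" unfolding z_def using k by (intro complex_root_unity) auto
  have zi: "z ^ i = exp (2 * of_real pi * \<i> * of_nat i / of_nat k)" for i
    by (simp add: z_def exp_of_nat_mult[symmetric] mult_ac)
  have vanish: "germ_coeff h i j = 0" if "\<not> k dvd i" for i j
  proof -
    have "z ^ i \<noteq> 1" unfolding zi using k that by (subst complex_root_unity_eq_1) auto
    moreover have "germ_coeff h i j = z ^ i * germ_coeff h i j"
      using germ_coeff_ramified[of 1 h z i j] inv[OF z] by simp
    ultimately show ?thesis by auto
  qed
  have "inj (\<lambda>(i, j::nat). (k * i, j))" using k by (auto simp: inj_def)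
  then obtain g where g: "\<And>i j. germ_coeff g i j = germ_coeff h (k * i) j"
    by (rule germ_reindex[of "\<lambda>i j. k * i" "\<lambda>i j. j" k 0 h]) (use k in \<open>auto simp: distrib_left\<close>)
  have "h = germ_subst g (germ_X ^ k) germ_Y"
  proof (rule germ_eqI)
    fix i j
    show "germ_coeff h i j = germ_coeff (germ_subst g (germ_X ^ k) germ_Y) i j"
      using germ_coeff_ramified[OF k, of g 1 i j] vanish[of i j] by (auto simp: g)
  qed
  then show ?thesis by (rule that)
qed

lemma germ_subst_no_y:
  assumes t: "germ_dy \<theta> = 0" and c: "germ_coeff c 0 0 = 0"
  shows "germ_subst \<theta> germ_X c = \<theta>"
proof -
  have no_y: "germ_coeff \<theta> i (Suc j) = 0" for i j
  proof -
    have "germ_coeff (germ_dy \<theta>) i j = 0" using t by simp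
    then show ?thesis by (simp add: germ_coeff_dy del: of_nat_Suc)
  qed
  show ?thesis
  proof (rule germ_eqI)
    fix k l :: nat
    define K where "K = k + l"
    have "germ_coeff (germ_subst \<theta> germ_X c) k l
        = (\<Sum>i\<le>K. \<Sum>j\<le>K. germ_coeff \<theta> i j * germ_coeff (germ_X ^ i * c ^ j) k l)"
      by (rule germ_coeff_subst) (simp_all add: c K_def)
    also have "\<dots> = (\<Sum>i\<le>K. \<Sum>j\<le>K. germ_coeff \<theta> i j * germ_coeff (germ_X ^ i * germ_Y ^ j) k l)"
    proof (intro sum.cong refl)
      fix i j show "germ_coeff \<theta> i j * germ_coeff (germ_X ^ i * c ^ j) k l
          = germ_coeff \<theta> i j * germ_coeff (germ_X ^ i * germ_Y ^ j) k l"
        by (cases j) (simp_all add: no_y)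
    qed
    also have "\<dots> = germ_coeff (germ_subst \<theta> germ_X germ_Y) k l"
      by (rule germ_coeff_subst[symmetric]) (simp_all add: K_def)
    finally show "germ_coeff (germ_subst \<theta> germ_X c) k l = germ_coeff \<theta> k l" by simp
  qed
qed

lemma germ_Y_dvd_iff: "germ_Y dvd h \<longleftrightarrow> germ_subst h germ_X 0 = 0"
proof
  assume "germ_Y dvd h"
  then obtain g where "h = germ_Y * g" by (rule dvdE)
  then show "germ_subst h germ_X 0 = 0" by (simp add: germ_subst_simps)
next
  assume z: "germ_subst h germ_X 0 = 0"
  have "germ_coeff h i j = 0" if "j < 1" for i j
  proof -
    have "germ_coeff (germ_subst h germ_X 0) i 0
        = (\<Sum>i'\<le>i. \<Sum>j\<le>i. germ_coeff h i' j * germ_coeff (germ_X ^ i' * 0 ^ j) i 0)"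
      by (rule germ_coeff_subst) simp_all
    also have "\<dots> = (\<Sum>i'\<le>i. \<Sum>j\<le>i. if j = 0 then if i' = i then germ_coeff h i 0 else 0 else 0)"
    proof (intro sum.cong refl)
      fix i' j
      show "germ_coeff h i' j * germ_coeff (germ_X ^ i' * 0 ^ j) i 0
          = (if j = 0 then if i' = i then germ_coeff h i 0 else 0 else 0)"
        using germ_coeff_monomial[of 1 i' 0 i 0] by (cases j) auto
    qed
    also have "\<dots> = germ_coeff h i 0" by simp
    finally show ?thesis using z that by simp
  qed
  then obtain g where "h = germ_Y ^ 1 * g" by (rule germ_Y_power_dvdE)
  then show "germ_Y dvd h" by simp
qed

text \<open>The shear Y -> Y + \<theta> moves the root to Y = 0; it leaves \<theta> itself fixed
  because \<theta> does not involve y.\<close>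

lemma germ_root_dvd:
  assumes t: "germ_coeff \<theta> 0 0 = 0" "germ_dy \<theta> = 0" and z: "germ_subst h germ_X \<theta> = 0"
  shows "(germ_Y - \<theta>) dvd h"
proof -
  note theta = germ_subst_no_y[OF t(2)]
  define h' where "h' = germ_subst h germ_X (germ_Y + \<theta>)"
  have h'0: "germ_subst h' germ_X 0 = 0"
    using t z by (simp add: h'_def germ_subst_assoc germ_subst_simps theta)
  then have "germ_Y dvd h'" by (simp add: germ_Y_dvd_iff)
  then obtain g where g: "h' = germ_Y * g" by (rule dvdE)
  have "h = germ_subst h' germ_X (germ_Y - \<theta>)"
    using t by (simp add: h'_def germ_subst_assoc germ_subst_simps theta)
  also have "\<dots> = (germ_Y - \<theta>) * germ_subst g germ_X (germ_Y - \<theta>)"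
    using t by (simp add: g germ_subst_simps)
  finally show ?thesis by (metis dvd_triv_left)
qed

text \<open>Factors are split off one at a time: in a domain, a root different from the earlier ones
  must be a root of the remaining quotient. The last assumption makes the roots behave as constants
  when one is substituted for y in another.\<close>

lemma germ_prod_roots_dvd:
  assumes "finite S" "\<And>\<theta>. \<theta> \<in> S \<Longrightarrow> germ_coeff \<theta> 0 0 = 0 \<and> germ_dy \<theta> = 0 \<and> germ_subst h germ_X \<theta> = 0"
    "\<And>\<theta> \<theta>'. \<theta> \<in> S \<Longrightarrow> \<theta>' \<in> S \<Longrightarrow> germ_subst \<theta>' germ_X \<theta> = \<theta>'"
  shows "(\<Prod>\<theta>\<in>S. germ_Y - \<theta>) dvd h"
  using assms
proof (induction S)
  case (insert \<theta> S)
  have "(\<Prod>\<theta>\<in>S. germ_Y - \<theta>) dvd h" using insert.prems by (intro insert.IH) auto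
  then obtain q where q: "h = (\<Prod>\<theta>\<in>S. germ_Y - \<theta>) * q" by (rule dvdE)
  have t: "germ_coeff \<theta> 0 0 = 0" "germ_dy \<theta> = 0" "germ_subst h germ_X \<theta> = 0" using insert.prems(1) by auto
  have "0 = (\<Prod>\<theta>'\<in>S. \<theta> - \<theta>') * germ_subst q germ_X \<theta>"
    using t(3) insert.prems(2)[of \<theta>] unfolding q
    by (simp add: germ_subst_simps germ_subst_prod t(1))
  moreover have "(\<Prod>\<theta>'\<in>S. \<theta> - \<theta>') \<noteq> 0" using insert.hyps by auto
  ultimately have "germ_subst q germ_X \<theta> = 0" by simp
  then have "(germ_Y - \<theta>) dvd q" using germ_root_dvd t by blast
  then show ?case using insert.hyps by (simp add: q mult.commute[of "germ_Y - \<theta>"] mult_dvd_mono)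
qed auto


text \<open>Two covectors that annihilate the same vector with nonzero first entry are
  proportional.\<close>

lemma wedge_along_curve:
  fixes R S N1 N2 x' y' :: germ
  assumes "R * x' + S * y' = 0" "N1 * x' + N2 * y' = 0" "x' \<noteq> 0"
  shows "R * N2 - S * N1 = 0"
proof -
  have "x' * (R * N2 - S * N1) = N2 * (R * x' + S * y') - S * (N1 * x' + N2 * y')"
    by (simp add: algebra_simps)
  then show ?thesis using assms by simp
qed

text \<open>The branch parametrized by (X^k, \<psi>) has as equation the norm of Y - \<psi>, the product of its
  distinct conjugates under X \<mapsto> \<zeta> X.\<close>

lemma germ_branch_equation:
  assumes k: "0 < k" and psi: "germ_coeff \<psi> 0 0 = 0" "germ_dy \<psi> = 0"
  obtains N where "irreducible N" "\<And>h. N dvd h \<longleftrightarrow> germ_subst h (germ_X ^ k) \<psi> = 0"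
proof -
  define \<sigma> where "\<sigma> = (\<lambda>\<zeta> h. germ_subst h (germ_const \<zeta> * germ_X) germ_Y)"
  define Z where "Z = {\<zeta>::complex. \<zeta> ^ k = 1}"
  \<comment> \<open>The image as a set keeps each conjugate once. If the parametrization is not
    primitive, repeated factors would make the norm a proper power.\<close>
  define S where "S = (\<lambda>\<zeta>. \<sigma> \<zeta> \<psi>) ` Z"
  have fin: "finite S" unfolding S_def Z_def using finite_roots_unity[of k] k by (intro finite_imageI) auto
  have Xk: "germ_coeff (germ_X ^ k) 0 0 = 0" using k by simp
  have comp: "\<sigma> \<zeta> (\<sigma> \<zeta>' h) = \<sigma> (\<zeta> * \<zeta>') h" for \<zeta> \<zeta>' h
    by (simp add: \<sigma>_def germ_subst_assoc germ_subst_simps germ_const_mult mult_ac)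
  have id: "\<sigma> 1 h = h" for h by (simp add: \<sigma>_def)
  have S0: "germ_coeff \<theta> 0 0 = 0" "germ_dy \<theta> = 0" if "\<theta> \<in> S" for \<theta>
    using that psi by (auto simp: S_def \<sigma>_def chain_rule_dy germ_dy_mult germ_subst_simps)
  have psi_S: "\<psi> \<in> S" unfolding S_def Z_def using id[of \<psi>] by (metis (mono_tags) imageI mem_Collect_eq power_one)
  have inj: "inj_on (\<sigma> \<zeta>) S" if "\<zeta> \<in> Z" for \<zeta>
  proof (rule inj_on_inverseI)
    fix x
    have "\<zeta> \<noteq> 0" using that k by (auto simp: Z_def zero_power)
    then show "\<sigma> (1 / \<zeta>) (\<sigma> \<zeta> x) = x" by (simp add: comp id)
  qed
  have perm: "\<sigma> \<zeta> ` S = S" if "\<zeta> \<in> Z" for \<zeta>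
  proof (rule endo_inj_surj[OF fin _ inj[OF that]])
    show "\<sigma> \<zeta> ` S \<subseteq> S" using that by (auto simp: S_def comp Z_def power_mult_distrib)
  qed
  define N' where "N' = (\<Prod>\<theta>\<in>S. germ_Y - \<theta>)"
  have N'_nz: "N' \<noteq> 0"
  proof
    assume "N' = 0"
    then obtain \<theta> where "\<theta> \<in> S" "germ_Y = \<theta>" using fin by (auto simp: N'_def)
    then show False using S0[of \<theta>] by simp
  qed
  have N'_inv: "\<sigma> \<zeta> N' = N'" if "\<zeta> \<in> Z" for \<zeta>
  proof -
    have "\<sigma> \<zeta> N' = (\<Prod>\<theta>\<in>S. germ_Y - \<sigma> \<zeta> \<theta>)"
      by (simp add: N'_def \<sigma>_def germ_subst_prod germ_subst_simps)
    also have "\<dots> = (\<Prod>\<theta>\<in>\<sigma> \<zeta> ` S. germ_Y - \<theta>)"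
      using inj[OF that] by (simp add: prod.reindex)
    finally show ?thesis by (simp add: perm[OF that] N'_def)
  qed
  obtain N where N: "N' = germ_subst N (germ_X ^ k) germ_Y"
    using germ_invariant_ramified[OF k, of N'] N'_inv by (auto simp: Z_def \<sigma>_def)
  have lift: "germ_subst (germ_subst h (germ_X ^ k) germ_Y) germ_X \<psi> = germ_subst h (germ_X ^ k) \<psi>" for h
    using psi Xk by (simp add: germ_subst_assoc germ_subst_simps)
  have N0: "germ_subst N (germ_X ^ k) \<psi> = 0"
  proof -
    have "germ_subst N' germ_X \<psi> = (\<Prod>\<theta>\<in>S. \<psi> - \<theta>)"
      using psi S0 by (simp add: N'_def germ_subst_prod germ_subst_simps germ_subst_no_y)
    also have "\<dots> = 0" using fin psi_S by auto
    finally show ?thesis by (simp add: N lift)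
  qed
  \<comment> \<open>On the ramified cover every conjugate of \<psi> is a root of \<open>h\<close>.
    The quotient by the product of the corresponding factors is again invariant under the deck
    group, hence descends.\<close>
  have dvd: "N dvd h" if h: "germ_subst h (germ_X ^ k) \<psi> = 0" for h
  proof -
    define h' where "h' = germ_subst h (germ_X ^ k) germ_Y"
    have h'_inv: "\<sigma> \<zeta> h' = h'" if "\<zeta> \<in> Z" for \<zeta>
    proof -
      have "(germ_const \<zeta> * germ_X) ^ k = germ_X ^ k"
        using that by (simp add: power_mult_distrib Z_def flip: germ_const_power)
      then show ?thesis using Xk by (simp add: \<sigma>_def h'_def germ_subst_assoc germ_subst_simps)
    qed
    have root: "germ_subst h' germ_X \<theta> = 0" if th: "\<theta> \<in> S" for \<theta>
    proof -
      obtain \<zeta> where z: "\<zeta> \<in> Z" "\<theta> = \<sigma> \<zeta> \<psi>" using th by (auto simp: S_def)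
      define cX where "cX = germ_const \<zeta> * germ_X"
      have cX: "germ_coeff cX 0 0 = 0" by (simp add: cX_def)
      have "germ_subst (\<sigma> \<zeta> h') germ_X (\<sigma> \<zeta> \<psi>) = germ_subst h' cX (\<sigma> \<zeta> \<psi>)"
        using psi cX by (simp add: \<sigma>_def germ_subst_assoc germ_subst_simps flip: cX_def)
          (simp add: cX_def germ_subst_simps psi)
      also have "\<dots> = \<sigma> \<zeta> (germ_subst h' germ_X \<psi>)"
        using psi cX by (simp add: \<sigma>_def germ_subst_assoc germ_subst_simps flip: cX_def)
      also have "\<dots> = 0" using h by (simp add: h'_def lift) (simp add: \<sigma>_def germ_subst_simps)
      finally show ?thesis using h'_inv z by simp
    qed
    have "N' dvd h'"
      unfolding N'_def using S0 root fin by (intro germ_prod_roots_dvd) (auto simp: germ_subst_no_y)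
    then obtain q where q: "h' = N' * q" by (rule dvdE)
    have "\<sigma> \<zeta> q = q" if "\<zeta> \<in> Z" for \<zeta>
    proof -
      have "N' * \<sigma> \<zeta> q = \<sigma> \<zeta> N' * \<sigma> \<zeta> q" by (simp add: N'_inv that)
      also have "\<dots> = \<sigma> \<zeta> h'" by (simp add: q \<sigma>_def germ_subst_simps)
      also have "\<dots> = N' * q" using h'_inv[OF that] by (simp add: q)
      finally show ?thesis using N'_nz by simp
    qed
    then obtain q' where q': "q = germ_subst q' (germ_X ^ k) germ_Y"
      using germ_invariant_ramified[OF k, of q] by (auto simp: Z_def \<sigma>_def)
    have "germ_subst h (germ_X ^ k) germ_Y = germ_subst (N * q') (germ_X ^ k) germ_Y"
      using q Xk by (simp add: h'_def N q' germ_subst_simps)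
    then have "h = N * q'" by (rule germ_ramified_inj[OF k])
    then show ?thesis by simp
  qed
  have iff: "N dvd h \<longleftrightarrow> germ_subst h (germ_X ^ k) \<psi> = 0" for h
    
  proof
    assume "N dvd h"
    then obtain q where "h = N * q" by (rule dvdE)
    then show "germ_subst h (germ_X ^ k) \<psi> = 0" using N0 psi Xk by (simp add: germ_subst_simps)
  qed (rule dvd)
  \<comment> \<open>\<open>N\<close> generates the kernel of a ring homomorphism into a domain, so
    it is prime and therefore irreducible.\<close>
  moreover have "irreducible N"
  proof (rule irreducibleI)
    show "N \<noteq> 0" using N'_nz Xk by (auto simp: N germ_subst_simps)
    show "\<not> N dvd 1" using psi Xk by (simp add: iff germ_subst_simps)
    fix a b assume ab: "N = a * b"
    then have "germ_subst a (germ_X ^ k) \<psi> * germ_subst b (germ_X ^ k) \<psi> = 0"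
      using N0 psi Xk by (simp add: germ_subst_simps)
    then have "N dvd a \<or> N dvd b" by (simp add: iff)
    moreover have "y dvd 1" if "N dvd x" "N = x * y" for x y
    proof -
      from \<open>N dvd x\<close> obtain z where "x = N * z" by (rule dvdE)
      then have "N * 1 = N * (y * z)" using \<open>N = x * y\<close> by (metis mult.assoc mult.commute mult.right_neutral)
      then have "1 = y * z" using \<open>N \<noteq> 0\<close> by (metis mult_left_cancel)
      then show ?thesis by (rule dvdI)
    qed
    ultimately show "a dvd 1 \<or> b dvd 1" using ab by (metis mult.commute)
  qed
  ultimately show ?thesis using that by blast
qed

text \<open>If the pullback of W to a surface is transversal to the coordinate line X = 0 at the origin, the
  leaf of the pullback through the origin is mapped to a separatrix of W.\<close>

lemma separatrix_of_transversal_pullback: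
  assumes k: "0 < k" and b: "germ_coeff b 0 0 = 0"
    and pb: "pullback (germ_X ^ k) b W = form_scale (germ_X ^ e) V"
    and tr: "germ_coeff (snd V) 0 0 \<noteq> 0"
  obtains N w where "irreducible N" "N dvd wedge W (differential N)"
    "germ_coeff w 0 0 = 0" "germ_dy w = 0"
    "\<And>h. N dvd h \<Longrightarrow> germ_subst h (germ_X ^ k) (germ_subst b germ_X w) = 0"
proof -
  obtain R S where W: "W = (R, S)" by force
  obtain A B where V: "V = (A, B)" by force
  obtain B' where B': "1 = B * B'" using tr by (auto simp: V germ_unit_iff[symmetric] dvd_def)
  \<comment> \<open>The leaf of \<open>V\<close> through the origin: \<open>V\<close> annihilates
    (1, w') exactly if w' = - A / B, and \<open>B'\<close> is 1 / B.\<close>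
  obtain w where w: "germ_dy w = 0" "germ_coeff w 0 0 = 0" "germ_dx w = germ_subst (- (A * B')) germ_X w"
    by (rule germ_ode)
  define \<psi> where "\<psi> = germ_subst b germ_X w"
  have Xk: "germ_coeff (germ_X ^ k) 0 0 = 0" using k by simp
  have psi: "germ_coeff \<psi> 0 0 = 0" "germ_dy \<psi> = 0"
    using b w by (simp_all add: \<psi>_def chain_rule_dy)
  obtain N where N: "irreducible N" "\<And>h. N dvd h \<longleftrightarrow> germ_subst h (germ_X ^ k) \<psi> = 0"
    using germ_branch_equation[OF k psi] by blast
  let ?c = "\<lambda>h. germ_subst h (germ_X ^ k) \<psi>"
  let ?x' = "of_nat k * germ_X ^ (k - 1)"
  have c: "?c h = germ_subst (germ_subst h (germ_X ^ k) b) germ_X w" for h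
    using b w Xk by (simp add: germ_subst_assoc germ_subst_simps \<psi>_def)
  have x': "germ_dx (germ_X ^ k) = ?x'" by (simp add: germ_dx_power)
  have e1: "germ_subst R (germ_X ^ k) b * ?x' + germ_subst S (germ_X ^ k) b * germ_dx b = germ_X ^ e * A"
    and e2: "germ_subst S (germ_X ^ k) b * germ_dy b = germ_X ^ e * B"
    using pb by (simp_all add: W V pullback_def form_scale_def differential_def germ_dx_power germ_dy_power)
  \<comment> \<open>The image curve is integral for \<open>W\<close> because its lift is integral
    for \<open>V\<close>. Below, dN is seen to annihilate the same velocity.\<close>
  have "?c R * ?x' + ?c S * germ_dx \<psi>
      = germ_subst (germ_X ^ e * A) germ_X w + germ_subst (germ_X ^ e * B) germ_X w * germ_dx w"
    unfolding e1[symmetric] e2[symmetric] c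
    using w(2) by (simp add: germ_subst_simps \<psi>_def chain_rule_dx algebra_simps)
  also have "\<dots> = germ_X ^ e * germ_subst (A * (1 - B * B')) germ_X w"
    unfolding w(3) using w(2) by (simp add: germ_subst_simps algebra_simps)
  also have "\<dots> = 0" using w(2) by (simp add: B'[symmetric] germ_subst_simps)
  finally have r1: "?c R * ?x' + ?c S * germ_dx \<psi> = 0" .
  have "?c N = 0" using N(2)[of N] by simp
  then have "germ_dx (?c N) = 0" by simp
  then have r2: "?c (germ_dx N) * ?x' + ?c (germ_dy N) * germ_dx \<psi> = 0"
    using psi Xk by (simp add: chain_rule_dx x')
  have "?c R * ?c (germ_dy N) - ?c S * ?c (germ_dx N) = 0"
    by (rule wedge_along_curve[OF r1 r2]) (use k in simp)
  then have "?c (wedge W (differential N)) = 0"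
    using psi Xk by (simp add: W wedge_def differential_def germ_subst_simps)
  then have dvd: "N dvd wedge W (differential N)" by (simp add: N(2))
  show ?thesis
  proof (rule that[OF N(1) dvd w(2) w(1)])
    fix h assume "N dvd h"
    then show "germ_subst h (germ_X ^ k) (germ_subst b germ_X w) = 0"
      using N(2)[of h] by (simp add: \<psi>_def)
  qed
qed

section \<open>Weighted initial parts\<close>

text \<open>The part of \<open>h\<close> of weight \<open>e\<close> for the weights (n, m),
  evaluated at (1, v). For positive weights the whole line lies in the range i, j \<le> e.\<close>

definition line_sum :: "nat \<Rightarrow> nat \<Rightarrow> germ \<Rightarrow> nat \<Rightarrow> complex \<Rightarrow> complex" where
  "line_sum n m h e v = (\<Sum>i\<le>e. \<Sum>j\<le>e. if n * i + m * j = e then germ_coeff h i j * v ^ j else 0)"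

text \<open>A monomial x^i y^j acquires the factor X^(n i + m j); after division by X^e only the
  part of weight \<open>e\<close> survives at the origin.\<close>

lemma weighted_subst:
  assumes n: "0 < n" and m: "0 < m"
    and h: "\<And>i j. germ_coeff h i j \<noteq> 0 \<Longrightarrow> e \<le> n * i + m * j"
  obtains K where "germ_subst h (germ_X ^ n) (germ_X ^ m * c) = germ_X ^ e * K"
    "germ_coeff K 0 0 = line_sum n m h e (germ_coeff c 0 0)"
proof -
  have coeff: "germ_coeff (germ_subst h (germ_X ^ n) (germ_X ^ m * c)) k l
      = (\<Sum>i\<le>k + l. \<Sum>j\<le>k + l. germ_coeff h i j *
           (if k < n * i + m * j then 0 else germ_coeff (c ^ j) (k - (n * i + m * j)) l))" for k l
  proof -
    have "(germ_X ^ n) ^ i * (germ_X ^ m * c) ^ j = germ_X ^ (n * i + m * j) * c ^ j" for i j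
      by (simp add: power_mult_distrib power_add power_mult)
    then show ?thesis
      using n m by (subst germ_coeff_subst[OF _ _ order_refl]) (simp_all add: germ_coeff_X_power_mult)
  qed
  have "germ_coeff (germ_subst h (germ_X ^ n) (germ_X ^ m * c)) k l = 0" if "k < e" for k l
    unfolding coeff using h that by (intro sum.neutral ballI) (force dest: order_less_le_trans)
  then obtain K where K: "germ_subst h (germ_X ^ n) (germ_X ^ m * c) = germ_X ^ e * K"
      "\<And>i j. germ_coeff K i j = germ_coeff (germ_subst h (germ_X ^ n) (germ_X ^ m * c)) (i + e) j"
    by (rule germ_X_power_dvdE) auto
  have "germ_coeff K 0 0 = germ_coeff (germ_subst h (germ_X ^ n) (germ_X ^ m * c)) e 0" by (simp add: K(2))
  also have "\<dots> = line_sum n m h e (germ_coeff c 0 0)"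
    unfolding coeff line_sum_def add_0_right
  proof (intro sum.cong refl)
    fix i j
    show "germ_coeff h i j * (if e < n * i + m * j then 0 else germ_coeff (c ^ j) (e - (n * i + m * j)) 0)
        = (if n * i + m * j = e then germ_coeff h i j * germ_coeff c 0 0 ^ j else 0)"
      using h[of i j] by (cases "n * i + m * j" e rule: linorder_cases) auto
  qed
  finally have "germ_coeff K 0 0 = line_sum n m h e (germ_coeff c 0 0)" .
  with K(1) show ?thesis by (rule that)
qed

text \<open>On a line of given weight, j determines i, so the sum is a nonzero polynomial in
  \<open>v\<close> with finitely many zeros. Avoiding v^n = 1 keeps the point off the strict
  transform of f.\<close>

lemma line_sum_generic_nonzero:
  assumes n: "0 < n" and m: "0 < m" and h: "germ_coeff h i j \<noteq> 0"
  obtains v where "line_sum n m h (n * i + m * j) v \<noteq> 0" "v ^ n \<noteq> 1"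
proof -
  define e where "e = n * i + m * j"
  define P where "P = (\<Sum>i'\<le>e. \<Sum>j'\<le>e. if n * i' + m * j' = e then monom (germ_coeff h i' j') j' else 0)"
  have le: "i \<le> e" "j \<le> e" using n m by (auto simp: e_def intro: trans_le_add1 trans_le_add2)
  have "coeff P j = (\<Sum>i'\<le>e. \<Sum>j'\<le>e. if j' = j then if i' = i then germ_coeff h i j else 0 else 0)"
    unfolding P_def coeff_sum using n by (intro sum.cong refl) (auto simp: e_def)
  also have "\<dots> = germ_coeff h i j" using le by simp
  finally have "P \<noteq> 0" using h by auto
  then have "finite {v. poly P v = 0}" by (rule poly_roots_finite)
  moreover have "finite {v::complex. v ^ n = 1}" using n by (intro finite_roots_unity) auto
  ultimately have "\<exists>v. v \<notin> {v. poly P v = 0} \<union> {v. v ^ n = 1}"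
    by (intro ex_new_if_finite) (auto simp: infinite_UNIV_char_0)
  then obtain v where v: "poly P v \<noteq> 0" "v ^ n \<noteq> 1" by auto
  have "poly P v = line_sum n m h e v"
    unfolding P_def line_sum_def poly_sum by (intro sum.cong refl) (auto simp: poly_monom)
  then show ?thesis using that v by (simp add: e_def)
qed

section \<open>Dicritical cases\<close>

definition qh_form :: "nat \<Rightarrow> nat \<Rightarrow> germ \<Rightarrow> form" where
  "qh_form n m h = differential (germ_Y ^ n - germ_X ^ m)
     + form_scale h (- of_nat m * germ_Y, of_nat n * germ_X)"

lemma wedge_form_scale: "wedge (form_scale u W) V = u * wedge W V"
  by (simp add: wedge_def form_scale_def algebra_simps)

lemma FolE:
  assumes "foliation W \<in> Fol f"
  obtains u W' where "u dvd 1" "W = form_scale u W'" "W' \<in> Fol_forms f" "union_of_separatrices_is W' f"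
proof -
  obtain W' where W': "foliation W = foliation W'" "W' \<in> Fol_forms f" "union_of_separatrices_is W' f"
    using assms by (auto simp: Fol_def)
  have "W \<in> foliation W" unfolding foliation_def
    by (auto simp: form_scale_def intro!: exI[of _ 1])
  then have "W \<in> foliation W'" using W'(1) by simp
  then obtain u where "u dvd 1" "W = form_scale u W'" unfolding foliation_def by blast
  then show ?thesis using W'(2,3) by (rule that)
qed

lemma Fol_singular: "foliation W \<in> Fol f \<Longrightarrow> singular W"
  by (erule FolE) (auto simp: Fol_forms_def defines_foliation_def singular_def form_scale_def)

lemma curve_eq_dvd: "curve a = curve b \<Longrightarrow> a dvd b"
proof -
  assume eq: "curve a = curve b"
  have "b \<in> curve b" by (simp add: curve_def)
  then have "b \<in> curve a" by (simp only: eq)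
  then show "a dvd b" by (simp add: curve_def)
qed

text \<open>Another 1-form of the same foliation changes the wedge only by a unit. So
  \<open>g\<close> is a separatrix of the representative whose separatrices multiply to
  \<open>f\<close>.\<close>

lemma Fol_separatrix_dvd:
  assumes W: "foliation W \<in> Fol f" and g: "irreducible g" "g dvd wedge W (differential g)"
  shows "g dvd f"
  using W
proof (rule FolE)
  fix u W' assume u: "u dvd 1" "W = form_scale u W'" and W': "union_of_separatrices_is W' f"
  obtain F where F: "finite F" "bij_betw curve F (separatrices W')" "curve f = curve (\<Prod>g\<in>F. g)"
    using W' by (auto simp: union_of_separatrices_is_def)
  have "g dvd u * wedge W' (differential g)" using g(2) by (simp add: u wedge_form_scale)
  moreover from u(1) obtain v where "1 = u * v" by (rule dvdE)
  then have "wedge W' (differential g) = u * wedge W' (differential g) * v"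
    by (simp add: mult_ac)
  ultimately have "g dvd wedge W' (differential g)" by (metis dvd_mult2)
  then have "curve g \<in> separatrices W'" using g(1) by (auto simp: separatrices_def)
  then have "curve g \<in> curve ` F" using F(2) by (simp add: bij_betw_def)
  then obtain g' where g': "curve g = curve g'" "g' \<in> F" by (rule imageE)
  have "g dvd g'" using g'(1) by (rule curve_eq_dvd)
  also have "g' dvd (\<Prod>g\<in>F. g)" using F(1) g'(2) by (rule dvd_prodI)
  also have "\<dots> dvd f" using F(3)[symmetric] by (rule curve_eq_dvd)
  finally show ?thesis .
qed

text \<open>The source of both dicritical contradictions: a leaf transversal to X = 0 projects to a
  separatrix, so \<open>f\<close> has to vanish along it.\<close>

lemma Fol_no_extra_separatrix:
  assumes W: "foliation W \<in> Fol f" and k: "0 < k" and b: "germ_coeff b 0 0 = 0"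
    and pb: "pullback (germ_X ^ k) b W = form_scale (germ_X ^ e) V"
    and tr: "germ_coeff (snd V) 0 0 \<noteq> 0"
  obtains w where "germ_coeff w 0 0 = 0" "germ_subst f (germ_X ^ k) (germ_subst b germ_X w) = 0"
  using separatrix_of_transversal_pullback[OF k b pb tr] Fol_separatrix_dvd[OF W] that by metis

text \<open>In the weighted chart f becomes X^(n m) (c^n - 1), and n x dy - m y dx becomes n X^(n +
  m) dc, without a dX part; hence \<open>h\<close> enters the second component only.\<close>

lemma pullback_qh_form:
  assumes n: "0 < n" and m: "0 < m" and c: "germ_dx c = 0" "germ_dy c = 1"
  shows "pullback (germ_X ^ n) (germ_X ^ m * c) (qh_form n m h) =
    (of_nat (m * n) * germ_X ^ (n * m - 1) * (c ^ n - 1),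
     of_nat n * (germ_X ^ (n * m) * c ^ (n - 1)
       + germ_X ^ (n + m) * germ_subst h (germ_X ^ n) (germ_X ^ m * c)))"
proof -
  have ab: "germ_coeff (germ_X ^ n) 0 0 = 0" "germ_coeff (germ_X ^ m * c) 0 0 = 0" using n m by simp_all
  note simps = germ_subst_simps[OF ab]
  define h' where "h' = germ_subst h (germ_X ^ n) (germ_X ^ m * c)"
  let ?R = "- of_nat m * ((germ_X ^ n) ^ (m - 1) + h' * (germ_X ^ m * c))"
  let ?S = "of_nat n * ((germ_X ^ m * c) ^ (n - 1) + h' * germ_X ^ n)"
  have RS: "germ_subst (fst (qh_form n m h)) (germ_X ^ n) (germ_X ^ m * c) = ?R"
    "germ_subst (snd (qh_form n m h)) (germ_X ^ n) (germ_X ^ m * c) = ?S"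
    by (simp_all add: qh_form_def differential_def form_scale_def germ_dx_power germ_dy_power simps
        flip: h'_def) (simp_all add: algebra_simps)
  obtain n' m' where nm: "n = Suc n'" "m = Suc m'" using n m by (metis gr0_conv_Suc)
  have e1: "(germ_X ^ n) ^ (m - 1) * germ_X ^ (n - 1) = germ_X ^ (n * m - 1)"
    and e2: "(germ_X ^ m) ^ (n - 1) * germ_X ^ (m - 1) = germ_X ^ (n * m - 1)"
    and e3: "(germ_X ^ m) ^ (n - 1) * germ_X ^ m = germ_X ^ (n * m)"
    and e4: "germ_X ^ n * germ_X ^ (m - 1) = germ_X ^ m * germ_X ^ (n - 1)"
    and e5: "c ^ (n - 1) * c = c ^ n"
    unfolding power_mult[symmetric] power_add[symmetric] using n
    by (simp_all add: nm algebra_simps)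
  have "fst (pullback (germ_X ^ n) (germ_X ^ m * c) (qh_form n m h))
      = ?R * (of_nat n * germ_X ^ (n - 1)) + ?S * (of_nat m * germ_X ^ (m - 1) * c)"
    by (simp only: pullback_def fst_add form_scale_def differential_def fst_conv snd_conv RS)
      (simp add: germ_dx_mult germ_dx_power c)
  also have "\<dots> = of_nat (m * n) * (((germ_X ^ m) ^ (n - 1) * germ_X ^ (m - 1)) * (c ^ (n - 1) * c)
      - (germ_X ^ n) ^ (m - 1) * germ_X ^ (n - 1))
      + of_nat (m * n) * h' * c * (germ_X ^ n * germ_X ^ (m - 1) - germ_X ^ m * germ_X ^ (n - 1))"
    by (simp add: power_mult_distrib algebra_simps)
  also have "\<dots> = of_nat (m * n) * germ_X ^ (n * m - 1) * (c ^ n - 1)"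
    unfolding e1 e2 e4 e5 by (simp add: algebra_simps)
  finally have 1: "fst (pullback (germ_X ^ n) (germ_X ^ m * c) (qh_form n m h))
      = of_nat (m * n) * germ_X ^ (n * m - 1) * (c ^ n - 1)" .
  have "snd (pullback (germ_X ^ n) (germ_X ^ m * c) (qh_form n m h)) = ?S * germ_X ^ m"
    by (simp only: pullback_def snd_add form_scale_def differential_def fst_conv snd_conv RS)
      (simp add: germ_dy_mult germ_dy_power c)
  also have "\<dots> = of_nat n * (((germ_X ^ m) ^ (n - 1) * germ_X ^ m) * c ^ (n - 1) + germ_X ^ (n + m) * h')"
    by (simp add: power_mult_distrib power_add algebra_simps)
  finally have 2: "snd (pullback (germ_X ^ n) (germ_X ^ m * c) (qh_form n m h))
      = of_nat n * (germ_X ^ (n * m) * c ^ (n - 1) + germ_X ^ (n + m) * h')" unfolding e3 .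
  show ?thesis using 1 2 by (intro prod_eqI) (simp_all add: h'_def)
qed

lemma X_power_diff_factor:
  assumes "a * n = b * m"
  shows "(germ_X ^ a * x) ^ n - (germ_X ^ b) ^ m = germ_X ^ (a * n) * (x ^ n - 1)"
  using assms by (simp add: power_mult_distrib right_diff_distrib flip: power_mult)

text \<open>A term of h below the Newton polygon of f makes the exceptional divisor of the weighted blow-up
  noninvariant.\<close>

lemma Fol_weight_ge:
  assumes W: "foliation (qh_form n m h) \<in> Fol (germ_Y ^ n - germ_X ^ m)" and n: "0 < n" and m: "0 < m"
    and hij: "germ_coeff h i j \<noteq> 0"
  shows "n * m \<le> n * (i + 1) + m * (j + 1)"
proof (rule ccontr)
  assume lt: "\<not> ?thesis"
  define P where "P = (\<lambda>e. \<exists>i j. germ_coeff h i j \<noteq> 0 \<and> e = n * i + m * j)"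
  \<comment> \<open>The least weight occurring in \<open>h\<close>; by assumption it is smaller than
    n m - n - m.\<close>
  define e where "e = Least P"
  have P: "P (n * i + m * j)" using hij by (auto simp: P_def)
  have e_le: "e \<le> n * i + m * j" if "germ_coeff h i j \<noteq> 0" for i j
    unfolding e_def by (rule Least_le) (use that in \<open>auto simp: P_def\<close>)
  have "P e" unfolding e_def by (rule LeastI[of P, OF P])
  then obtain i0 j0 where ij0: "germ_coeff h i0 j0 \<noteq> 0" "e = n * i0 + m * j0" by (auto simp: P_def)
  have e_lt: "e + n + m < n * m" using e_le[OF hij] lt by (simp add: algebra_simps)
  obtain v where v: "line_sum n m h e v \<noteq> 0" "v ^ n \<noteq> 1"
    by (rule line_sum_generic_nonzero[OF n m ij0(1), folded ij0(2)])
  define c where "c = germ_const v + germ_Y"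
  have c: "germ_dx c = 0" "germ_dy c = 1" "germ_coeff c 0 0 = v" by (simp_all add: c_def germ_coeff_const)
  obtain K where K: "germ_subst h (germ_X ^ n) (germ_X ^ m * c) = germ_X ^ e * K"
      "germ_coeff K 0 0 = line_sum n m h e v"
    by (rule weighted_subst[OF n m e_le, of h c, unfolded c(3)])
  \<comment> \<open>Compared with the power X^(e + n + m) coming from \<open>h\<close>, the terms of
    df have surplus order l in dX and l + 1 in dY. After division the dY coefficient at the origin
    is therefore that of \<open>K\<close>.\<close>
  define l where "l = n * m - 1 - (e + n + m)"
  have l: "n * m - 1 = (e + n + m) + l" "n * m = (e + n + m) + Suc l" using e_lt by (auto simp: l_def)
  define V where "V = (of_nat (m * n) * germ_X ^ l * (c ^ n - 1), of_nat n * (germ_X ^ Suc l * c ^ (n - 1) + K))"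
  have pb: "pullback (germ_X ^ n) (germ_X ^ m * c) (qh_form n m h) = form_scale (germ_X ^ (e + n + m)) V"
  proof -
    have "germ_X ^ (n * m - 1) = germ_X ^ (e + n + m) * germ_X ^ l"
      "germ_X ^ (n * m) = germ_X ^ (e + n + m) * germ_X ^ Suc l"
      unfolding power_add[symmetric] by (simp_all add: l)
    then show ?thesis
      unfolding pullback_qh_form[OF n m c(1,2)] K(1) V_def form_scale_def
      by (simp only: fst_conv snd_conv) (simp add: power_add algebra_simps)
  qed
  have tr: "germ_coeff (snd V) 0 0 \<noteq> 0" using n v K(2) by (simp add: V_def germ_coeff_of_nat)
  have b0: "germ_coeff (germ_X ^ m * c) 0 0 = 0" using m by simp
  obtain w where w: "germ_coeff w 0 0 = 0"
      "germ_subst (germ_Y ^ n - germ_X ^ m) (germ_X ^ n) (germ_subst (germ_X ^ m * c) germ_X w) = 0"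
    by (rule Fol_no_extra_separatrix[OF W n b0 pb tr])
  \<comment> \<open>Along the leaf, f is a power of X times a series whose constant term v^n - 1 is
    nonzero.\<close>
  have "(germ_X ^ m * (germ_const v + w)) ^ n - (germ_X ^ n) ^ m = 0"
    using w n m by (simp add: c_def germ_subst_simps)
  then have "germ_X ^ (m * n) * ((germ_const v + w) ^ n - 1) = 0"
    by (subst (asm) X_power_diff_factor) (simp_all add: mult.commute)
  then have "(germ_const v + w) ^ n - 1 = 0" by simp
  then have "germ_coeff ((germ_const v + w) ^ n - 1) 0 0 = 0" by simp
  then show False using v w by (simp add: germ_coeff_const germ_coeff_one)
qed

text \<open>A resonant node on the exceptional divisor of the weighted blow-up is resolved into a
  noninvariant component by the further weighted blow-up with weights \<alpha> and \<beta>.\<close>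

lemma Fol_not_node:
  assumes W: "foliation (qh_form n m h) \<in> Fol (germ_Y ^ n - germ_X ^ m)" and n: "2 \<le> n" and m: "2 \<le> m"
    and v: "v ^ n = 1"
  shows "1 + v * line_sum n m h (n * m - n - m) v \<notin> neg_rats"
proof
  assume "1 + v * line_sum n m h (n * m - n - m) v \<in> neg_rats"
  then obtain q where q: "1 + v * line_sum n m h (n * m - n - m) v = of_rat q" "q < 0"
    by (auto simp: neg_rats_def)
  obtain a b where ab: "quotient_of q = (a, b)" by force
  then have ab: "q = of_int a / of_int b" "0 < b"
    by (auto simp: quotient_of_div quotient_of_denom_pos)
  have "a < 0" using q(2) ab by (simp add: divide_less_0_iff)
  \<comment> \<open>Up to a constant, the linear part at the point v of the divisor is m n y dx +
    \<kappa> x dy with \<kappa> = a / b. Its leaves y^\<alpha> = const x^\<beta> dictate these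
    weights.\<close>
  define \<alpha> where "\<alpha> = nat (- a)"
  define \<beta> where "\<beta> = nat b * (m * n)"
  have pos: "0 < \<alpha>" "0 < \<beta>" using \<open>a < 0\<close> ab(2) n m by (auto simp: \<alpha>_def \<beta>_def)
  define e where "e = n * m - n - m"
  define \<kappa> where "\<kappa> = 1 + v * line_sum n m h e v"
  have "\<kappa> = of_int a / of_int b" using q(1) by (simp add: \<kappa>_def e_def ab(1) of_rat_divide)
  moreover have "(of_nat \<alpha> :: complex) = - of_int a" "(of_nat \<beta> :: complex) = of_int b * (of_nat m * of_nat n)"
    using \<open>a < 0\<close> ab(2) by (simp_all add: \<alpha>_def \<beta>_def of_nat_nat)
  ultimately have kappa: "of_nat \<beta> * \<kappa> = - (of_nat \<alpha> * of_nat m * of_nat n)" "\<kappa> \<noteq> 0"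
    using ab(2) \<open>a < 0\<close> by auto
  have n0: "0 < n" and m0: "0 < m" using n m by auto
  have "(n - 1) * (m - 1) \<ge> 1 * 1" using n m by (intro mult_le_mono) auto
  then have enm: "n * m = e + n + m"
    using n m unfolding e_def by (cases n; cases m) (auto simp: algebra_simps)
  have e_le: "e \<le> n * i + m * j" if "germ_coeff h i j \<noteq> 0" for i j
    using Fol_weight_ge[OF W n0 m0 that] enm by (simp add: algebra_simps)
  define c where "c = germ_const v + germ_Y"
  have c: "germ_dx c = 0" "germ_dy c = 1" "germ_coeff c 0 0 = v" by (simp_all add: c_def germ_coeff_const)
  obtain K where K: "germ_subst h (germ_X ^ n) (germ_X ^ m * c) = germ_X ^ e * K"
      "germ_coeff K 0 0 = line_sum n m h e v"
    by (rule weighted_subst[OF n0 m0 e_le, of h c, unfolded c(3)])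
  \<comment> \<open>Since v^n = 1, this is the quotient of x^n - 1 by x - v.\<close>
  define E where "E = (\<lambda>c. \<Sum>i<n. germ_const v ^ (n - Suc i) * c ^ i)"
  have cn: "x ^ n - 1 = (x - germ_const v) * E x" for x
    using power_diff_sumr2[of x n "germ_const v"] v by (simp add: E_def flip: germ_const_power)
  have E0: "germ_coeff (E x) 0 0 = of_nat n * v ^ (n - 1)" if "germ_coeff x 0 0 = v" for x
    by (simp add: E_def that germ_coeff_const flip: power_add)
  define S where "S = c ^ (n - 1) + K"
  have S0: "germ_coeff S 0 0 = v ^ (n - 1) * \<kappa>"
    using v n by (cases n) (simp_all add: S_def c K(2) \<kappa>_def algebra_simps)
  have pb1: "pullback (germ_X ^ n) (germ_X ^ m * c) (qh_form n m h)
      = form_scale (germ_X ^ (n * m - 1)) (of_nat n * (of_nat m * (germ_Y * E c)), of_nat n * (germ_X * S))"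
  proof -
    have "c ^ n - 1 = germ_Y * E c" by (simp add: cn c_def)
    moreover have "germ_X ^ (n * m) * c ^ (n - 1) + germ_X ^ (n + m) * (germ_X ^ e * K) = germ_X ^ (n * m - 1) * (germ_X * S)"
    proof -
      have "germ_X ^ (n + m) * germ_X ^ e = germ_X ^ (n * m)" 
        unfolding power_add[symmetric] using enm by (simp add: add_ac)
      moreover have "germ_X ^ (n * m) = germ_X ^ (n * m - 1) * germ_X"
        using n0 m0 by (metis mult.commute nat_0_less_mult_iff power_minus_mult)
      ultimately show ?thesis by (simp add: S_def algebra_simps)
    qed
    ultimately show ?thesis
      unfolding pullback_qh_form[OF n0 m0 c(1,2)] K(1) form_scale_def by (simp add: mult_ac)
  qed
  \<comment> \<open>The leaf with leading coefficient 1 is followed; coefficient 0 would belong to y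
    = 0, the strict transform of f.\<close>
  define u where "u = 1 + germ_Y"
  define X2 where "X2 = germ_X ^ \<alpha>"
  define Y2 where "Y2 = germ_X ^ \<beta> * u"
  have XY0: "germ_coeff X2 0 0 = 0" "germ_coeff Y2 0 0 = 0" using pos by (simp_all add: X2_def Y2_def)
  note simps = germ_subst_simps[OF XY0]
  \<comment> \<open>The resonance between \<alpha>, \<beta> and \<kappa> makes \<open>Q\<close>
    vanish at the origin, so the dX coefficient gains the factor X that the dY coefficient already
    has.\<close>
  define Q where "Q = of_nat (\<alpha> * m) * E c + of_nat \<beta> * S"
  have "germ_coeff Q 0 0 = v ^ (n - 1) * (of_nat \<alpha> * of_nat m * of_nat n + of_nat \<beta> * \<kappa>)"
    by (simp add: Q_def E0 c S0 germ_coeff_of_nat algebra_simps)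
  then have "germ_coeff Q 0 0 = 0" by (simp add: kappa)
  then have "1 \<le> \<alpha> * i + \<beta> * j" if "germ_coeff Q i j \<noteq> 0" for i j
    using that pos by (cases i; cases j) auto
  then obtain Q' where Q': "germ_subst Q X2 Y2 = germ_X * Q'"
    using weighted_subst[OF pos, of Q 1 u] by (metis X2_def Y2_def power_one_right)
  have dX2: "germ_dx X2 = of_nat \<alpha> * germ_X ^ (\<alpha> - 1)" "germ_dy X2 = 0"
    by (simp_all add: X2_def germ_dx_power germ_dy_power)
  have dY2: "germ_dx Y2 = of_nat \<beta> * germ_X ^ (\<beta> - 1) * u" "germ_dy Y2 = germ_X ^ \<beta>"
    by (simp_all add: Y2_def u_def germ_dx_mult germ_dy_mult germ_dx_power germ_dy_power)
  have a1: "X2 = germ_X ^ (\<alpha> - 1) * germ_X" and b1: "Y2 = germ_X ^ (\<beta> - 1) * germ_X * u"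
    and b2: "germ_X ^ \<beta> = germ_X ^ (\<beta> - 1) * germ_X"
    using pos by (simp_all only: X2_def Y2_def power_minus_mult)
  define V where "V = (of_nat n * u * Q', of_nat n * germ_subst S X2 Y2)"
  have pb2: "pullback X2 Y2 (of_nat n * (of_nat m * (germ_Y * E c)), of_nat n * (germ_X * S))
      = form_scale (germ_X ^ (\<alpha> - 1 + (\<beta> - 1) + 2)) V"
  proof (intro prod_eqI)
    have "fst (pullback X2 Y2 (of_nat n * (of_nat m * (germ_Y * E c)), of_nat n * (germ_X * S)))
        = of_nat n * (of_nat m * (Y2 * germ_subst (E c) X2 Y2)) * (of_nat \<alpha> * germ_X ^ (\<alpha> - 1))
          + of_nat n * (X2 * germ_subst S X2 Y2) * (of_nat \<beta> * germ_X ^ (\<beta> - 1) * u)"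
      by (simp add: pullback_def form_scale_def differential_def simps dX2 dY2)
    also have "\<dots> = of_nat n * germ_X ^ (\<alpha> - 1) * germ_X ^ (\<beta> - 1) * germ_X * u * germ_subst Q X2 Y2"
      unfolding a1[symmetric] by (subst (1) b1, subst (2) a1)
        (simp add: Q_def simps algebra_simps)
    finally show "fst (pullback X2 Y2 (of_nat n * (of_nat m * (germ_Y * E c)), of_nat n * (germ_X * S)))
        = fst (form_scale (germ_X ^ (\<alpha> - 1 + (\<beta> - 1) + 2)) V)"
      by (simp add: Q' V_def form_scale_def power_add power2_eq_square mult_ac)
    have "snd (pullback X2 Y2 (of_nat n * (of_nat m * (germ_Y * E c)), of_nat n * (germ_X * S)))
        = of_nat n * (X2 * germ_subst S X2 Y2) * germ_X ^ \<beta>"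
      by (simp add: pullback_def form_scale_def differential_def simps dX2 dY2)
    also have "\<dots> = of_nat n * (germ_X ^ (\<alpha> - 1) * germ_X * germ_subst S X2 Y2) * (germ_X ^ (\<beta> - 1) * germ_X)"
      by (simp only: a1[symmetric] b2[symmetric])
    finally show "snd (pullback X2 Y2 (of_nat n * (of_nat m * (germ_Y * E c)), of_nat n * (germ_X * S)))
        = snd (form_scale (germ_X ^ (\<alpha> - 1 + (\<beta> - 1) + 2)) V)"
      by (simp add: V_def form_scale_def power_add power2_eq_square mult_ac)
  qed
  have comp1: "germ_subst (germ_X ^ n) X2 Y2 = germ_X ^ (\<alpha> * n)"
    by (simp add: simps) (simp add: X2_def power_mult)
  define b' where "b' = germ_subst (germ_X ^ m * c) X2 Y2"
  have b': "b' = germ_X ^ (\<alpha> * m) * (germ_const v + Y2)"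
    by (simp add: b'_def c_def simps) (simp add: X2_def power_mult)
  have "pullback (germ_X ^ (\<alpha> * n)) b' (qh_form n m h)
      = pullback X2 Y2 (pullback (germ_X ^ n) (germ_X ^ m * c) (qh_form n m h))"
    unfolding comp1[symmetric] b'_def using n0 m0 XY0 by (intro pullback_assoc) auto
  also have "\<dots> = form_scale (X2 ^ (n * m - 1)) (form_scale (germ_X ^ (\<alpha> - 1 + (\<beta> - 1) + 2)) V)"
    unfolding pb1 pullback_form_scale[OF XY0] pb2 by (simp add: simps)
  also have "\<dots> = form_scale (germ_X ^ (\<alpha> * (n * m - 1) + (\<alpha> - 1 + (\<beta> - 1) + 2))) V"
    by (simp add: form_scale_def X2_def power_add power_mult mult_ac)
  finally have pb: "pullback (germ_X ^ (\<alpha> * n)) b' (qh_form n m h)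
      = form_scale (germ_X ^ (\<alpha> * (n * m - 1) + (\<alpha> - 1 + (\<beta> - 1) + 2))) V" .
  have v0: "v \<noteq> 0" using v n by (auto simp: zero_power)
  have tr: "germ_coeff (snd V) 0 0 \<noteq> 0"
    using kappa v0 n0 by (simp add: V_def germ_coeff_subst_00[OF XY0] S0 germ_coeff_of_nat)
  have b'0: "germ_coeff b' 0 0 = 0" and an: "0 < \<alpha> * n" using pos m0 n0 by (simp_all add: b')
  obtain w where w: "germ_coeff w 0 0 = 0"
      "germ_subst (germ_Y ^ n - germ_X ^ m) (germ_X ^ (\<alpha> * n)) (germ_subst b' germ_X w) = 0"
    by (rule Fol_no_extra_separatrix[OF W an b'0 pb tr])
  \<comment> \<open>The value of \<open>c\<close> along the leaf. There f is a power of X times (x -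
    v) E(x), and neither factor vanishes.\<close>
  define x where "x = germ_const v + germ_X ^ \<beta> * (1 + w)"
  have b'w: "germ_subst b' germ_X w = germ_X ^ (\<alpha> * m) * x"
    using w(1) by (simp add: b' Y2_def u_def x_def germ_subst_simps)
  have "(germ_X ^ (\<alpha> * m) * x) ^ n - (germ_X ^ (\<alpha> * n)) ^ m = 0"
    using w(2) pos n0 m0 unfolding b'w by (simp add: germ_subst_simps)
  then have "germ_X ^ (\<alpha> * m * n) * (x ^ n - 1) = 0"
    by (subst (asm) X_power_diff_factor) (simp_all add: mult_ac)
  then have "x ^ n - 1 = 0" by simp
  then have "germ_X ^ \<beta> * (1 + w) * E x = 0" by (simp add: cn x_def)
  then have "1 + w = 0 \<or> E x = 0" by simp
  moreover have "1 + w \<noteq> 0"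
  proof
    assume "1 + w = 0"
    then have "germ_coeff (1 + w) 0 0 = 0" by (simp only: germ_coeff_zero)
    then show False using w(1) by (simp add: germ_coeff_one)
  qed
  moreover have "germ_coeff (E x) 0 0 \<noteq> 0"
    using E0[of x] pos v0 n0 by (simp add: x_def germ_coeff_const)
  ultimately show False by auto
qed

section \<open>Linear parts\<close>

lemma eigenvalue_pair_iff:
  "eigenvalue_pair (linear_part (R, S)) l1 l2 \<longleftrightarrow>
     l1 + l2 = germ_coeff R 0 1 - germ_coeff S 1 0 \<and>
     l1 * l2 = germ_coeff S 0 1 * germ_coeff R 1 0 - germ_coeff S 1 0 * germ_coeff R 0 1"
    (is "_ \<longleftrightarrow> l1 + l2 = ?t \<and> l1 * l2 = ?d")
proof -
  have det: "det (mat z - linear_part (R, S)) = z * z - ?t * z + ?d" for z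
    by (simp add: det_2 linear_part_def vector_2 mat_def algebra_simps)
  have "eigenvalue_pair (linear_part (R, S)) l1 l2 \<longleftrightarrow>
      (\<forall>z. (l1 + l2 - ?t) * z = l1 * l2 - ?d)"
    unfolding eigenvalue_pair_def det by (simp add: algebra_simps)
  also have "\<dots> \<longleftrightarrow> l1 + l2 - ?t = 0 \<and> l1 * l2 - ?d = 0"
  proof -
    have "(\<forall>z. a * z = b) \<longleftrightarrow> a = 0 \<and> b = 0" for a b :: complex
    proof
      assume all: "\<forall>z. a * z = b"
      show "a = 0 \<and> b = 0" using all[rule_format, of 0] all[rule_format, of 1] by simp
    qed simp
    then show ?thesis .
  qed
  finally show ?thesis by simp
qed

lemma not_saddle_node_if_det:
  "germ_coeff S 0 1 * germ_coeff R 1 0 \<noteq> germ_coeff S 1 0 * germ_coeff R 0 1 \<Longrightarrow> \<not> saddle_node (R, S)"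
  by (auto simp: saddle_node_def eigenvalue_pair_iff)

text \<open>Trace and determinant vanish, so both eigenvalues are 0 and neither kind of irreducible
  singularity is possible.\<close>

lemma nilpotent_not_irreducible:
  assumes "germ_coeff S 0 1 * germ_coeff R 1 0 = germ_coeff S 1 0 * germ_coeff R 0 1"
    "germ_coeff R 0 1 = germ_coeff S 1 0"
  shows "\<not> irreducible_singularity (R, S)"
proof
  assume "irreducible_singularity (R, S)"
  then obtain l1 l2 where l: "eigenvalue_pair (linear_part (R, S)) l1 l2" "l1 \<noteq> 0 \<or> l2 \<noteq> 0"
    by (auto simp: irreducible_singularity_def saddle_node_def simple_singularity_def)
  have "l1 + l2 = 0" "l1 * l2 = 0" using l(1) assms by (simp_all add: eigenvalue_pair_iff)
  then show False using l(2) by auto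
qed

text \<open>The linear part is triangular with eigenvalues - s and r.\<close>

lemma diagonal_simple_singularity:
  assumes "germ_coeff R 0 0 = 0" "germ_coeff S 0 0 = 0" "germ_coeff R 1 0 = 0 \<or> germ_coeff S 0 1 = 0"
    "germ_coeff R 0 1 = r" "germ_coeff S 1 0 = s" "r \<noteq> 0" "s \<noteq> 0" "- s / r \<notin> pos_rats"
  shows "simple_singularity (R, S)"
  unfolding simple_singularity_def
proof
  show "\<exists>l1 l2. eigenvalue_pair (linear_part (R, S)) l1 l2 \<and> l1 * l2 \<noteq> 0 \<and> l1 / l2 \<notin> pos_rats"
    using assms by (intro exI[of _ "- s"] exI[of _ r]) (auto simp: eigenvalue_pair_iff)
qed (use assms in \<open>simp add: singular_def\<close>)

text \<open>The determinant vanishes while the trace does not.\<close>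

lemma diagonal_saddle_node:
  assumes "germ_coeff R 0 0 = 0" "germ_coeff S 0 0 = 0"
    "germ_coeff S 0 1 * germ_coeff R 1 0 = germ_coeff S 1 0 * germ_coeff R 0 1"
    "germ_coeff R 0 1 \<noteq> germ_coeff S 1 0"
  shows "saddle_node (R, S)"
  unfolding saddle_node_def
proof
  show "\<exists>l1 l2. eigenvalue_pair (linear_part (R, S)) l1 l2 \<and> (l1 = 0) \<noteq> (l2 = 0)"
    using assms by (intro exI[of _ 0] exI[of _ "germ_coeff R 0 1 - germ_coeff S 1 0"])
      (auto simp: eigenvalue_pair_iff)
qed (use assms in \<open>simp add: singular_def\<close>)

lemma neg_ratio_not_pos_rats:
  assumes "0 < a" "0 < b" shows "- (of_nat a * z) / (of_nat b * z) \<notin> (pos_rats :: complex set)"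
proof
  assume "- (of_nat a * z) / (of_nat b * z) \<in> pos_rats"
  then obtain q where q: "- (of_nat a * z) / (of_nat b * z) = of_rat q" "0 < q" by (auto simp: pos_rats_def)
  then have "z \<noteq> 0" by auto
  then have "- of_nat a = of_rat q * (of_nat b :: complex)" using q(1) assms by (simp add: field_simps)
  then have "(of_rat (- of_nat a) :: complex) = of_rat (q * of_nat b)"
    by (simp add: of_rat_mult of_rat_minus)
  then have "- of_nat a = q * of_nat b" by (simp only: of_rat_eq_iff)
  moreover have "0 < q * of_nat b" using q assms by simp
  ultimately show False by simp
qed

text \<open>This is the eigenvalue ratio - \<kappa> / C at the points of the strict transform of f,
  with \<open>z\<close> a common factor of both eigenvalues.\<close>

lemma kappa_ratio_not_pos_rats:
  assumes "\<kappa> \<notin> neg_rats" "0 < C" "z \<noteq> 0"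
  shows "- (\<kappa> * z) / (of_nat C * z) \<notin> pos_rats"
proof
  assume "- (\<kappa> * z) / (of_nat C * z) \<in> pos_rats"
  then obtain q where q: "- (\<kappa> * z) / (of_nat C * z) = of_rat q" "0 < q" by (auto simp: pos_rats_def)
  then have "- \<kappa> = of_rat q * of_nat C" using assms by (simp add: field_simps)
  then have "\<kappa> = - (of_rat q * of_nat C)" by (metis minus_minus)
  then have "\<kappa> = of_rat (- (q * of_nat C))" by (simp add: of_rat_mult of_rat_minus)
  moreover have "- (q * of_nat C) < 0" using q assms by simp
  ultimately show False using assms(1) by (auto simp: neg_rats_def)
qed


section \<open>Blowing up corner forms\<close>

lemma germ_X_dvd_iff: "germ_X dvd h \<longleftrightarrow> germ_subst h 0 germ_Y = 0"
proof
  assume "germ_X dvd h"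
  then obtain g where "h = germ_X * g" by (rule dvdE)
  then show "germ_subst h 0 germ_Y = 0" by (simp add: germ_subst_simps)
next
  assume z: "germ_subst h 0 germ_Y = 0"
  have "germ_coeff h 0 l = 0" for l
  proof -
    have "germ_coeff (germ_subst h 0 germ_Y) 0 l
        = (\<Sum>i\<le>l. \<Sum>j\<le>l. germ_coeff h i j * germ_coeff (0 ^ i * germ_Y ^ j) 0 l)"
      by (rule germ_coeff_subst) simp_all
    also have "\<dots> = (\<Sum>i\<le>l. \<Sum>j\<le>l. if i = 0 then if j = l then germ_coeff h 0 l else 0 else 0)"
    proof (intro sum.cong refl)
      fix i j
      show "germ_coeff h i j * germ_coeff (0 ^ i * germ_Y ^ j) 0 l
          = (if i = 0 then if j = l then germ_coeff h 0 l else 0 else 0)"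
        using germ_coeff_monomial[of 1 0 j 0 l] by (cases i) auto
    qed
    also have "\<dots> = germ_coeff h 0 l"
      by (subst sum.swap) simp
    finally show ?thesis using z by simp
  qed
  then obtain g where "h = germ_X ^ 1 * g" using germ_X_power_dvdE[of 1 h] by auto
  then show "germ_X dvd h" by simp
qed

lemma germ_X_prime: "germ_X dvd a * b \<Longrightarrow> germ_X dvd a \<or> germ_X dvd b"
  and germ_Y_prime: "germ_Y dvd a * b \<Longrightarrow> germ_Y dvd a \<or> germ_Y dvd b"
  by (simp_all add: germ_X_dvd_iff germ_Y_dvd_iff germ_subst_simps)

text \<open>Indivisibility by \<open>e\<close> fixes the power that is split off. An explicitly
  computed transform is thus the one met in the rules of \<open>reduction_point\<close>.\<close>

lemma strict_transform_unique:
  assumes "strict_transform a b e W W1" "strict_transform a b e W W2" "e \<noteq> 0"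
  shows "W1 = W2"
proof -
  obtain k l where k: "pullback a b W = form_scale (e ^ k) W1" "pullback a b W = form_scale (e ^ l) W2"
      and nd: "\<not> (e dvd fst W1 \<and> e dvd snd W1)" "\<not> (e dvd fst W2 \<and> e dvd snd W2)"
    using assms by (auto simp: strict_transform_def)
  have le: "k = l" if "k \<le> l" "form_scale (e ^ k) W1 = form_scale (e ^ l) W2" "\<not> (e dvd fst W1 \<and> e dvd snd W1)"
    for k l and W1 W2 :: form
  proof (rule ccontr)
    assume "k \<noteq> l"
    then have "k < l" using that(1) by simp
    then obtain r where "l = Suc (k + r)" using less_imp_Suc_add by blast
    then have r: "l = k + Suc r" by simp
    have "e ^ k * fst W1 = e ^ k * (e * e ^ r * fst W2)" "e ^ k * snd W1 = e ^ k * (e * e ^ r * snd W2)"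
      using that(2) by (simp_all add: form_scale_def r power_add mult_ac)
    then have "fst W1 = e * e ^ r * fst W2" "snd W1 = e * e ^ r * snd W2" using assms(3) by auto
    then show False using that(3) by (simp add: mult.assoc)
  qed
  have "k = l"
    using le[of k l W1 W2] le[of l k W2 W1] k nd by (cases "k \<le> l") auto
  then have "form_scale (e ^ k) W1 = form_scale (e ^ k) W2" using k by simp
  then show ?thesis using assms(3) by (simp add: form_scale_def prod_eq_iff)
qed

lemma germ_const_add_Y_nz [simp]: "germ_const t + germ_Y \<noteq> 0"
proof
  assume "germ_const t + germ_Y = 0"
  then have "germ_dy (germ_const t + germ_Y) = germ_dy 0" by (simp only:)
  then show False by simp
qed

definition excp :: "nat \<Rightarrow> germ \<Rightarrow> germ" where
  "excp A x = (if A = 0 then 1 else x)"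

text \<open>With f = y^n - x^m this is x y (df + f (A dx/x + B dy/y) + h (n x dy - m y dx)), the factor x
  (or y) being left out if A = 0 (or B = 0): A and B are the multiplicities of the total transform of
  the curve along the components x = 0 and y = 0 of the divisor.\<close>

definition corner :: "nat \<Rightarrow> nat \<Rightarrow> nat \<Rightarrow> nat \<Rightarrow> germ \<Rightarrow> form" where
  "corner n m A B h = (let f = germ_Y ^ n - germ_X ^ m in
     (excp A germ_X * excp B germ_Y * germ_dx f + of_nat A * excp B germ_Y * f
        - of_nat m * excp A germ_X * excp B germ_Y * germ_Y * h,
      excp A germ_X * excp B germ_Y * germ_dy f + of_nat B * excp A germ_X * f
        + of_nat n * excp A germ_X * excp B germ_Y * germ_X * h))"

lemma corner_0_0: "corner n m 0 0 h = qh_form n m h"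
  by (simp add: corner_def qh_form_def excp_def differential_def form_scale_def Let_def algebra_simps)

text \<open>From f = X^\<mu> F and dy/y = dX/X + dY1/Y1, the multiplicity along the new component is
  A + B + \<mu>. The form n x dy - m y dx becomes n X^2 dY1 + (n - m) X Y1 dX, whence the factor X^2
  in the normalization of \<open>K\<close>. The last assumption treats n = m and n \<noteq> m
  together: modulo X, only the term with \<open>F\<close> is left in the dX coefficient.\<close>

lemma corner_finite_chart:
  assumes \<mu>: "0 < \<mu>" and Y1: "Y1 = germ_const t + germ_Y"
    and F: "germ_subst (germ_Y ^ n - germ_X ^ m) germ_X (germ_X * Y1) = germ_X ^ \<mu> * F"
    and K: "germ_X ^ 2 * germ_subst h germ_X (germ_X * Y1) = germ_X ^ \<mu> * K"
    and nd: "\<not> germ_X dvd F" "germ_X dvd (of_nat n - of_nat m) * K"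
  shows "strict_transform germ_X (germ_X * Y1) germ_X (corner n m A B h)
    (excp B Y1 * (of_nat (A + B + \<mu>) * F + germ_X * germ_dx F + (of_nat n - of_nat m) * Y1 * K),
     excp B Y1 * (germ_X * germ_dy F + of_nat n * germ_X * K) + of_nat B * germ_X * F)"
    (is "strict_transform _ _ _ _ (?R, ?S)")
proof -
  obtain \<nu> where \<nu>: "\<mu> = Suc \<nu>" using \<mu> by (metis gr0_conv_Suc)
  have z: "germ_coeff germ_X 0 0 = 0" "germ_coeff (germ_X * Y1) 0 0 = 0" by simp_all
  note simps = germ_subst_simps[OF z]
  define f where "f = germ_Y ^ n - germ_X ^ m"
  define fx fy H where "fx = germ_subst (germ_dx f) germ_X (germ_X * Y1)"
    and "fy = germ_subst (germ_dy f) germ_X (germ_X * Y1)" and "H = germ_subst h germ_X (germ_X * Y1)"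
  have dY1: "germ_dx Y1 = 0" "germ_dy Y1 = 1" by (simp_all add: Y1)
  have fxy: "fx + fy * Y1 = of_nat \<mu> * germ_X ^ \<nu> * F + germ_X ^ \<nu> * germ_X * germ_dx F"
  proof -
    have "germ_dx (germ_X ^ \<mu> * F) = of_nat \<mu> * germ_X ^ \<nu> * F + germ_X ^ \<nu> * germ_X * germ_dx F"
      unfolding \<nu> germ_dx_mult germ_dx_power by (simp add: mult_ac)
    moreover have "germ_dx (germ_X * Y1) = Y1" by (simp add: germ_dx_mult dY1)
    ultimately show ?thesis
      using chain_rule_dx[OF z, of f] unfolding F[folded f_def] by (simp add: fx_def fy_def)
  qed
  have fyX: "fy * germ_X = germ_X ^ \<nu> * germ_X * germ_dy F"
  proof -
    have "germ_dy (germ_X ^ \<mu> * F) = germ_X ^ \<nu> * germ_X * germ_dy F"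
      unfolding \<nu> germ_dy_mult germ_dy_power by (simp add: mult_ac)
    moreover have "germ_dy (germ_X * Y1) = germ_X" by (simp add: germ_dy_mult dY1)
    ultimately show ?thesis
      using chain_rule_dy[OF z, of f] unfolding F[folded f_def] by (simp add: fx_def fy_def)
  qed
  have "germ_X * (germ_X * H) = germ_X * (germ_X ^ \<nu> * K)"
    using K by (simp add: H_def[symmetric] \<nu> power2_eq_square mult_ac)
  then have HX: "germ_X * H = germ_X ^ \<nu> * K" by simp
  \<comment> \<open>The exponents of X that the equations of the old components contribute to the
    pullback.\<close>
  define sA where "sA = (if A = 0 then 0 else 1 :: nat)"
  define sB where "sB = (if B = 0 then 0 else 1 :: nat)"
  have EA: "excp A germ_X = germ_X ^ sA" and EB: "excp B (germ_X * Y1) = germ_X ^ sB * excp B Y1"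
    by (simp_all add: excp_def sA_def sB_def)
  have AX: "of_nat A * germ_X = of_nat A * excp A germ_X" and BX: "of_nat B * (germ_X * Y1) = of_nat B * excp B (germ_X * Y1)"
    and BX': "of_nat B * germ_X = of_nat B * germ_X ^ sB"
    by (simp_all add: excp_def sB_def)
  have excp_subst: "germ_subst (excp A germ_X) germ_X (germ_X * Y1) = excp A germ_X"
    "germ_subst (excp B germ_Y) germ_X (germ_X * Y1) = excp B (germ_X * Y1)"
    by (simp_all add: excp_def simps)
  let ?A = "excp A germ_X" and ?B = "excp B (germ_X * Y1)"
  let ?r = "?A * ?B * fx + of_nat A * ?B * (germ_X ^ \<mu> * F) - of_nat m * ?A * ?B * (germ_X * Y1) * H"
  let ?s = "?A * ?B * fy + of_nat B * ?A * (germ_X ^ \<mu> * F) + of_nat n * ?A * ?B * germ_X * H"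
  have sub: "germ_subst (fst (corner n m A B h)) germ_X (germ_X * Y1) = ?r"
    "germ_subst (snd (corner n m A B h)) germ_X (germ_X * Y1) = ?s"
    unfolding corner_def Let_def f_def[symmetric] fst_conv snd_conv
    by (simp_all only: germ_subst_add[OF z] germ_subst_diff[OF z] germ_subst_mult[OF z] germ_subst_of_nat[OF z]
        excp_subst fx_def[symmetric] fy_def[symmetric] H_def[symmetric] F[folded f_def]
        germ_subst_X[OF z] germ_subst_Y[OF z])
  have "fst (pullback germ_X (germ_X * Y1) (corner n m A B h)) = ?r + ?s * Y1"
    by (simp only: pullback_def fst_add form_scale_def differential_def fst_conv snd_conv sub)
      (simp add: germ_dx_mult dY1)
  also have "\<dots> = ?A * ?B * (fx + fy * Y1)
      + ((of_nat A * germ_X) * ?B + (of_nat B * (germ_X * Y1)) * ?A) * (germ_X ^ \<nu> * F)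
      + (of_nat n - of_nat m) * ?A * ?B * Y1 * (germ_X * H)"
    by (simp add: \<nu> algebra_simps)
  also have "\<dots> = ?A * ?B * germ_X ^ \<nu> * (of_nat (A + B + \<mu>) * F + germ_X * germ_dx F + (of_nat n - of_nat m) * Y1 * K)"
    unfolding fxy AX BX HX by (simp add: algebra_simps)
  finally have 1: "fst (pullback germ_X (germ_X * Y1) (corner n m A B h)) = germ_X ^ (sA + sB + \<nu>) * ?R"
    unfolding EA EB by (simp add: power_add mult_ac)
  have "snd (pullback germ_X (germ_X * Y1) (corner n m A B h)) = ?s * germ_X"
    by (simp only: pullback_def snd_add form_scale_def differential_def fst_conv snd_conv sub)
      (simp add: germ_dy_mult dY1)
  also have "\<dots> = ?A * ?B * (fy * germ_X) + (of_nat B * germ_X) * ?A * (germ_X ^ \<mu> * F)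
      + of_nat n * ?A * ?B * germ_X * (germ_X * H)"
    by (simp add: algebra_simps)
  also have "\<dots> = ?A * ?B * (fy * germ_X) + (of_nat B * germ_X ^ sB) * ?A * (germ_X ^ \<mu> * F)
      + of_nat n * ?A * ?B * germ_X * (germ_X * H)"
    by (simp only: BX')
  also have "\<dots> = germ_X ^ (sA + sB + \<nu>) * ?S"
    unfolding fyX HX EA EB by (simp add: \<nu> power_add algebra_simps)
  finally have 2: "snd (pullback germ_X (germ_X * Y1) (corner n m A B h)) = germ_X ^ (sA + sB + \<nu>) * ?S" .
  have "\<not> germ_X dvd ?R"
  proof
    assume d: "germ_X dvd ?R"
    have "\<not> germ_X dvd excp B Y1"
    proof
      assume "germ_X dvd excp B Y1"
      then have z: "germ_subst (excp B Y1) 0 germ_Y = 0" by (simp add: germ_X_dvd_iff)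
      show False
      proof (cases "B = 0")
        case False
        then have "germ_const t + germ_Y = 0" using z by (simp add: excp_def Y1 germ_subst_simps)
        then show False by simp
      qed (use z in \<open>simp add: excp_def germ_subst_simps\<close>)
    qed
    then have "germ_X dvd of_nat (A + B + \<mu>) * F + germ_X * germ_dx F + (of_nat n - of_nat m) * Y1 * K"
      using germ_X_prime[OF d] by blast
    then have "germ_X dvd of_nat (A + B + \<mu>) * F + (germ_X * germ_dx F + (of_nat n - of_nat m) * Y1 * K)"
      by (simp only: add.assoc)
    moreover have "germ_X dvd germ_X * germ_dx F + (of_nat n - of_nat m) * Y1 * K"
      using dvd_mult2[OF nd(2), of Y1] by (intro dvd_add) (simp_all add: mult_ac)
    ultimately have "germ_X dvd of_nat (A + B + \<mu>) * F"
      by (simp only: dvd_add_left_iff)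
    then have "germ_X dvd of_nat (A + B + \<mu>)" using germ_X_prime nd(1) by blast
    then show False using \<mu> by (simp add: germ_X_dvd_iff germ_subst_of_nat del: of_nat_add)
  qed
  moreover have "pullback germ_X (germ_X * Y1) (corner n m A B h) = form_scale (germ_X ^ (sA + sB + \<nu>)) (?R, ?S)"
    by (intro prod_eqI) (simp_all only: form_scale_def fst_conv snd_conv 1 2)
  ultimately show ?thesis unfolding strict_transform_def fst_conv snd_conv
    by (intro conjI exI[of _ "sA + sB + \<nu>"]) simp_all
qed

text \<open>Now dx/x = dX/X + dY/Y, so the multiplicity A + B + \<mu> appears in the dY coefficient,
  and n x dy - m y dx becomes (n - m) X Y dY - m Y^2 dX.\<close>

lemma corner_infinite_chart:
  assumes \<mu>: "0 < \<mu>"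
    and F: "germ_subst (germ_Y ^ n - germ_X ^ m) (germ_X * germ_Y) germ_Y = germ_Y ^ \<mu> * F"
    and K: "germ_Y ^ 2 * germ_subst h (germ_X * germ_Y) germ_Y = germ_Y ^ \<mu> * K"
    and nd: "\<not> germ_Y dvd F" "germ_Y dvd (of_nat n - of_nat m) * K"
  shows "strict_transform (germ_X * germ_Y) germ_Y germ_Y (corner n m A B h)
    (excp A germ_X * (germ_Y * germ_dx F - of_nat m * germ_Y * K) + of_nat A * germ_Y * F,
     excp A germ_X * (of_nat (A + B + \<mu>) * F + germ_Y * germ_dy F + (of_nat n - of_nat m) * germ_X * K))"
    (is "strict_transform _ _ _ _ (?R, ?S)")
proof -
  obtain \<nu> where \<nu>: "\<mu> = Suc \<nu>" using \<mu> by (metis gr0_conv_Suc)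
  have z: "germ_coeff (germ_X * germ_Y) 0 0 = 0" "germ_coeff germ_Y 0 0 = 0" by simp_all
  note simps = germ_subst_simps[OF z]
  define f where "f = germ_Y ^ n - germ_X ^ m"
  define fx fy H where "fx = germ_subst (germ_dx f) (germ_X * germ_Y) germ_Y"
    and "fy = germ_subst (germ_dy f) (germ_X * germ_Y) germ_Y" and "H = germ_subst h (germ_X * germ_Y) germ_Y"
  have fxy: "fx * germ_X + fy = of_nat \<mu> * germ_Y ^ \<nu> * F + germ_Y ^ \<nu> * germ_Y * germ_dy F"
  proof -
    have "germ_dy (germ_Y ^ \<mu> * F) = of_nat \<mu> * germ_Y ^ \<nu> * F + germ_Y ^ \<nu> * germ_Y * germ_dy F"
      unfolding \<nu> germ_dy_mult germ_dy_power by (simp add: mult_ac)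
    moreover have "germ_dy (germ_X * germ_Y) = germ_X" by (simp add: germ_dy_mult)
    ultimately show ?thesis
      using chain_rule_dy[OF z, of f] unfolding F[folded f_def] by (simp add: fx_def fy_def)
  qed
  have fxY: "fx * germ_Y = germ_Y ^ \<nu> * germ_Y * germ_dx F"
  proof -
    have "germ_dx (germ_Y ^ \<mu> * F) = germ_Y ^ \<nu> * germ_Y * germ_dx F"
      unfolding \<nu> germ_dx_mult germ_dx_power by (simp add: mult_ac)
    moreover have "germ_dx (germ_X * germ_Y) = germ_Y" by (simp add: germ_dx_mult)
    ultimately show ?thesis
      using chain_rule_dx[OF z, of f] unfolding F[folded f_def] by (simp add: fx_def fy_def)
  qed
  have "germ_Y * (germ_Y * H) = germ_Y * (germ_Y ^ \<nu> * K)"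
    using K by (simp add: H_def[symmetric] \<nu> power2_eq_square mult_ac)
  then have HY: "germ_Y * H = germ_Y ^ \<nu> * K" by simp
  define sA where "sA = (if A = 0 then 0 else 1 :: nat)"
  define sB where "sB = (if B = 0 then 0 else 1 :: nat)"
  have EB: "excp B germ_Y = germ_Y ^ sB" and EA: "excp A (germ_X * germ_Y) = germ_Y ^ sA * excp A germ_X"
    by (simp_all add: excp_def sA_def sB_def)
  have BY: "of_nat B * germ_Y = of_nat B * excp B germ_Y"
    and AY: "of_nat A * (germ_X * germ_Y) = of_nat A * excp A (germ_X * germ_Y)"
    and AY': "of_nat A * germ_Y = of_nat A * germ_Y ^ sA"
    by (simp_all add: excp_def sA_def)
  have excp_subst: "germ_subst (excp A germ_X) (germ_X * germ_Y) germ_Y = excp A (germ_X * germ_Y)"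
    "germ_subst (excp B germ_Y) (germ_X * germ_Y) germ_Y = excp B germ_Y"
    by (simp_all add: excp_def simps)
  let ?A = "excp A (germ_X * germ_Y)" and ?B = "excp B germ_Y"
  let ?r = "?A * ?B * fx + of_nat A * ?B * (germ_Y ^ \<mu> * F) - of_nat m * ?A * ?B * germ_Y * H"
  let ?s = "?A * ?B * fy + of_nat B * ?A * (germ_Y ^ \<mu> * F) + of_nat n * ?A * ?B * (germ_X * germ_Y) * H"
  have sub: "germ_subst (fst (corner n m A B h)) (germ_X * germ_Y) germ_Y = ?r"
    "germ_subst (snd (corner n m A B h)) (germ_X * germ_Y) germ_Y = ?s"
    unfolding corner_def Let_def f_def[symmetric] fst_conv snd_conv
    by (simp_all only: germ_subst_add[OF z] germ_subst_diff[OF z] germ_subst_mult[OF z] germ_subst_of_nat[OF z]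
        excp_subst fx_def[symmetric] fy_def[symmetric] H_def[symmetric] F[folded f_def]
        germ_subst_X[OF z] germ_subst_Y[OF z])
  have "snd (pullback (germ_X * germ_Y) germ_Y (corner n m A B h)) = ?r * germ_X + ?s"
    by (simp only: pullback_def snd_add form_scale_def differential_def fst_conv snd_conv sub)
      (simp add: germ_dy_mult)
  also have "\<dots> = ?A * ?B * (fx * germ_X + fy)
      + ((of_nat A * (germ_X * germ_Y)) * ?B + (of_nat B * germ_Y) * ?A) * (germ_Y ^ \<nu> * F)
      + (of_nat n - of_nat m) * ?A * ?B * germ_X * (germ_Y * H)"
    by (simp add: \<nu> algebra_simps)
  also have "\<dots> = ?A * ?B * germ_Y ^ \<nu> * (of_nat (A + B + \<mu>) * F + germ_Y * germ_dy F + (of_nat n - of_nat m) * germ_X * K)"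
    unfolding fxy AY BY HY by (simp add: algebra_simps)
  finally have 2: "snd (pullback (germ_X * germ_Y) germ_Y (corner n m A B h)) = germ_Y ^ (sA + sB + \<nu>) * ?S"
    unfolding EA EB by (simp add: power_add mult_ac)
  have "fst (pullback (germ_X * germ_Y) germ_Y (corner n m A B h)) = ?r * germ_Y"
    by (simp only: pullback_def fst_add form_scale_def differential_def fst_conv snd_conv sub)
      (simp add: germ_dx_mult)
  also have "\<dots> = ?A * ?B * (fx * germ_Y) + (of_nat A * germ_Y) * ?B * (germ_Y ^ \<mu> * F)
      - of_nat m * ?A * ?B * germ_Y * (germ_Y * H)"
    by (simp add: algebra_simps)
  also have "\<dots> = ?A * ?B * (fx * germ_Y) + (of_nat A * germ_Y ^ sA) * ?B * (germ_Y ^ \<mu> * F)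
      - of_nat m * ?A * ?B * germ_Y * (germ_Y * H)"
    by (simp only: AY')
  also have "\<dots> = germ_Y ^ (sA + sB + \<nu>) * ?R"
    unfolding fxY HY EA EB by (simp add: \<nu> power_add algebra_simps)
  finally have 1: "fst (pullback (germ_X * germ_Y) germ_Y (corner n m A B h)) = germ_Y ^ (sA + sB + \<nu>) * ?R" .
  have "\<not> germ_Y dvd ?S"
  proof
    assume d: "germ_Y dvd ?S"
    have "\<not> germ_Y dvd excp A germ_X"
      by (auto simp: excp_def germ_Y_dvd_iff germ_subst_simps)
    then have "germ_Y dvd of_nat (A + B + \<mu>) * F + germ_Y * germ_dy F + (of_nat n - of_nat m) * germ_X * K"
      using germ_Y_prime[OF d] by blast
    then have "germ_Y dvd of_nat (A + B + \<mu>) * F + (germ_Y * germ_dy F + (of_nat n - of_nat m) * germ_X * K)"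
      by (simp only: add.assoc)
    moreover have "germ_Y dvd germ_Y * germ_dy F + (of_nat n - of_nat m) * germ_X * K"
      using dvd_mult2[OF nd(2), of germ_X] by (intro dvd_add) (simp_all add: mult_ac)
    ultimately have "germ_Y dvd of_nat (A + B + \<mu>) * F"
      by (simp only: dvd_add_left_iff)
    then have "germ_Y dvd of_nat (A + B + \<mu>)" using germ_Y_prime nd(1) by blast
    then show False using \<mu> by (simp add: germ_Y_dvd_iff germ_subst_of_nat del: of_nat_add)
  qed
  moreover have "pullback (germ_X * germ_Y) germ_Y (corner n m A B h) = form_scale (germ_Y ^ (sA + sB + \<nu>)) (?R, ?S)"
    by (intro prod_eqI) (simp_all only: form_scale_def fst_conv snd_conv 1 2)
  ultimately show ?thesis unfolding strict_transform_def fst_conv snd_conv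
    by (intro conjI exI[of _ "sA + sB + \<nu>"]) simp_all
qed

section \<open>Data of corner forms\<close>

lemma germ_dx_of_nat [simp]: "germ_dx (of_nat e) = 0" and germ_dy_of_nat [simp]: "germ_dy (of_nat e) = 0"
  by (simp_all add: of_nat_germ)

lemma germ_dx_uminus [simp]: "germ_dx (- h) = - germ_dx h" and germ_dy_uminus [simp]: "germ_dy (- h) = - germ_dy h"
  using germ_dx_diff[of 0 h] germ_dy_diff[of 0 h] by simp_all

text \<open>As rewrite rules these turn linear coefficients into values of derivatives, to which the
  product and power rules apply.\<close>

lemma germ_coeff_10_dx: "germ_coeff h (Suc 0) 0 = germ_coeff (germ_dx h) 0 0"
  and germ_coeff_01_dy: "germ_coeff h 0 (Suc 0) = germ_coeff (germ_dy h) 0 0"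
  by (simp_all add: germ_coeff_dx germ_coeff_dy)

lemmas linear_part_simps = germ_coeff_10_dx germ_coeff_01_dy germ_dx_mult germ_dy_mult germ_dx_power germ_dy_power
  germ_coeff_const germ_coeff_of_nat germ_coeff_one

lemma line_sum_altdef:
  assumes "0 < n" "0 < m"
  shows "line_sum n m h e v = (\<Sum>(i, j)\<in>{(i, j). n * i + m * j = e}. germ_coeff h i j * v ^ j)"
proof -
  have le: "i \<le> e \<and> j \<le> e" if "n * i + m * j = e" for i j
  proof -
    have "i \<le> n * i" "j \<le> m * j" using assms by auto
    then show ?thesis using that by linarith
  qed
  have "line_sum n m h e v = (\<Sum>(i, j)\<in>{..e} \<times> {..e}. if n * i + m * j = e then germ_coeff h i j * v ^ j else 0)"
    by (simp add: line_sum_def sum.cartesian_product)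
  also have "\<dots> = (\<Sum>(i, j)\<in>{(i, j). n * i + m * j = e}. germ_coeff h i j * v ^ j)"
    using le by (intro sum.mono_neutral_cong_right) (auto split: if_splits)
  finally show ?thesis .
qed

lemma inj_on_line:
  assumes "0 < M" shows "inj_on (\<lambda>k. (k * M - 1, (d - k) * N - 1 :: nat)) {0<..<d}"
proof (rule inj_onI)
  fix k k' assume k: "k \<in> {0<..<d}" "k' \<in> {0<..<d}"
    and eq: "(k * M - 1, (d - k) * N - 1) = (k' * M - 1, (d - k') * N - 1)"
  have "0 < k * M" "0 < k' * M" using k assms by auto
  moreover have "k * M - 1 = k' * M - 1" using eq by (simp only: prod.inject)
  ultimately have "k * M = k' * M" by linarith
  then show "k = k'" using assms by simp
qed

lemma line_sum_reindex:
  assumes "0 < n" "0 < m" "0 < N" "0 < M"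
    and line: "\<And>i j. n * i + m * j = e \<longleftrightarrow> (\<exists>k. 0 < k \<and> k < d \<and> i = k * M - 1 \<and> j = (d - k) * N - 1)"
  shows "v * line_sum n m h e v = (\<Sum>k\<in>{0<..<d}. germ_coeff h (k * M - 1) ((d - k) * N - 1) * v ^ ((d - k) * N))"
proof -
  have set: "{(i, j). n * i + m * j = e} = (\<lambda>k. (k * M - 1, (d - k) * N - 1)) ` {0<..<d}"
    unfolding line by auto
  have inj: "inj_on (\<lambda>k. (k * M - 1, (d - k) * N - 1)) {0<..<d}" by (rule inj_on_line) fact
  have "v * line_sum n m h e v = (\<Sum>k\<in>{0<..<d}. v * (germ_coeff h (k * M - 1) ((d - k) * N - 1) * v ^ ((d - k) * N - 1)))"
    unfolding line_sum_altdef[OF assms(1,2)] set sum.reindex[OF inj] by (simp add: sum_distrib_left)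
  also have "\<dots> = (\<Sum>k\<in>{0<..<d}. germ_coeff h (k * M - 1) ((d - k) * N - 1) * v ^ ((d - k) * N))"
  proof (intro sum.cong refl)
    fix k assume "k \<in> {0<..<d}"
    then have "0 < (d - k) * N" using assms by simp
    then have "v ^ ((d - k) * N) = v * v ^ ((d - k) * N - 1)" by (metis mult.commute power_minus_mult)
    then show "v * (germ_coeff h (k * M - 1) ((d - k) * N - 1) * v ^ ((d - k) * N - 1))
        = germ_coeff h (k * M - 1) ((d - k) * N - 1) * v ^ ((d - k) * N)" by simp
  qed
  finally show ?thesis .
qed

text \<open>(i + 1, j + 1) is a lattice point with positive entries on a line. Coprimality puts it
  at (k M, (d - k) N), and positivity excludes k = 0 and k = d.\<close>

lemma line_iff:
  fixes N M d i j :: nat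
  assumes NM: "coprime N M" "0 < N" "0 < M"
  shows "N * (i + 1) + M * (j + 1) = d * N * M \<longleftrightarrow>
    (\<exists>k. 0 < k \<and> k < d \<and> i = k * M - 1 \<and> j = (d - k) * N - 1)" (is "?L \<longleftrightarrow> ?R")
proof
  assume L: ?L
  have "M dvd N * (i + 1)"
  proof -
    have "M dvd N * (i + 1) + M * (j + 1)" unfolding L by simp
    then show ?thesis by (simp add: dvd_add_left_iff)
  qed
  then have "M dvd i + 1" 
    using NM(1) coprime_dvd_mult_right_iff[of M N "i + 1"] by (simp add: coprime_commute)
  then obtain k where k: "i + 1 = M * k" by (rule dvdE)
  have "M * (N * k + (j + 1)) = M * (d * N)" using L unfolding k by (simp add: algebra_simps)
  then have "N * k + (j + 1) = d * N" by (simp only: nat_mult_eq_cancel1[OF NM(3)])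
  then have j: "N * k + (j + 1) = N * d" by (simp only: mult.commute)
  have "0 < k" using k by (cases k) auto
  moreover have "N * k < N * d" using j by linarith
  then have "k < d" by simp
  moreover have "i = k * M - 1" using k by (simp add: mult.commute)
  moreover have "j = (d - k) * N - 1" 
  proof -
    have "(d - k) * N = N * d - N * k" by (simp add: diff_mult_distrib2 mult.commute)
    then show ?thesis using j by linarith
  qed
  ultimately show ?R by blast
next
  assume ?R
  then obtain k where k: "0 < k" "k < d" "i = k * M - 1" "j = (d - k) * N - 1" by blast
  obtain l where l: "d = k + l" "0 < l" using k(2) by (metis less_imp_add_positive)
  have "i + 1 = k * M" "j + 1 = l * N" using k l NM by simp_all
  then show ?L by (simp add: l algebra_simps)
qed

text \<open>The part of the data of a corner form with f = y^(dN) - x^(dM) that survives the blow-ups: the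
  coefficients of h lie on or above the Newton polygon of f, and those on it form the sequence c.\<close>

definition corner_data :: "nat \<Rightarrow> (nat \<Rightarrow> complex) \<Rightarrow> nat \<Rightarrow> nat \<Rightarrow> germ \<Rightarrow> bool" where
  "corner_data d c N M h \<longleftrightarrow> 0 < d \<and> 0 < N \<and> 0 < M \<and> coprime N M \<and>
     (\<forall>i j. germ_coeff h i j \<noteq> 0 \<longrightarrow> d * N * M \<le> N * (i + 1) + M * (j + 1)) \<and>
     (\<forall>k. 0 < k \<and> k < d \<longrightarrow> germ_coeff h (k * M - 1) ((d - k) * N - 1) = c k)"

text \<open>Replacing the smaller weight by the larger one is a strict loss for N \<noteq> M, which
  yields one order more than for N = M. Because of this extra order, \<open>h\<close> contributes
  nothing along the new divisor unless N = M.\<close>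

lemma corner_data_order:
  assumes D: "corner_data d c N M h" and h: "germ_coeff h i j \<noteq> 0"
  shows "N < M \<Longrightarrow> d * N \<le> i + j + 1" "M < N \<Longrightarrow> d * M \<le> i + j + 1"
    "N = M \<Longrightarrow> d \<le> i + j + 2"
proof -
  have le: "d * N * M \<le> N * (i + 1) + M * (j + 1)" and pos: "0 < N" "0 < M" "coprime N M"
    using D h by (auto simp: corner_data_def)
  {
    assume "N < M"
    then have "N * (i + 1) < M * (i + 1)" by (rule mult_less_mono1) simp
    then have "M * (d * N) < M * (i + j + 2)" using le by (simp add: algebra_simps)
    then have "d * N < i + j + 2" by (simp only: mult_less_cancel1)
    then show "d * N \<le> i + j + 1" by simp
  next
    assume "M < N"
    then have "M * (j + 1) < N * (j + 1)" by (rule mult_less_mono1) simp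
    then have "N * (d * M) < N * (i + j + 2)" using le by (simp add: algebra_simps)
    then have "d * M < i + j + 2" by (simp only: mult_less_cancel1)
    then show "d * M \<le> i + j + 1" by simp
  next
    assume "N = M"
    then have "N = 1" "M = 1" using pos by auto
    then show "d \<le> i + j + 2" using le by simp
  }
qed

lemma germ_coeff_subst_X_XY:
  "germ_coeff (germ_subst h germ_X (germ_X * germ_Y)) k l = (if l \<le> k then germ_coeff h (k - l) l else 0)"
proof -
  define K where "K = k + l"
  have "germ_coeff (germ_subst h germ_X (germ_X * germ_Y)) k l
      = (\<Sum>i\<le>K. \<Sum>j\<le>K. germ_coeff h i j * germ_coeff (germ_X ^ i * (germ_X * germ_Y) ^ j) k l)"
    by (rule germ_coeff_subst) (simp_all add: K_def)
  also have "\<dots> = (\<Sum>i\<le>K. \<Sum>j\<le>K. if j = l then if l \<le> k then if i = k - l then germ_coeff h (k - l) l else 0 else 0 else 0)"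
  proof (intro sum.cong refl)
    fix i j
    have "germ_X ^ i * (germ_X * germ_Y) ^ j = germ_const 1 * germ_X ^ (i + j) * germ_Y ^ j"
      by (simp add: power_mult_distrib power_add)
    then show "germ_coeff h i j * germ_coeff (germ_X ^ i * (germ_X * germ_Y) ^ j) k l
        = (if j = l then if l \<le> k then if i = k - l then germ_coeff h (k - l) l else 0 else 0 else 0)"
      by (simp only: germ_coeff_monomial) auto
  qed
  also have "\<dots> = (if l \<le> k then germ_coeff h (k - l) l else 0)"
    by (auto simp: K_def)
  finally show ?thesis .
qed

lemma germ_coeff_subst_XY_Y:
  "germ_coeff (germ_subst h (germ_X * germ_Y) germ_Y) k l = (if k \<le> l then germ_coeff h k (l - k) else 0)"
proof -
  define K where "K = k + l"
  have "germ_coeff (germ_subst h (germ_X * germ_Y) germ_Y) k l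
      = (\<Sum>i\<le>K. \<Sum>j\<le>K. germ_coeff h i j * germ_coeff ((germ_X * germ_Y) ^ i * germ_Y ^ j) k l)"
    by (rule germ_coeff_subst) (simp_all add: K_def)
  also have "\<dots> = (\<Sum>i\<le>K. \<Sum>j\<le>K. if i = k then if k \<le> l then if j = l - k then germ_coeff h k (l - k) else 0 else 0 else 0)"
  proof (intro sum.cong refl)
    fix i j
    have "(germ_X * germ_Y) ^ i * germ_Y ^ j = germ_const 1 * germ_X ^ i * germ_Y ^ (i + j)"
      by (simp add: power_mult_distrib power_add)
    then show "germ_coeff h i j * germ_coeff ((germ_X * germ_Y) ^ i * germ_Y ^ j) k l
        = (if i = k then if k \<le> l then if j = l - k then germ_coeff h k (l - k) else 0 else 0 else 0)"
      by (simp only: germ_coeff_monomial) auto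
  qed
  also have "\<dots> = (if k \<le> l then germ_coeff h k (l - k) else 0)"
    by (subst sum.swap) (auto simp: K_def)
  finally show ?thesis .
qed

text \<open>The coefficient at (i, j) moves to (i + j + 1 - d N, j). Passing to the weights (N, M -
  N), both its weight N (i + 1) + M (j + 1) and the bound d N M drop by d N^2, so the position
  relative to the Newton polygon is kept; the k-th point on the polygon goes to the k-th point on
  the new one.\<close>

lemma corner_data_finite_chart:
  assumes D: "corner_data d c N M h" and lt: "N < M"
  obtains h' where "germ_X ^ 2 * germ_subst h germ_X (germ_X * germ_Y) = germ_X ^ (d * N) * (germ_X * h')"
    "corner_data d c N (M - N) h'"
proof -
  \<comment> \<open>One of the two factors X stays outside: in the new corner form it is the
    equation of the new component.\<close>
  define S where "S = germ_X * germ_subst h germ_X (germ_X * germ_Y)"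
  obtain P where P: "M = N + P" "0 < P" using lt less_imp_add_positive by blast
  have pos: "0 < d" "0 < N" "coprime N M" using D by (auto simp: corner_data_def)
  have S: "germ_coeff S i j = (if j < i then germ_coeff h (i - 1 - j) j else 0)" for i j
    by (auto simp: S_def germ_coeff_X_mult germ_coeff_subst_X_XY)
  have "germ_coeff S i j = 0" if "i < d * N" for i j
  proof (rule ccontr)
    assume "germ_coeff S i j \<noteq> 0"
    then have "j < i" "germ_coeff h (i - 1 - j) j \<noteq> 0" by (auto simp: S split: if_splits)
    then show False using corner_data_order(1)[OF D _ lt] that by fastforce
  qed
  then obtain h' where h': "S = germ_X ^ (d * N) * h'" "\<And>i j. germ_coeff h' i j = germ_coeff S (i + d * N) j"
    by (rule germ_X_power_dvdE) auto
  have "germ_X ^ 2 * germ_subst h germ_X (germ_X * germ_Y) = germ_X * S" by (simp add: S_def power2_eq_square mult.assoc)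
  then have 1: "germ_X ^ 2 * germ_subst h germ_X (germ_X * germ_Y) = germ_X ^ (d * N) * (germ_X * h')"
    by (simp add: h'(1) mult_ac)
  have "corner_data d c N P h'"
    unfolding corner_data_def
  proof (intro conjI allI impI)
    show "coprime N P" using pos(3) unfolding P(1) by (simp add: coprime_iff_gcd_eq_1)
    fix i j assume "germ_coeff h' i j \<noteq> 0"
    then have j: "j < i + d * N" "germ_coeff h (i + d * N - 1 - j) j \<noteq> 0" by (auto simp: h'(2) S split: if_splits)
    define b where "b = i + d * N - 1 - j"
    have b: "b + 1 + j = i + d * N" using j(1) by (simp add: b_def)
    have "d * N * (N + P) \<le> N * (b + 1) + (N + P) * (j + 1)"
      using D j(2) by (simp add: corner_data_def b_def P(1) del: One_nat_def)
    also have "\<dots> = N * (b + 1 + j + 1) + P * (j + 1)" by (simp add: algebra_simps)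
    also have "\<dots> = N * (i + 1) + d * N * N + P * (j + 1)" unfolding b by (simp add: algebra_simps)
    finally show "d * N * P \<le> N * (i + 1) + P * (j + 1)" by (simp add: algebra_simps)
  next
    fix k assume k: "0 < k \<and> k < d"
    then obtain l where l: "d = k + l" "0 < l" using less_imp_add_positive by blast
    have p: "0 < k * P" "0 < l * N" "0 < k * N" using k l pos P by auto
    have "germ_coeff h' (k * P - 1) (l * N - 1) = germ_coeff S (k * P - 1 + d * N) (l * N - 1)" by (rule h'(2))
    also have "\<dots> = germ_coeff h (k * P - 1 + d * N - 1 - (l * N - 1)) (l * N - 1)"
    proof -
      have "d * N = k * N + l * N" by (simp add: l algebra_simps)
      then have "l * N - 1 < k * P - 1 + d * N" using p by linarith
      then show ?thesis by (simp only: S if_True)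
    qed
    also have "k * P - 1 + d * N - 1 - (l * N - 1) = k * M - 1"
    proof -
      have "d * N = k * N + l * N" "k * M = k * N + k * P" by (simp_all add: l P(1) algebra_simps)
      then show ?thesis using p by linarith
    qed
    also have "germ_coeff h (k * M - 1) (l * N - 1) = c k" using D k l by (auto simp: corner_data_def)
    finally show "germ_coeff h' (k * P - 1) ((d - k) * N - 1) = c k" by (simp add: l)
  qed (use pos P in auto)
  then show ?thesis using that 1 by (simp add: P(1))
qed

text \<open>The same lattice map with the axes exchanged: (i, j) moves to (i, i + j + 1 - d
  M).\<close>

lemma corner_data_infinite_chart:
  assumes D: "corner_data d c N M h" and lt: "M < N"
  obtains h' where "germ_Y ^ 2 * germ_subst h (germ_X * germ_Y) germ_Y = germ_Y ^ (d * M) * (germ_Y * h')"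
    "corner_data d c (N - M) M h'"
proof -
  define S where "S = germ_Y * germ_subst h (germ_X * germ_Y) germ_Y"
  obtain P where P: "N = M + P" "0 < P" using lt less_imp_add_positive by blast
  have pos: "0 < d" "0 < M" "coprime N M" using D by (auto simp: corner_data_def)
  have S: "germ_coeff S i j = (if i < j then germ_coeff h i (j - 1 - i) else 0)" for i j
    by (auto simp: S_def germ_coeff_Y_mult germ_coeff_subst_XY_Y)
  have "germ_coeff S i j = 0" if "j < d * M" for i j
  proof (rule ccontr)
    assume "germ_coeff S i j \<noteq> 0"
    then have "i < j" "germ_coeff h i (j - 1 - i) \<noteq> 0" by (auto simp: S split: if_splits)
    then show False using corner_data_order(2)[OF D _ lt] that by fastforce
  qed
  then obtain h' where h': "S = germ_Y ^ (d * M) * h'" "\<And>i j. germ_coeff h' i j = germ_coeff S i (j + d * M)"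
    by (rule germ_Y_power_dvdE) auto
  have "germ_Y ^ 2 * germ_subst h (germ_X * germ_Y) germ_Y = germ_Y * S" by (simp add: S_def power2_eq_square mult.assoc)
  then have 1: "germ_Y ^ 2 * germ_subst h (germ_X * germ_Y) germ_Y = germ_Y ^ (d * M) * (germ_Y * h')"
    by (simp add: h'(1) mult_ac)
  have "corner_data d c P M h'"
    unfolding corner_data_def
  proof (intro conjI allI impI)
    show "coprime P M" using pos(3) unfolding P(1) by (simp add: coprime_iff_gcd_eq_1 gcd.commute)
    fix i j assume "germ_coeff h' i j \<noteq> 0"
    then have i: "i < j + d * M" "germ_coeff h i (j + d * M - 1 - i) \<noteq> 0" by (auto simp: h'(2) S split: if_splits)
    define b where "b = j + d * M - 1 - i"
    have b: "b + 1 + i = j + d * M" using i(1) by (simp add: b_def)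
    have "d * (M + P) * M \<le> (M + P) * (i + 1) + M * (b + 1)"
      using D i(2) by (simp add: corner_data_def b_def P(1) del: One_nat_def)
    also have "\<dots> = M * (b + 1 + i + 1) + P * (i + 1)" by (simp add: algebra_simps)
    also have "\<dots> = M * (j + 1) + d * M * M + P * (i + 1)" unfolding b by (simp add: algebra_simps)
    finally show "d * P * M \<le> P * (i + 1) + M * (j + 1)" by (simp add: algebra_simps)
  next
    fix k assume k: "0 < k \<and> k < d"
    then obtain l where l: "d = k + l" "0 < l" using less_imp_add_positive by blast
    have p: "0 < l * P" "0 < k * M" "0 < l * M" using k l pos P by auto
    have "germ_coeff h' (k * M - 1) (l * P - 1) = germ_coeff S (k * M - 1) (l * P - 1 + d * M)" by (rule h'(2))
    also have "\<dots> = germ_coeff h (k * M - 1) (l * P - 1 + d * M - 1 - (k * M - 1))"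
    proof -
      have "d * M = k * M + l * M" by (simp add: l algebra_simps)
      then have "k * M - 1 < l * P - 1 + d * M" using p by linarith
      then show ?thesis by (simp only: S if_True)
    qed
    also have "l * P - 1 + d * M - 1 - (k * M - 1) = l * N - 1"
    proof -
      have "d * M = k * M + l * M" "l * N = l * M + l * P" by (simp_all add: l P(1) algebra_simps)
      then show ?thesis using p by linarith
    qed
    also have "germ_coeff h (k * M - 1) (l * N - 1) = c k" using D k l by (auto simp: corner_data_def)
    finally show "germ_coeff h' (k * M - 1) ((d - k) * P - 1) = c k" by (simp add: l)
  qed (use pos P in auto)
  then show ?thesis using that 1 by (simp add: P(1))
qed


section \<open>Strict transforms of corner forms in both charts\<close>

lemma germ_subst_XY_Y_dvdE:
  assumes "\<And>i j. germ_coeff h i j \<noteq> 0 \<Longrightarrow> e \<le> i + j"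
  obtains K where "germ_subst h (germ_X * germ_Y) germ_Y = germ_Y ^ e * K"
proof -
  have "germ_coeff (germ_subst h (germ_X * germ_Y) germ_Y) i j = 0" if "j < e" for i j
    using assms[of i "j - i"] that by (cases "germ_coeff h i (j - i) = 0") (auto simp: germ_coeff_subst_XY_Y)
  then show ?thesis using germ_Y_power_dvdE that by metis
qed

text \<open>The number in the statement for t = 1 / \<xi>: at the k-th point of the polygon the
  exponent of \<xi> is k, and \<xi>^k = t^(d - k) because \<xi>^d = 1.\<close>

definition kappa :: "nat \<Rightarrow> (nat \<Rightarrow> complex) \<Rightarrow> complex \<Rightarrow> complex" where
  "kappa d c t = 1 + (\<Sum>k\<in>{0<..<d}. c k * t ^ (d - k))"

lemma const_add_Y_power_neq_1:
  assumes "0 < n" shows "(germ_const t + germ_Y) ^ n - 1 \<noteq> 0"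
proof
  assume "(germ_const t + germ_Y) ^ n - 1 = 0"
  then have "germ_dy ((germ_const t + germ_Y) ^ n - 1) = germ_dy 0" by (simp only:)
  then show False using assms by (simp add: germ_dy_power)
qed

text \<open>With \<mu> the multiplicity of f and \<open>F\<close> its strict transform, one formula
  covers all three relations between \<open>N\<close> and \<open>M\<close>. For N = M the initial
  part of \<open>h\<close> survives on the divisor, and its value at \<open>t\<close> is what enters
  \<kappa>.\<close>

lemma finite_chart_strict_transform:
  fixes t :: complex
  assumes D: "corner_data d c N M h"
  defines "\<mu> \<equiv> min (d * N) (d * M)" and "Y1 \<equiv> germ_const t + germ_Y"
  defines "F \<equiv> germ_X ^ (d * N - \<mu>) * Y1 ^ (d * N) - germ_X ^ (d * M - \<mu>)"
  obtains K where "strict_transform germ_X (germ_X * Y1) germ_X (corner (d * N) (d * M) A B h)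
    (excp B Y1 * (of_nat (A + B + \<mu>) * F + germ_X * germ_dx F + (of_nat (d * N) - of_nat (d * M)) * Y1 * K),
     excp B Y1 * (germ_X * germ_dy F + of_nat (d * N) * germ_X * K) + of_nat B * germ_X * F)"
    "N \<noteq> M \<Longrightarrow> germ_coeff K 0 0 = 0" "N = M \<Longrightarrow> 1 + t * germ_coeff K 0 0 = kappa d c t"
proof -
  have pos: "0 < d" "0 < N" "0 < M" "coprime N M" using D by (auto simp: corner_data_def)
  then have mu: "0 < \<mu>" by (simp add: \<mu>_def)
  have Y10: "germ_coeff Y1 0 0 = t" by (simp add: Y1_def germ_coeff_const)
  have z: "germ_coeff germ_X 0 0 = 0" "germ_coeff (germ_X * Y1) 0 0 = 0" by simp_all
  have "\<mu> \<le> d * N" "\<mu> \<le> d * M" by (simp_all add: \<mu>_def)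
  then have split: "germ_X ^ (d * N) = germ_X ^ \<mu> * germ_X ^ (d * N - \<mu>)"
    "germ_X ^ (d * M) = germ_X ^ \<mu> * germ_X ^ (d * M - \<mu>)"
    by (simp_all flip: power_add)
  have F: "germ_subst (germ_Y ^ (d * N) - germ_X ^ (d * M)) germ_X (germ_X * Y1) = germ_X ^ \<mu> * F"
    unfolding germ_subst_diff[OF z] germ_subst_power[OF z] germ_subst_X[OF z] germ_subst_Y[OF z]
      power_mult_distrib F_def right_diff_distrib mult.assoc[symmetric] split[symmetric] by (simp add: mult_ac)
  have "germ_subst F 0 germ_Y \<noteq> 0"
  proof (cases N M rule: linorder_cases)
    case less
    then show ?thesis using pos by (simp add: F_def \<mu>_def Y1_def germ_subst_simps min_def zero_power)
  next
    case equal
    then show ?thesis using pos const_add_Y_power_neq_1[of "d * N" t]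
      by (simp add: F_def \<mu>_def Y1_def germ_subst_simps)
  next
    case greater
    then show ?thesis using pos by (simp add: F_def \<mu>_def Y1_def germ_subst_simps min_def zero_power)
  qed
  then have nd: "\<not> germ_X dvd F" by (simp add: germ_X_dvd_iff)
  have wt: "\<exists>K. germ_subst h germ_X (germ_X * Y1) = germ_X ^ e * K \<and> germ_coeff K 0 0 = line_sum 1 1 h e t"
    if "\<And>i j. germ_coeff h i j \<noteq> 0 \<Longrightarrow> e \<le> i + j" for e
    using weighted_subst[of 1 1 h e Y1] that Y10 by simp metis
  show ?thesis
  proof (cases "N = M")
    case False
    have "\<mu> - 1 \<le> i + j" if "germ_coeff h i j \<noteq> 0" for i j
      using corner_data_order(1,2)[OF D that] False by (cases N M rule: linorder_cases) (auto simp: \<mu>_def)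
    then obtain K where K: "germ_subst h germ_X (germ_X * Y1) = germ_X ^ (\<mu> - 1) * K" using wt by blast
    have "germ_X ^ 2 * germ_subst h germ_X (germ_X * Y1) = germ_X ^ \<mu> * (germ_X * K)"
      using mu by (cases \<mu>) (simp_all add: K power2_eq_square mult_ac)
    from corner_finite_chart[OF mu Y1_def[THEN meta_eq_to_obj_eq] F this nd, of A B] False show ?thesis
      by (intro that[of "germ_X * K"]) auto
  next
    case True
    then have NM: "N = 1" "M = 1" using pos by auto
    have mud: "\<mu> = d" by (simp add: \<mu>_def NM)
    have "d - 2 \<le> i + j" if "germ_coeff h i j \<noteq> 0" for i j
      using corner_data_order(3)[OF D that True] by simp
    then obtain K where K: "germ_subst h germ_X (germ_X * Y1) = germ_X ^ (d - 2) * K"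
        "germ_coeff K 0 0 = line_sum 1 1 h (d - 2) t" using wt by blast
    \<comment> \<open>By truncated subtraction the exponent is 1 for d = 1 and 0 for d \<ge> 2. For
      d = 1 the polygon has no interior lattice point, and accordingly \<open>K'\<close> vanishes at
      the origin.\<close>
    define K' where "K' = germ_X ^ (2 + (d - 2) - d) * K"
    have eq: "germ_X ^ 2 * germ_subst h germ_X (germ_X * Y1) = germ_X ^ \<mu> * K'"
      unfolding K K'_def mud mult.assoc[symmetric] power_add[symmetric] by simp
    have "1 + t * germ_coeff K' 0 0 = kappa d c t"
    proof (cases "d = 1")
      case True
      moreover have "{0<..<Suc 0} = {}" by auto
      ultimately show ?thesis by (simp add: K'_def kappa_def)
    next
      case False
      then have d2: "2 \<le> d" using pos by simp
      have line: "1 * i + 1 * j = d - 2 \<longleftrightarrow> (\<exists>k. 0 < k \<and> k < d \<and> i = k * 1 - 1 \<and> j = (d - k) * 1 - 1)" for i j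
      proof
        assume "1 * i + 1 * j = d - 2"
        then show "\<exists>k. 0 < k \<and> k < d \<and> i = k * 1 - 1 \<and> j = (d - k) * 1 - 1"
          using d2 by (intro exI[of _ "i + 1"]) auto
      qed auto
      have "t * line_sum 1 1 h (d - 2) t
          = (\<Sum>k\<in>{0<..<d}. germ_coeff h (k * 1 - 1) ((d - k) * 1 - 1) * t ^ ((d - k) * 1))"
        by (rule line_sum_reindex) (use line in auto)
      also have "\<dots> = (\<Sum>k\<in>{0<..<d}. c k * t ^ (d - k))"
        using D by (intro sum.cong refl) (auto simp: corner_data_def NM)
      finally show ?thesis using d2 by (simp add: K'_def K(2) kappa_def)
    qed
    moreover have "germ_X dvd (of_nat (d * N) - of_nat (d * M)) * K'" by (simp add: NM)
    ultimately show ?thesis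
      using corner_finite_chart[OF mu Y1_def[THEN meta_eq_to_obj_eq] F eq nd, of A B] True that[of K'] by blast
  qed
qed

lemma infinite_chart_strict_transform:
  assumes D: "corner_data d c N M h"
  defines "\<mu> \<equiv> min (d * N) (d * M)"
  defines "F \<equiv> germ_Y ^ (d * N - \<mu>) - germ_X ^ (d * M) * germ_Y ^ (d * M - \<mu>)"
  obtains K where "strict_transform (germ_X * germ_Y) germ_Y germ_Y (corner (d * N) (d * M) A B h)
    (excp A germ_X * (germ_Y * germ_dx F - of_nat (d * M) * germ_Y * K) + of_nat A * germ_Y * F,
     excp A germ_X * (of_nat (A + B + \<mu>) * F + germ_Y * germ_dy F + (of_nat (d * N) - of_nat (d * M)) * germ_X * K))"
proof -
  have pos: "0 < d" "0 < N" "0 < M" "coprime N M" using D by (auto simp: corner_data_def)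
  then have mu: "0 < \<mu>" by (simp add: \<mu>_def)
  have z: "germ_coeff (germ_X * germ_Y) 0 0 = 0" "germ_coeff germ_Y 0 0 = 0" by simp_all
  have "\<mu> \<le> d * N" "\<mu> \<le> d * M" by (simp_all add: \<mu>_def)
  then have split: "germ_Y ^ (d * N) = germ_Y ^ \<mu> * germ_Y ^ (d * N - \<mu>)"
    "germ_Y ^ (d * M) = germ_Y ^ \<mu> * germ_Y ^ (d * M - \<mu>)"
    by (simp_all flip: power_add)
  have F: "germ_subst (germ_Y ^ (d * N) - germ_X ^ (d * M)) (germ_X * germ_Y) germ_Y = germ_Y ^ \<mu> * F"
    unfolding germ_subst_diff[OF z] germ_subst_power[OF z] germ_subst_X[OF z] germ_subst_Y[OF z]
      power_mult_distrib F_def right_diff_distrib mult.left_commute[of _ "germ_X ^ (d * M)"] split[symmetric] by simp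
  have "germ_subst F germ_X 0 \<noteq> 0"
  proof (cases N M rule: linorder_cases)
    case less
    then show ?thesis using pos by (simp add: F_def \<mu>_def germ_subst_simps min_def zero_power)
  next
    case equal
    have "germ_coeff (1 - germ_X ^ (d * M)) 0 0 = 1" using pos by (simp add: germ_coeff_one zero_power)
    then have "1 - germ_X ^ (d * M) \<noteq> 0" by (metis germ_coeff_zero zero_neq_one)
    then show ?thesis using pos equal by (simp add: F_def \<mu>_def germ_subst_simps)
  next
    case greater
    then show ?thesis using pos by (simp add: F_def \<mu>_def germ_subst_simps min_def zero_power)
  qed
  then have nd: "\<not> germ_Y dvd F" by (simp add: germ_Y_dvd_iff)
  show ?thesis
  proof (cases "N = M")
    case False
    have "\<mu> - 1 \<le> i + j" if "germ_coeff h i j \<noteq> 0" for i j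
      using corner_data_order(1,2)[OF D that] False by (cases N M rule: linorder_cases) (auto simp: \<mu>_def)
    then obtain K where K: "germ_subst h (germ_X * germ_Y) germ_Y = germ_Y ^ (\<mu> - 1) * K"
      by (rule germ_subst_XY_Y_dvdE)
    have "germ_Y ^ 2 * germ_subst h (germ_X * germ_Y) germ_Y = germ_Y ^ \<mu> * (germ_Y * K)"
      using mu by (cases \<mu>) (simp_all add: K power2_eq_square mult_ac)
    from corner_infinite_chart[OF mu F this nd, of A B] show ?thesis
      by (intro that[of "germ_Y * K"]) auto
  next
    case True
    then have NM: "N = 1" "M = 1" using pos by auto
    have mud: "\<mu> = d" by (simp add: \<mu>_def NM)
    have "d - 2 \<le> i + j" if "germ_coeff h i j \<noteq> 0" for i j
      using corner_data_order(3)[OF D that True] by simp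
    then obtain K where K: "germ_subst h (germ_X * germ_Y) germ_Y = germ_Y ^ (d - 2) * K"
      by (rule germ_subst_XY_Y_dvdE)
    define K' where "K' = germ_Y ^ (2 + (d - 2) - d) * K"
    have eq: "germ_Y ^ 2 * germ_subst h (germ_X * germ_Y) germ_Y = germ_Y ^ \<mu> * K'"
      unfolding K K'_def mud mult.assoc[symmetric] power_add[symmetric] by simp
    moreover have "germ_Y dvd (of_nat (d * N) - of_nat (d * M)) * K'" by (simp add: NM)
    ultimately show ?thesis
      using corner_infinite_chart[OF mu F eq nd, of A B] that[of K'] by blast
  qed
qed

section \<open>Points of the reduction process\<close>

text \<open>Regular points and simple singularities: the process stops there, and no saddle-node
  occurs.\<close>

definition harmless :: "form \<Rightarrow> bool" where
  "harmless W \<longleftrightarrow> \<not> saddle_node W \<and> (singular W \<longrightarrow> irreducible_singularity W)"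

lemma not_singular_harmless: "\<not> singular W \<Longrightarrow> harmless W"
  by (simp add: harmless_def saddle_node_def)

lemma diagonal_harmless:
  assumes "germ_coeff R 0 0 = 0" "germ_coeff S 0 0 = 0" "germ_coeff R 1 0 = 0 \<or> germ_coeff S 0 1 = 0"
    "germ_coeff R 0 1 = r" "germ_coeff S 1 0 = s" "r \<noteq> 0" "s \<noteq> 0" "- s / r \<notin> pos_rats"
  shows "harmless (R, S)"
proof -
  have "simple_singularity (R, S)" by (rule diagonal_simple_singularity[OF assms])
  moreover have "\<not> saddle_node (R, S)" using assms by (intro not_saddle_node_if_det) auto
  ultimately show ?thesis by (simp add: harmless_def irreducible_singularity_def)
qed

text \<open>One subtraction of Euclid's algorithm, from (N, M) to (N, M - N), at the point where the
  strict transform of f meets the new component.\<close>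

lemma finite_chart_corner:
  assumes D: "corner_data d c N M h" and lt: "N < M"
  obtains h' where "corner_data d c N (M - N) h'"
    "strict_transform germ_X (germ_X * (germ_const 0 + germ_Y)) germ_X (corner (d * N) (d * M) A B h)
       (corner (d * N) (d * (M - N)) (A + B + d * N) B h')"
proof -
  obtain h' where h': "germ_X ^ 2 * germ_subst h germ_X (germ_X * germ_Y) = germ_X ^ (d * N) * (germ_X * h')"
      "corner_data d c N (M - N) h'"
    using corner_data_finite_chart[OF D lt] by blast
  have pos: "0 < d * N" using D by (simp add: corner_data_def)
  have dM: "d * M = d * N + d * (M - N)" using lt by (simp flip: distrib_left)
  define F where "F = germ_Y ^ (d * N) - germ_X ^ (d * (M - N))"
  have z: "germ_coeff germ_X 0 0 = 0" "germ_coeff (germ_X * germ_Y) 0 0 = 0" by simp_all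
  have F: "germ_subst (germ_Y ^ (d * N) - germ_X ^ (d * M)) germ_X (germ_X * germ_Y) = germ_X ^ (d * N) * F"
  proof -
    have "germ_X ^ (d * M) = germ_X ^ (d * N) * germ_X ^ (d * (M - N))" by (subst dM) (rule power_add)
    then show ?thesis
      unfolding germ_subst_diff[OF z] germ_subst_power[OF z] germ_subst_X[OF z] germ_subst_Y[OF z]
        power_mult_distrib F_def right_diff_distrib by simp
  qed
  have "germ_subst F 0 germ_Y \<noteq> 0" using D lt by (simp add: F_def germ_subst_simps corner_data_def zero_power)
  then have nd: "\<not> germ_X dvd F" by (simp add: germ_X_dvd_iff)
  have "strict_transform germ_X (germ_X * germ_Y) germ_X (corner (d * N) (d * M) A B h)
    (excp B germ_Y * (of_nat (A + B + d * N) * F + germ_X * germ_dx F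
         + (of_nat (d * N) - of_nat (d * M)) * germ_Y * (germ_X * h')),
     excp B germ_Y * (germ_X * germ_dy F + of_nat (d * N) * germ_X * (germ_X * h')) + of_nat B * germ_X * F)"
    using F h'(1) nd pos by (intro corner_finite_chart[where t = 0]) auto
  also have "(excp B germ_Y * (of_nat (A + B + d * N) * F + germ_X * germ_dx F
         + (of_nat (d * N) - of_nat (d * M)) * germ_Y * (germ_X * h')),
     excp B germ_Y * (germ_X * germ_dy F + of_nat (d * N) * germ_X * (germ_X * h')) + of_nat B * germ_X * F)
     = corner (d * N) (d * (M - N)) (A + B + d * N) B h'"
  proof -
    \<comment> \<open>The new multiplicity is positive, so the equation of the new component is
      present and the chart formula is literally a corner form.\<close>
    have e: "excp (A + B + d * N) germ_X = germ_X" using pos by (simp add: excp_def)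
    have m: "(of_nat (d * N) - of_nat (d * M) :: germ) = - of_nat (d * (M - N))" by (simp add: dM)
    show ?thesis unfolding corner_def Let_def F_def[symmetric] e m by (simp add: algebra_simps del: of_nat_mult of_nat_add)
  qed
  finally show ?thesis using that h'(2) by simp
qed

lemma infinite_chart_corner:
  assumes D: "corner_data d c N M h" and lt: "M < N"
  obtains h' where "corner_data d c (N - M) M h'"
    "strict_transform (germ_X * germ_Y) germ_Y germ_Y (corner (d * N) (d * M) A B h)
       (corner (d * (N - M)) (d * M) A (A + B + d * M) h')"
proof -
  obtain h' where h': "germ_Y ^ 2 * germ_subst h (germ_X * germ_Y) germ_Y = germ_Y ^ (d * M) * (germ_Y * h')"
      "corner_data d c (N - M) M h'"
    using corner_data_infinite_chart[OF D lt] by blast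
  have pos: "0 < d * M" using D by (simp add: corner_data_def)
  have dN: "d * N = d * M + d * (N - M)" using lt by (simp flip: distrib_left)
  define F where "F = germ_Y ^ (d * (N - M)) - germ_X ^ (d * M)"
  have z: "germ_coeff (germ_X * germ_Y) 0 0 = 0" "germ_coeff germ_Y 0 0 = 0" by simp_all
  have F: "germ_subst (germ_Y ^ (d * N) - germ_X ^ (d * M)) (germ_X * germ_Y) germ_Y = germ_Y ^ (d * M) * F"
  proof -
    have "germ_Y ^ (d * N) = germ_Y ^ (d * M) * germ_Y ^ (d * (N - M))" by (subst dN) (rule power_add)
    then show ?thesis
      unfolding germ_subst_diff[OF z] germ_subst_power[OF z] germ_subst_X[OF z] germ_subst_Y[OF z]
        power_mult_distrib F_def right_diff_distrib by (simp add: mult.commute)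
  qed
  have "germ_subst F germ_X 0 \<noteq> 0" using D lt by (simp add: F_def germ_subst_simps corner_data_def zero_power)
  then have nd: "\<not> germ_Y dvd F" by (simp add: germ_Y_dvd_iff)
  have "strict_transform (germ_X * germ_Y) germ_Y germ_Y (corner (d * N) (d * M) A B h)
    (excp A germ_X * (germ_Y * germ_dx F - of_nat (d * M) * germ_Y * (germ_Y * h')) + of_nat A * germ_Y * F,
     excp A germ_X * (of_nat (A + B + d * M) * F + germ_Y * germ_dy F
        + (of_nat (d * N) - of_nat (d * M)) * germ_X * (germ_Y * h')))"
    using F h'(1) nd pos by (intro corner_infinite_chart) auto
  also have "(excp A germ_X * (germ_Y * germ_dx F - of_nat (d * M) * germ_Y * (germ_Y * h')) + of_nat A * germ_Y * F,
     excp A germ_X * (of_nat (A + B + d * M) * F + germ_Y * germ_dy F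
        + (of_nat (d * N) - of_nat (d * M)) * germ_X * (germ_Y * h')))
     = corner (d * (N - M)) (d * M) A (A + B + d * M) h'"
  proof -
    have e: "excp (A + B + d * M) germ_Y = germ_Y" using pos by (simp add: excp_def)
    have m: "(of_nat (d * N) - of_nat (d * M) :: germ) = of_nat (d * (N - M))" by (simp add: dN)
    show ?thesis unfolding corner_def Let_def F_def[symmetric] e m by (simp add: algebra_simps del: of_nat_mult of_nat_add)
  qed
  finally show ?thesis using that h'(2) by simp
qed

text \<open>For N = M = 1 the blow-up separates the d branches of f, which meet the new component at
  the points t with t^d = 1. The linear part there is triangular, with eigenvalues - \<kappa> z and
  (A + B + d) z.\<close>

lemma finite_chart_root:
  assumes D: "corner_data d c N M h" and NM: "N = M" and t: "t ^ d = 1"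
  obtains R S z where
    "strict_transform germ_X (germ_X * (germ_const t + germ_Y)) germ_X (corner (d * N) (d * M) A B h) (R, S)"
    "germ_coeff R 0 0 = 0" "germ_coeff S 0 0 = 0" "germ_coeff R 1 0 = 0" "z \<noteq> 0"
    "germ_coeff R 0 1 = of_nat (A + B + d) * z" "germ_coeff S 1 0 = kappa d c t * z"
proof -
  have pos: "0 < d" "N = 1" "M = 1" using D NM by (auto simp: corner_data_def)
  obtain K where st: "strict_transform germ_X (germ_X * (germ_const t + germ_Y)) germ_X (corner (d * N) (d * M) A B h)
    (excp B (germ_const t + germ_Y) * (of_nat (A + B + d) * ((germ_const t + germ_Y) ^ d - 1)
        + germ_X * germ_dx ((germ_const t + germ_Y) ^ d - 1)),
     excp B (germ_const t + germ_Y) * (germ_X * germ_dy ((germ_const t + germ_Y) ^ d - 1) + of_nat d * germ_X * K)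
        + of_nat B * germ_X * ((germ_const t + germ_Y) ^ d - 1))" (is "strict_transform _ _ _ _ (?R, ?S)")
    and K: "1 + t * germ_coeff K 0 0 = kappa d c t"
    by (rule finite_chart_strict_transform[OF D, of t A B]) (use pos in simp)
  have t0: "t \<noteq> 0" using t pos by (auto simp: zero_power)
  define E where "E = excp B (germ_const t + germ_Y)"
  have E0: "germ_coeff E 0 0 \<noteq> 0" using t0 by (simp add: E_def excp_def germ_coeff_const germ_coeff_one)
  \<comment> \<open>The old component's equation at the point, times the derivative of y^d at y =
    t.\<close>
  define z where "z = germ_coeff E 0 0 * of_nat d * t ^ (d - 1)"
  have td: "t ^ (d - 1) * t = 1" using t pos power_minus_mult[of d t] by simp
  have "kappa d c t * z = germ_coeff E 0 0 * of_nat d * (t ^ (d - 1) + germ_coeff K 0 0 * (t ^ (d - 1) * t))"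
    unfolding K[symmetric] z_def by (simp add: algebra_simps)
  then have kz: "kappa d c t * z = germ_coeff E 0 0 * of_nat d * (t ^ (d - 1) + germ_coeff K 0 0)"
    by (simp only: td mult_1_right)
  have "germ_coeff ?R 0 0 = 0" "germ_coeff ?S 0 0 = 0"
    using t by (simp_all add: germ_coeff_const germ_coeff_one)
  moreover have "germ_coeff ?R 1 0 = 0"
    using t unfolding E_def[symmetric] by (simp add: linear_part_simps)
  moreover have "germ_coeff ?R 0 1 = of_nat (A + B + d) * z"
    using t unfolding E_def[symmetric] by (simp add: linear_part_simps z_def)
  moreover have "germ_coeff ?S 1 0 = kappa d c t * z"
    using t unfolding E_def[symmetric] kz by (simp add: linear_part_simps algebra_simps)
  moreover have "z \<noteq> 0" using E0 t0 pos by (simp add: z_def)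
  ultimately show ?thesis using st that by blast
qed

text \<open>Off the strict transform \<open>F\<close> is a unit. The point is then regular, unless
  it is the corner with the old component y = 0, where the eigenvalue ratio is the negative rational
  - B / (A + B + \<mu>).\<close>

lemma finite_chart_harmless:
  assumes D: "corner_data d c N M h"
    and st: "strict_transform germ_X (germ_X * (germ_const t + germ_Y)) germ_X (corner (d * N) (d * M) A B h) W"
    and t: "\<not> (t = 0 \<and> N < M)" "\<not> (N = M \<and> t ^ d = 1)"
  shows "harmless W"
proof -
  have pos: "0 < d" "0 < N" "0 < M" "coprime N M" using D by (auto simp: corner_data_def)
  define \<mu> where "\<mu> = min (d * N) (d * M)"
  define F where "F = germ_X ^ (d * N - \<mu>) * (germ_const t + germ_Y) ^ (d * N) - germ_X ^ (d * M - \<mu>)"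
  have "0 < \<mu>" using pos by (simp add: \<mu>_def)
  then have C: "0 < A + B + \<mu>" by simp
  obtain K where W: "strict_transform germ_X (germ_X * (germ_const t + germ_Y)) germ_X (corner (d * N) (d * M) A B h)
    (excp B (germ_const t + germ_Y) * (of_nat (A + B + \<mu>) * F + germ_X * germ_dx F
        + (of_nat (d * N) - of_nat (d * M)) * (germ_const t + germ_Y) * K),
     excp B (germ_const t + germ_Y) * (germ_X * germ_dy F + of_nat (d * N) * germ_X * K) + of_nat B * germ_X * F)"
      (is "strict_transform _ _ _ _ (?R, ?S)") and K: "N \<noteq> M \<Longrightarrow> germ_coeff K 0 0 = 0"
    using finite_chart_strict_transform[OF D, of t A B] unfolding F_def \<mu>_def by metis
  have W: "W = (?R, ?S)" by (rule strict_transform_unique[OF st W]) simp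
  have F0: "germ_coeff F 0 0 \<noteq> 0"
  proof (cases N M rule: linorder_cases)
    case less
    then show ?thesis using pos t by (simp add: F_def \<mu>_def min_def zero_power germ_coeff_const)
  next
    case equal
    then have "N = 1" using pos by simp
    then show ?thesis using pos t equal by (simp add: F_def \<mu>_def germ_coeff_const germ_coeff_one)
  next
    case greater
    then show ?thesis using pos by (simp add: F_def \<mu>_def min_def zero_power germ_coeff_one)
  qed
  have R0: "germ_coeff ?R 0 0 = germ_coeff (excp B (germ_const t + germ_Y)) 0 0 * (of_nat (A + B + \<mu>) * germ_coeff F 0 0)"
    using K by (cases "N = M") (simp_all add: germ_coeff_of_nat)
  show ?thesis
  proof (cases "t = 0 \<and> 0 < B")
    case False
    then have "germ_coeff (excp B (germ_const t + germ_Y)) 0 0 \<noteq> 0"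
      by (auto simp: excp_def germ_coeff_const germ_coeff_one)
    then have "germ_coeff ?R 0 0 \<noteq> 0" unfolding R0 using F0 C by (simp del: of_nat_add)
    then have "\<not> singular W" by (simp only: W singular_def fst_conv) simp
    then show ?thesis by (rule not_singular_harmless)
  next
    case True
    then have E: "excp B (germ_const t + germ_Y) = germ_Y" by (simp add: excp_def)
    show ?thesis
      unfolding W E
    proof (rule diagonal_harmless)
      show "germ_coeff (germ_Y * (of_nat (A + B + \<mu>) * F + germ_X * germ_dx F
        + (of_nat (d * N) - of_nat (d * M)) * (germ_const t + germ_Y) * K)) 0 1 = of_nat (A + B + \<mu>) * germ_coeff F 0 0"
        using True by (simp add: linear_part_simps)
      show "germ_coeff (germ_Y * (germ_X * germ_dy F + of_nat (d * N) * germ_X * K) + of_nat B * germ_X * F) 1 0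
        = of_nat B * germ_coeff F 0 0"
        by (simp add: linear_part_simps)
      show "- (of_nat B * germ_coeff F 0 0) / (of_nat (A + B + \<mu>) * germ_coeff F 0 0) \<notin> pos_rats"
        using True C by (intro neg_ratio_not_pos_rats) auto
    qed (use True F0 C in \<open>simp_all add: linear_part_simps del: of_nat_add\<close>)
  qed
qed

text \<open>For N \<le> M the strict transform of f misses the direction of the y-axis. The point is
  regular if A = 0, and otherwise a corner with eigenvalue ratio - (A + B + \<mu>) / A.\<close>

lemma infinite_chart_harmless:
  assumes D: "corner_data d c N M h"
    and st: "strict_transform (germ_X * germ_Y) germ_Y germ_Y (corner (d * N) (d * M) A B h) W"
    and le: "N \<le> M"
  shows "harmless W"
proof -
  have pos: "0 < d" "0 < N" "0 < M" "coprime N M" using D by (auto simp: corner_data_def)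
  define \<mu> where "\<mu> = min (d * N) (d * M)"
  define F where "F = germ_Y ^ (d * N - \<mu>) - germ_X ^ (d * M) * germ_Y ^ (d * M - \<mu>)"
  have "0 < \<mu>" using pos by (simp add: \<mu>_def)
  then have C: "0 < A + B + \<mu>" by simp
  obtain K where W: "strict_transform (germ_X * germ_Y) germ_Y germ_Y (corner (d * N) (d * M) A B h)
    (excp A germ_X * (germ_Y * germ_dx F - of_nat (d * M) * germ_Y * K) + of_nat A * germ_Y * F,
     excp A germ_X * (of_nat (A + B + \<mu>) * F + germ_Y * germ_dy F + (of_nat (d * N) - of_nat (d * M)) * germ_X * K))"
      (is "strict_transform _ _ _ _ (?R, ?S)")
    using infinite_chart_strict_transform[OF D, of A B] unfolding F_def \<mu>_def by metis
  have W: "W = (?R, ?S)" by (rule strict_transform_unique[OF st W]) simp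
  have F0: "germ_coeff F 0 0 = 1"
    using pos le by (simp add: F_def \<mu>_def zero_power germ_coeff_one)
  show ?thesis
  proof (cases "A = 0")
    case True
    then have "germ_coeff ?S 0 0 = of_nat (A + B + \<mu>)"
      using F0 by (simp add: excp_def germ_coeff_of_nat del: of_nat_add)
    then have "germ_coeff ?S 0 0 \<noteq> 0" using C by (simp del: of_nat_add)
    then have "\<not> singular W" by (simp only: W singular_def snd_conv) simp
    then show ?thesis by (rule not_singular_harmless)
  next
    case False
    then have E: "excp A germ_X = germ_X" by (simp add: excp_def)
    show ?thesis
      unfolding W E
    proof (rule diagonal_harmless)
      show "germ_coeff (germ_X * (germ_Y * germ_dx F - of_nat (d * M) * germ_Y * K) + of_nat A * germ_Y * F) 0 1
          = of_nat A * 1"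
        using F0 by (simp add: linear_part_simps)
      show "germ_coeff (germ_X * (of_nat (A + B + \<mu>) * F + germ_Y * germ_dy F
          + (of_nat (d * N) - of_nat (d * M)) * germ_X * K)) 1 0 = of_nat (A + B + \<mu>) * 1"
        using F0 by (simp add: linear_part_simps)
      show "- (of_nat (A + B + \<mu>) * 1) / (of_nat A * 1) \<notin> (pos_rats :: complex set)"
        using False C by (intro neg_ratio_not_pos_rats) auto
    qed (use False F0 C in \<open>simp_all add: linear_part_simps del: of_nat_add\<close>)
  qed
qed

text \<open>A = 0 only at the origin, where n \<le> m.\<close>

definition corner_shape :: "nat \<Rightarrow> nat \<Rightarrow> nat \<Rightarrow> nat \<Rightarrow> bool" where
  "corner_shape n m A B \<longleftrightarrow> (if A = 0 then B = 0 \<and> 2 \<le> n \<and> n \<le> m else 0 < B \<or> 2 \<le> n)"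

text \<open>The linear part is nilpotent, so the process goes on at a corner form. In the excluded
  case n = m = 2 at the origin, f has a nondegenerate quadratic part.\<close>

lemma corner_nilpotent:
  assumes D: "corner_data d c N M h" and sh: "corner_shape (d * N) (d * M) A B"
    and no2: "\<not> (A = 0 \<and> d * N = 2 \<and> d * M = 2)"
  shows "singular (corner (d * N) (d * M) A B h)"
    "\<not> irreducible_singularity (corner (d * N) (d * M) A B h)"
proof -
  define n m where "n = d * N" and "m = d * M"
  have pos: "0 < n" "0 < m" using D by (auto simp: corner_data_def n_def m_def)
  obtain R S where RS: "corner n m A B h = (R, S)" by force
  have "germ_coeff R 0 0 = 0 \<and> germ_coeff S 0 0 = 0 \<and>
      germ_coeff S 0 1 * germ_coeff R 1 0 = germ_coeff S 1 0 * germ_coeff R 0 1 \<and>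
      germ_coeff R 0 1 = germ_coeff S 1 0"
  proof (cases "A = 0")
    case False
    show ?thesis
    proof (cases "B = 0")
      case True
      then have "2 \<le> n" using sh False by (simp add: corner_shape_def n_def)
      then show ?thesis
        using RS False True pos
        by (auto simp: corner_def excp_def Let_def linear_part_simps zero_power)
    next
      case B: False
      then show ?thesis
        using RS False pos
        by (auto simp: corner_def excp_def Let_def linear_part_simps zero_power)
    qed
  next
    case True
    then have nm: "B = 0" "2 \<le> n" "n \<le> m" using sh by (auto simp: corner_shape_def n_def m_def)
    then have m3: "3 \<le> m" using no2 True unfolding n_def m_def by linarith
    \<comment> \<open>A constant term of \<open>h\<close> would have weight n + m, which is below n
      m for n \<ge> 2 and m \<ge> 3.\<close>
    have "germ_coeff h 0 0 = 0"
    proof (rule ccontr)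
      assume "germ_coeff h 0 0 \<noteq> 0"
      then have "d * N * M \<le> N * (0 + 1) + M * (0 + 1)" using D unfolding corner_data_def by blast
      then have "d * (d * N * M) \<le> d * (N + M)" by (intro mult_le_mono) auto
      then have "n * m \<le> n + m" by (simp add: n_def m_def algebra_simps)
      moreover have "n * 3 \<le> n * m" "2 * m \<le> n * m" using m3 nm by (intro mult_le_mono; simp)+
      ultimately show False using m3 nm by linarith
    qed
    then show ?thesis
      using RS True nm m3 by (auto simp: corner_def excp_def Let_def linear_part_simps zero_power)
  qed
  then have "singular (R, S)" "\<not> irreducible_singularity (R, S)"
    using nilpotent_not_irreducible[of S R] by (simp_all add: singular_def)
  then show "singular (corner (d * N) (d * M) A B h)" "\<not> irreducible_singularity (corner (d * N) (d * M) A B h)"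
    using RS by (simp_all only: n_def m_def not_False_eq_True)
qed

section \<open>The double point n = m = 2\<close>

lemma germ_coeff_numeral: "germ_coeff (numeral k) i j = (if i = 0 \<and> j = 0 then numeral k else 0)"
  using germ_coeff_of_nat[of "numeral k"] by simp

text \<open>The determinant is 4 (h(0)^2 - 1) and the trace is - 4 h(0). So a saddle-node at the
  origin itself means that one of the two values 1 + h(0), 1 - h(0) of \<kappa> is zero.\<close>

lemma corner_2_2:
  "singular (corner 2 2 0 0 h)"
  "saddle_node (corner 2 2 0 0 h) \<longleftrightarrow> germ_coeff h 0 0 ^ 2 = 1"
proof -
  obtain R S where RS: "corner 2 2 0 0 h = (R, S)" by force
  have RS0: "germ_coeff R 0 0 = 0" "germ_coeff S 0 0 = 0" "germ_coeff R 1 0 = - 2" "germ_coeff S 0 1 = 2"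
    "germ_coeff R 0 1 = - 2 * germ_coeff h 0 0" "germ_coeff S 1 0 = 2 * germ_coeff h 0 0"
    using RS by (auto simp: corner_def excp_def Let_def linear_part_simps germ_coeff_numeral)
  show "singular (corner 2 2 0 0 h)" by (simp add: RS singular_def RS0)
  have iff: "germ_coeff S 0 1 * germ_coeff R 1 0 = germ_coeff S 1 0 * germ_coeff R 0 1 \<longleftrightarrow> germ_coeff h 0 0 ^ 2 = 1"
    unfolding RS0 by (auto simp: power2_eq_square)
  show "saddle_node (corner 2 2 0 0 h) \<longleftrightarrow> germ_coeff h 0 0 ^ 2 = 1"
  proof
    assume sq: "germ_coeff h 0 0 ^ 2 = 1"
    then have "germ_coeff h 0 0 \<noteq> 0" by auto
    then show "saddle_node (corner 2 2 0 0 h)"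
      unfolding RS using sq iff by (intro diagonal_saddle_node) (simp_all only: RS0; simp)+
  qed (use not_saddle_node_if_det[of S R] iff RS in auto)
qed

text \<open>Harmless points have no successors. Those of a corner form are harmless off the strict
  transform of f and again corner forms along Euclid's algorithm; where the branches separate, the
  hypothesis on \<kappa> makes them simple.\<close>

lemma reduction_point_cases:
  assumes "reduction_point W0 W ex ey"
    and "W0 = corner (d * N) (d * M) 0 0 h" "corner_data d c N M h" "corner_shape (d * N) (d * M) 0 0"
    and kappa: "\<And>t. t ^ d = 1 \<Longrightarrow> kappa d c t \<notin> neg_rats \<union> {0}"
  shows "harmless W \<or> (\<exists>N M A B h. W = corner (d * N) (d * M) A B h \<and> corner_data d c N M h \<and>
    corner_shape (d * N) (d * M) A B)"
  using assms(1)
proof (induction rule: reduction_point.induct)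
  case origin
  then show ?case using assms by blast
next
  case (finite_direction W ex ey t W')
  then have "\<not> harmless W" by (simp add: harmless_def)
  then obtain N M A B h where W: "W = corner (d * N) (d * M) A B h" and D: "corner_data d c N M h"
      and sh: "corner_shape (d * N) (d * M) A B"
    using finite_direction.IH by blast
  note st = finite_direction.hyps(4)[unfolded W]
  have pos: "0 < d" "0 < N" "0 < M" using D by (auto simp: corner_data_def)
  \<comment> \<open>In turn: the point continuing Euclid's algorithm, a point on a separated branch
    of f, and a point off the strict transform.\<close>
  consider "t = 0" "N < M" | "N = M" "t ^ d = 1" | "\<not> (t = 0 \<and> N < M)" "\<not> (N = M \<and> t ^ d = 1)" by blast
  then show ?case
  proof cases
    case 1
    obtain h' where h': "corner_data d c N (M - N) h'"
      "strict_transform germ_X (germ_X * (germ_const 0 + germ_Y)) germ_X (corner (d * N) (d * M) A B h)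
         (corner (d * N) (d * (M - N)) (A + B + d * N) B h')"
      by (rule finite_chart_corner[OF D 1(2)])
    have W': "W' = corner (d * N) (d * (M - N)) (A + B + d * N) B h'"
      by (rule strict_transform_unique[OF st[unfolded 1(1)] h'(2)]) simp
    moreover have "corner_shape (d * N) (d * (M - N)) (A + B + d * N) B"
      using sh pos by (auto simp: corner_shape_def split: if_splits)
    ultimately show ?thesis using h'(1) by blast
  next
    case 2
    obtain R S z where RS:
      "strict_transform germ_X (germ_X * (germ_const t + germ_Y)) germ_X (corner (d * N) (d * M) A B h) (R, S)"
      "germ_coeff R 0 0 = 0" "germ_coeff S 0 0 = 0" "germ_coeff R 1 0 = 0" "z \<noteq> 0"
      "germ_coeff R 0 1 = of_nat (A + B + d) * z" "germ_coeff S 1 0 = kappa d c t * z"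
      by (rule finite_chart_root[OF D 2])
    have W': "W' = (R, S)" by (rule strict_transform_unique[OF st RS(1)]) simp
    have k: "kappa d c t \<notin> neg_rats" "kappa d c t \<noteq> 0" using kappa[OF 2(2)] by auto
    have C: "0 < A + B + d" using pos by simp
    have "harmless (R, S)"
      using RS(5) C k(2)
      by (intro diagonal_harmless[OF RS(2,3) disjI1[OF RS(4)] RS(6,7) _ _ kappa_ratio_not_pos_rats[OF k(1) C RS(5)]])
        (simp_all del: of_nat_add)
    then show ?thesis by (simp add: W')
  next
    case 3
    then show ?thesis using finite_chart_harmless[OF D st] by blast
  qed
next
  case (infinite_direction W ex ey W')
  then have "\<not> harmless W" by (simp add: harmless_def)
  then obtain N M A B h where W: "W = corner (d * N) (d * M) A B h" and D: "corner_data d c N M h"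
      and sh: "corner_shape (d * N) (d * M) A B"
    using infinite_direction.IH by blast
  note st = infinite_direction.hyps(4)[unfolded W]
  have pos: "0 < d" "0 < N" "0 < M" using D by (auto simp: corner_data_def)
  show ?case
  proof (cases "N \<le> M")
    case True
    then show ?thesis using infinite_chart_harmless[OF D st] by blast
  next
    case False
    then have lt: "M < N" by simp
    obtain h' where h': "corner_data d c (N - M) M h'"
      "strict_transform (germ_X * germ_Y) germ_Y germ_Y (corner (d * N) (d * M) A B h)
         (corner (d * (N - M)) (d * M) A (A + B + d * M) h')"
      by (rule infinite_chart_corner[OF D lt])
    have W': "W' = corner (d * (N - M)) (d * M) A (A + B + d * M) h'"
      by (rule strict_transform_unique[OF st h'(2)]) simp
    moreover have "corner_shape (d * (N - M)) (d * M) A (A + B + d * M)"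
      using sh pos lt by (auto simp: corner_shape_def split: if_splits)
    ultimately show ?thesis using h'(1) by blast
  qed
qed

lemma kappa_2: "kappa 2 c t = 1 + c 1 * t"
proof -
  have "{0<..<2::nat} = {1}" by auto
  then show ?thesis by (simp add: kappa_def)
qed

lemma corner_data_2_2:
  assumes "corner_data d c N M h" "d * N = 2" "d * M = 2"
  shows "d = 2" "N = 1" "M = 1" "germ_coeff h 0 0 = c 1"
proof -
  have pos: "0 < d" "0 < N" "0 < M" "coprime N M" using assms by (auto simp: corner_data_def)
  have "d * N = d * M" using assms(2,3) by simp
  then have "N = M" using pos by simp
  then show NM: "N = 1" "M = 1" using pos by auto
  then show d: "d = 2" using assms(2) by simp
  have "\<forall>k. 0 < k \<and> k < d \<longrightarrow> germ_coeff h (k * M - 1) ((d - k) * N - 1) = c k"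
    using assms(1) unfolding corner_data_def by blast
  from this[rule_format, of 1] show "germ_coeff h 0 0 = c 1" by (simp add: d NM)
qed

lemma corner_generalized_curve:
  assumes D: "corner_data d c N M h" and sh: "corner_shape (d * N) (d * M) 0 0"
    and kappa: "\<And>t. t ^ d = 1 \<Longrightarrow> kappa d c t \<notin> neg_rats \<union> {0}"
  shows "generalized_curve (corner (d * N) (d * M) 0 0 h)"
  unfolding generalized_curve_def
proof (intro allI impI)
  fix W ex ey assume "reduction_point (corner (d * N) (d * M) 0 0 h) W ex ey"
  from reduction_point_cases[OF this refl D sh kappa]
  show "\<not> saddle_node W"
  proof
    assume "\<exists>N M A B h. W = corner (d * N) (d * M) A B h \<and> corner_data d c N M h \<and> corner_shape (d * N) (d * M) A B"
    then obtain N M A B h where W: "W = corner (d * N) (d * M) A B h" and D: "corner_data d c N M h"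
        and sh: "corner_shape (d * N) (d * M) A B" by blast
    show ?thesis
    proof (cases "A = 0 \<and> d * N = 2 \<and> d * M = 2")
      case True
      then have B: "B = 0" using sh by (simp add: corner_shape_def)
      from True have "d * N = 2" "d * M = 2" by auto
      note eq = corner_data_2_2[OF D this]
      \<comment> \<open>If c 1 had square 1, then t = - c 1 would be a square root of 1 at which
        \<kappa> vanishes.\<close>
      have "kappa d c (- c 1) = 1 - c 1 ^ 2" unfolding eq(1) kappa_2 by (simp add: power2_eq_square)
      then have "c 1 ^ 2 \<noteq> 1" using kappa[of "- c 1"] eq(1) by auto
      then show ?thesis using True B corner_2_2(2)[of h] by (simp add: W eq)
    next
      case False
      then show ?thesis using corner_nilpotent(2)[OF D sh] by (simp add: W irreducible_singularity_def)
    qed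
  next
    assume "harmless W"
    then show ?thesis unfolding harmless_def by blast
  qed
qed

text \<open>Euclid's algorithm decreases N + M and keeps \<open>d\<close> and \<open>c\<close>,
  hence \<kappa>. Once N = M, the point \<open>t\<close> has eigenvalues 0 and (A + B + d) z with z
  \<noteq> 0.\<close>

lemma corner_saddle_node_reached:
  assumes "reduction_point W0 (corner (d * N) (d * M) A B h) ex ey"
    and "corner_data d c N M h" "corner_shape (d * N) (d * M) A B"
    and t: "t ^ d = 1" "kappa d c t = 0"
  shows "\<exists>W ex ey. reduction_point W0 W ex ey \<and> saddle_node W"
  using assms(1-3)
proof (induction "N + M" arbitrary: N M A B h ex ey rule: less_induct)
  case less
  note rp = less.prems(1) and D = less.prems(2) and sh = less.prems(3)
  have pos: "0 < d" "0 < N" "0 < M" using D by (auto simp: corner_data_def)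
  show ?case
  proof (cases "A = 0 \<and> d * N = 2 \<and> d * M = 2")
    case True
    then have B: "B = 0" using sh by (simp add: corner_shape_def)
    from True have "d * N = 2" "d * M = 2" by auto
    note eq = corner_data_2_2[OF D this]
    \<comment> \<open>Here the origin itself is the saddle-node: \<kappa> = 0 at \<open>t\<close>
      forces h(0)^2 = 1.\<close>
    have "c 1 * t = - 1" using t(2) unfolding eq(1) kappa_2 by (simp add: eq_neg_iff_add_eq_0 add.commute)
    then have "(c 1 * t) ^ 2 = 1" by simp
    then have "c 1 ^ 2 = 1" using t(1) eq(1) by (simp add: power_mult_distrib)
    then have "saddle_node (corner (d * N) (d * M) A B h)"
      using True B corner_2_2(2)[of h] eq(4) by simp
    then show ?thesis using rp by blast
  next
    case False
    note sing = corner_nilpotent[OF D sh False]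
    show ?thesis
    proof (cases N M rule: linorder_cases)
      case lt: less
      obtain h' where h': "corner_data d c N (M - N) h'"
        "strict_transform germ_X (germ_X * (germ_const 0 + germ_Y)) germ_X (corner (d * N) (d * M) A B h)
           (corner (d * N) (d * (M - N)) (A + B + d * N) B h')"
        by (rule finite_chart_corner[OF D lt])
      have "corner_shape (d * N) (d * (M - N)) (A + B + d * N) B"
        using sh pos by (auto simp: corner_shape_def split: if_splits)
      then show ?thesis
        using less.hyps[OF _ finite_direction[OF rp sing h'(2)] h'(1)] pos lt by simp
    next
      case gt: greater
      obtain h' where h': "corner_data d c (N - M) M h'"
        "strict_transform (germ_X * germ_Y) germ_Y germ_Y (corner (d * N) (d * M) A B h)
           (corner (d * (N - M)) (d * M) A (A + B + d * M) h')"
        by (rule infinite_chart_corner[OF D gt])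
      have "corner_shape (d * (N - M)) (d * M) A (A + B + d * M)"
        using sh pos gt by (auto simp: corner_shape_def split: if_splits)
      then show ?thesis
        using less.hyps[OF _ infinite_direction[OF rp sing h'(2)] h'(1)] pos gt by simp
    next
      case eq: equal
      obtain R S z where RS:
        "strict_transform germ_X (germ_X * (germ_const t + germ_Y)) germ_X (corner (d * N) (d * M) A B h) (R, S)"
        "germ_coeff R 0 0 = 0" "germ_coeff S 0 0 = 0" "germ_coeff R 1 0 = 0" "z \<noteq> 0"
        "germ_coeff R 0 1 = of_nat (A + B + d) * z" "germ_coeff S 1 0 = kappa d c t * z"
        by (rule finite_chart_root[OF D eq t(1)])
      have "of_nat (A + B + d) * z \<noteq> 0" using pos RS(5) by (simp del: of_nat_add)
      then have "saddle_node (R, S)"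
        using RS(2-4,6,7) t(2) by (intro diagonal_saddle_node) (simp_all del: of_nat_add)
      then show ?thesis using finite_direction[OF rp sing RS(1)] by blast
    qed
  qed
qed

lemma corner_generalized_curve_iff:
  assumes D: "corner_data d c N M h" and sh: "corner_shape (d * N) (d * M) 0 0"
    and kappa: "\<And>t. t ^ d = 1 \<Longrightarrow> kappa d c t \<notin> neg_rats"
  shows "generalized_curve (corner (d * N) (d * M) 0 0 h) \<longleftrightarrow> (\<forall>t. t ^ d = 1 \<longrightarrow> kappa d c t \<notin> neg_rats \<union> {0})"
  using corner_generalized_curve[OF D sh] corner_saddle_node_reached[OF origin D sh] kappa
  unfolding generalized_curve_def by blast

section \<open>From corner data to the sum in the statement\<close>

lemma polynomial_part_coeff:
  assumes "i + 2 \<le> m" "j + 2 \<le> n"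
  shows "germ_coeff ((\<Sum>(i, j)\<in>{(i, j). i + 2 \<le> m \<and> j + 2 \<le> n}. germ_const (a i j) * germ_X ^ i * germ_Y ^ j)
      + (germ_Y ^ n - germ_X ^ m) * g) i j = a i j"
proof -
  let ?S = "{(i, j). i + 2 \<le> m \<and> j + 2 \<le> n}"
  have fin: "finite ?S" by (rule finite_subset[of _ "{..m} \<times> {..n}"]) auto
  have "germ_coeff (\<Sum>(i, j)\<in>?S. germ_const (a i j) * germ_X ^ i * germ_Y ^ j) i j
      = (\<Sum>x\<in>?S. if x = (i, j) then a i j else 0)"
    unfolding germ_coeff_sum by (intro sum.cong refl) (auto simp: germ_coeff_monomial split: if_splits)
  also have "\<dots> = a i j" using fin assms by simp
  finally show ?thesis
    using assms by (simp add: left_diff_distrib germ_coeff_X_power_mult germ_coeff_Y_power_mult)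
qed

theorem corollary3p6:
  fixes n m d p q :: nat
    and f g \<Delta> :: germ and W :: form and a :: "nat \<Rightarrow> nat \<Rightarrow> complex"
  assumes "0 < n" "n \<le> m"
    and "d = gcd n m"
    and "0 < p" "0 < q" "int m * int p - int n * int q = int d"
    and "f = germ_Y ^ n - germ_X ^ m"
    and "\<Delta> = (\<Sum>(i, j) \<in> {(i, j). i + 2 \<le> m \<and> j + 2 \<le> n}.
                germ_const (a i j) * germ_X ^ i * germ_Y ^ j)"
    and "W = differential f
             + form_scale (\<Delta> + f * g) (- of_nat m * germ_Y, of_nat n * germ_X)"
    and "foliation W \<in> Fol f"
    and "second_type W"
  shows "generalized_curve W \<longleftrightarrow>
    (\<forall>\<xi>::complex. \<xi> ^ d = 1 \<longrightarrow>
       1 + (\<Sum>(r, s) \<in> {(r, s). r + 2 \<le> m \<and> s + 2 \<le> n \<and> n * (r + 1) + m * (s + 1) = m * n}.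
              a r s * \<xi> powi (int p * (int r + 1) + int q * (int s + 1) - int q * int n))
       \<notin> neg_rats \<union> {0})"
proof -
  define h where "h = \<Delta> + f * g"
  have Wh: "W = qh_form n m h" using assms(9) by (simp add: qh_form_def h_def assms(7))
  have Fol: "foliation (qh_form n m h) \<in> Fol (germ_Y ^ n - germ_X ^ m)" using assms(10) by (simp add: Wh assms(7))
  have m: "0 < m" using assms(1,2) by simp
  have d: "0 < d" using assms(1,3) by simp
  define N M where "N = n div d" and "M = m div d"
  have nm: "n = d * N" "m = d * M" using assms(3) by (simp_all add: N_def M_def)
  have NM: "0 < N" "0 < M" using nm assms(1) m by auto
  have cop: "coprime N M" unfolding N_def M_def assms(3) using assms(1) by (intro div_gcd_coprime) auto
  \<comment> \<open>For n = 1 the dy coefficient would be a unit and the foliation regular.\<close>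
  have "n \<noteq> 1"
  proof
    assume "n = 1"
    then have "germ_coeff (snd (qh_form n m h)) 0 0 = 1"
      by (simp add: qh_form_def differential_def form_scale_def germ_dy_power germ_coeff_one)
    then show False using Fol_singular[OF Fol] by (simp add: singular_def)
  qed
  then have n2: "2 \<le> n" "2 \<le> m" using assms(1,2) by auto
  \<comment> \<open>Both summands are positive, so points on the Newton polygon lie in the box of
    \<Delta>, where multiples of f have no coefficients.\<close>
  have bnd: "r + 2 \<le> m \<and> s + 2 \<le> n" if "n * (r + 1) + m * (s + 1) = n * m" for r s
  proof -
    have "n * (r + 1) < n * m" "m * (s + 1) < m * n" using that assms(1) m by (auto simp: mult.commute)
    then have "r + 1 < m" "s + 1 < n" by (simp_all only: mult_less_cancel1)
    then show ?thesis by simp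
  qed
  have line: "n * (r + 1) + m * (s + 1) = n * m \<longleftrightarrow> (\<exists>k. 0 < k \<and> k < d \<and> r = k * M - 1 \<and> s = (d - k) * N - 1)" for r s
  proof -
    have "n * (r + 1) + m * (s + 1) = n * m \<longleftrightarrow> d * (N * (r + 1) + M * (s + 1)) = d * (d * N * M)"
      unfolding nm by (simp add: algebra_simps)
    also have "\<dots> \<longleftrightarrow> N * (r + 1) + M * (s + 1) = d * N * M" using d by (simp only: nat_mult_eq_cancel1)
    finally show ?thesis using line_iff[OF cop NM] by simp
  qed
  have coeff: "germ_coeff h r s = a r s" if "n * (r + 1) + m * (s + 1) = n * m" for r s
    using bnd[OF that] unfolding h_def assms(7,8) by (intro polynomial_part_coeff) auto
  define c where "c = (\<lambda>k. a (k * M - 1) ((d - k) * N - 1))"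
  have hc: "germ_coeff h (k * M - 1) ((d - k) * N - 1) = c k" if "0 < k" "k < d" for k
    using coeff line that unfolding c_def by blast
  have D: "corner_data d c N M h"
    unfolding corner_data_def
  proof (intro conjI allI impI)
    fix i j assume "germ_coeff h i j \<noteq> 0"
    then have "n * m \<le> n * (i + 1) + m * (j + 1)" using Fol_weight_ge[OF Fol assms(1) m] by blast
    then have "d * (d * N * M) \<le> d * (N * (i + 1) + M * (j + 1))" unfolding nm by (simp add: algebra_simps)
    then show "d * N * M \<le> N * (i + 1) + M * (j + 1)" using d by (simp only: nat_mult_le_cancel1)
  qed (use d NM cop hc in auto)
  have sh: "corner_shape (d * N) (d * M) 0 0"
    using n2 assms(2) unfolding corner_shape_def nm by simp
  have e: "n + m \<le> n * m"
  proof -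
    obtain n' m' where "n = Suc (Suc n')" "m = Suc (Suc m')"
      using n2 by (metis add_2_eq_Suc le_Suc_ex)
    then show ?thesis by simp
  qed
  have kappa: "kappa d c t \<notin> neg_rats" if t: "t ^ d = 1" for t
  proof -
    \<comment> \<open>A point of the weighted divisor above \<open>t\<close>: since v^n = t^d = 1,
      the exclusion of resonant nodes applies to it.\<close>
    obtain v where v: "v ^ N = t" using exists_complex_root[of N t] NM by auto
    then have vn: "v ^ n = 1" using t by (simp add: nm mult.commute[of d] power_mult)
    have "n * i + m * j = n * m - n - m \<longleftrightarrow> n * (i + 1) + m * (j + 1) = n * m" for i j
      using e by (simp add: algebra_simps) linarith
    then have "v * line_sum n m h (n * m - n - m) v
        = (\<Sum>k\<in>{0<..<d}. germ_coeff h (k * M - 1) ((d - k) * N - 1) * v ^ ((d - k) * N))"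
      using line by (intro line_sum_reindex assms(1) m NM) simp
    also have "\<dots> = (\<Sum>k\<in>{0<..<d}. c k * t ^ (d - k))"
      using hc by (intro sum.cong refl) (simp add: v[symmetric] power_mult[symmetric] mult.commute)
    finally show ?thesis using Fol_not_node[OF Fol n2 vn] by (simp add: kappa_def)
  qed
  have pq: "int M * int p - int N * int q = 1"
  proof -
    have "int d * (int M * int p - int N * int q) = int d * 1"
      using assms(6) unfolding nm by (simp add: algebra_simps)
    then show ?thesis using d by simp
  qed
  have sum: "1 + (\<Sum>(r, s) \<in> {(r, s). r + 2 \<le> m \<and> s + 2 \<le> n \<and> n * (r + 1) + m * (s + 1) = m * n}.
        a r s * \<xi> powi (int p * (int r + 1) + int q * (int s + 1) - int q * int n)) = kappa d c (inverse \<xi>)"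
    (is "1 + ?sum = _") if xi: "\<xi> ^ d = 1" for \<xi> :: complex
  proof -
    have xi0: "\<xi> \<noteq> 0" using xi d by (auto simp: zero_power)
    have set: "{(r, s). r + 2 \<le> m \<and> s + 2 \<le> n \<and> n * (r + 1) + m * (s + 1) = m * n}
        = (\<lambda>k. (k * M - 1, (d - k) * N - 1)) ` {0<..<d}"
    proof -
      have "r + 2 \<le> m \<and> s + 2 \<le> n \<and> n * (r + 1) + m * (s + 1) = n * m \<longleftrightarrow>
          (\<exists>k. 0 < k \<and> k < d \<and> r = k * M - 1 \<and> s = (d - k) * N - 1)" for r s
        using line[of r s] bnd[of r s] by blast
      then show ?thesis unfolding mult.commute[of m n] by auto
    qed
    have "?sum = (\<Sum>k\<in>{0<..<d}. c k * \<xi> powi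
        (int p * (int (k * M - 1) + 1) + int q * (int ((d - k) * N - 1) + 1) - int q * int n))"
      unfolding set sum.reindex[OF inj_on_line[OF NM(2)]] c_def by simp
    also have "\<dots> = (\<Sum>k\<in>{0<..<d}. c k * inverse \<xi> ^ (d - k))"
    proof (intro sum.cong refl)
      fix k assume k: "k \<in> {0<..<d}"
      have "0 < k * M" "0 < (d - k) * N" using k NM by auto
      then have pred: "int (k * M - 1) + 1 = int k * int M" "int ((d - k) * N - 1) + 1 = (int d - int k) * int N"
      proof -
        have pred: "int (x - 1) + 1 = int x" if "0 < x" for x using that by simp
        show "int (k * M - 1) + 1 = int k * int M" using pred[OF \<open>0 < k * M\<close>] by simp
        have "int ((d - k) * N) = (int d - int k) * int N" using k by (simp add: of_nat_diff)
        then show "int ((d - k) * N - 1) + 1 = (int d - int k) * int N"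
          using pred[OF \<open>0 < (d - k) * N\<close>] by (simp only:)
      qed
      \<comment> \<open>The subtracted q n cancels the summand q d N, and what remains is a multiple
        of M p - N q = 1.\<close>
      have "int p * (int (k * M - 1) + 1) + int q * (int ((d - k) * N - 1) + 1) - int q * int n
          = int k * (int M * int p - int N * int q)"
        unfolding pred by (simp add: nm algebra_simps)
      then have "int p * (int (k * M - 1) + 1) + int q * (int ((d - k) * N - 1) + 1) - int q * int n = int k"
        by (simp only: pq mult_1_right)
      moreover have "\<xi> ^ k = inverse \<xi> ^ (d - k)"
      proof -
        have "\<xi> ^ k * \<xi> ^ (d - k) = 1" using xi k by (simp flip: power_add)
        then show ?thesis using xi0 by (simp add: power_inverse field_simps)
      qed
      ultimately show "c k * \<xi> powi (int p * (int (k * M - 1) + 1) + int q * (int ((d - k) * N - 1) + 1) - int q * int n)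
          = c k * inverse \<xi> ^ (d - k)" by simp
    qed
    finally show ?thesis by (simp add: kappa_def)
  qed
  \<comment> \<open>Inversion permutes the d-th roots of unity.\<close>
  have inv: "(\<forall>\<xi>. \<xi> ^ d = 1 \<longrightarrow> P (inverse \<xi>)) \<longleftrightarrow> (\<forall>t. t ^ d = 1 \<longrightarrow> P t)" for P :: "complex \<Rightarrow> bool"
    by (metis inverse_1 inverse_inverse_eq power_inverse)
  have "generalized_curve W \<longleftrightarrow> (\<forall>t. t ^ d = 1 \<longrightarrow> kappa d c t \<notin> neg_rats \<union> {0})"
    using corner_generalized_curve_iff[OF D sh kappa] by (simp add: Wh corner_0_0 flip: nm)
  also have "\<dots> \<longleftrightarrow> (\<forall>\<xi>. \<xi> ^ d = 1 \<longrightarrow> kappa d c (inverse \<xi>) \<notin> neg_rats \<union> {0})"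
    by (rule inv[symmetric])
  finally show ?thesis using sum by simp
qed

end
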